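(* Let $k$ be a positive integer and let $S_k(x)=x(1+W_k(x))\bmod 1$ be an element of the family $\mathscr F$ (with $V=W_k$) for which $W_k(x)=A_k(\log^k 1/x)^{-1}$, with $A_k>0$, for all sufficiently small $x>0$. Let $\omega,\Omega\in\mathcal M$ be concave moduli of continuity such that, in a neighborhood of the origin ($x>0$), $$\omega(x)=(\log^k 1/x)^{-1}(\log 1/x)^{-1}(\log^2 1/x)^{-2},\qquad \Omega(x)=(\log^2 1/x)^{-1}.$$ Let $f:\mathbb T\to\mathbb R$ be a continuous potential with a positive multiple of $\omega$ as modulus of continuity, i.e. $f\in\mathscr C_\omega(\mathbb T)$. Then a Ruelle-Perron-Frobenius theorem holds for the transfer operator $\mathscr L_f$ on $\mathscr C_\Omega(\mathbb T)$, that is: (i) there are a Borel probability measure $\nu$ on $\mathbb T$ and a constant $\chi>0$ with $\mathscr L_f^*\nu=\chi\nu$; (ii) $\chi$ is a simple eigenvalue of $\mathscr L_f$, and there is a positive function $h\in\mathscr C_\Omega(\mathbb T)$ with $\mathscr L_fh=\chi h$; (iii) $\mathscr L_f$, acting on complex-valued continuous functions, has no eigenvalue $c\ne\chi$ with $|c|\ge\chi$; (iv) if $h$ is normalized by $\int h\,d\nu=1$, then for every continuous $\phi$ the sequence $\chi^{-n}\mathscr L_f^n\phi$ converges uniformly on $\mathbb T$ to $h\int\phi\,d\nu$. In addition, existence and uniqueness of the Gibbs-equilibrium state associated with $f$ hold: with $\int h\,d\nu=1$, $\mu=h\nu$ is an $S_k$-invariant probability with $h_\mu(S_k)+\int f\,d\mu=\log\chi=P(S_k,f)$;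 $h_m(S_k)+\int f\,dm<P(S_k,f)$ for every $m\in M(\mathbb T,S_k)$ with $m\neq\mu$; and for every sufficiently small $r>0$ there is $K_r>0$ such that, for all $x\in\mathbb T$ and $n\ge1$, $$K_r^{-1}\le\frac{\mu\big(\{y\in\mathbb T: d(S_k^j(x),S_k^j(y))<r,\ 0\le j\le n\}\big)}{e^{S_nf(x)-nP(S_k,f)}}\le K_r,$$ where $S_nf=\sum_{j=0}^{n-1}f\circ S_k^j$ denotes the Birkhoff sum of $f$.
   Context: $\mathbb T=\mathbb R/\mathbb Z=[0,1)$ is the circle with metric $d(x,y)=\min\{|x-y|,|x-y\pm1|\}$. Here $\log^k$ denotes the $k$-fold composition of the logarithm function (so $\log^1=\log$, $\log^2=\log\circ\log$), and $\log^k 1/x$ means $\log^k(1/x)$. The symbol $S_k^j$ denotes the $j$-th iterate of the map $S_k$. Family $\mathscr F$: all continuous maps $T:\mathbb T\to\mathbb T$ of the form $T(x)=x(1+V(x))\bmod 1$ for $x\in[0,1)$, where $V:[0,+\infty)\to[0,+\infty)$ is continuous and increasing, $V(0)=0$ (so $0$ is an indifferent fixed point), $V(1)$ is a positive integer, and for some $\sigma\ge0$ one has $\lim_{x\to0}V(tx)/V(x)=t^\sigma$ for all $t>0$. $\mathcal M$ is the set of all concave moduli of continuity, i.e. concave, continuous, non-decreasing functions $\omega:[0,+\infty)\to[0,+\infty)$ with $\omega(0)=0$. For $\omega\in\mathcal M$, $\mathscr C_\omega(\mathbb T)$ is the linear space of functions $\varphi:\mathbb T\to\mathbb R$ for which there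 is $C>0$ with $|\varphi(x)-\varphi(y)|\le C\,\omega(d(x,y))$ for all $x,y\in\mathbb T$. Transfer operator: $\mathscr L_f\phi(x)=\sum_{y\in S_k^{-1}(x)}e^{f(y)}\phi(y)$ for continuous $\phi$. The dual $\mathscr L_f^*$ acts on finite signed Borel measures by $\int\phi\,d(\mathscr L_f^*m)=\int\mathscr L_f\phi\,dm$ for all continuous $\phi$. $M(\mathbb T,S_k)$ is the set of $S_k$-invariant Borel probability measures, $h_m(S_k)$ is the metric entropy, and $P(S_k,f)=\sup_{m\in M(\mathbb T,S_k)}\{h_m(S_k)+\int f\,dm\}$ is the topological pressure. The measure $h\nu$ is the one with density $h$ with respect to $\nu$. *)

theory Defs
  imports "HOL-Probability.Probability"
begin

typedef circle = "{0..<1::real}"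
  morphisms crep Abs_circle
  by (rule exI[of _ 0]) simp

definition to_circle :: "real \<Rightarrow> circle" where
  "to_circle t = Abs_circle (frac t)"

instantiation circle :: metric_space
begin

definition dist_circle :: "circle \<Rightarrow> circle \<Rightarrow> real" where
  "dist_circle x y = Min {\<bar>crep x - crep y\<bar>, \<bar>crep x - crep y + 1\<bar>, \<bar>crep x - crep y - 1\<bar>}"

definition uniformity_circle :: "(circle \<times> circle) filter" where
  "uniformity_circle = (INF e\<in>{0<..}. principal {(x, y). dist x y < e})"

definition open_circle :: "circle set \<Rightarrow> bool" where
  "open_circle U \<longleftrightarrow> (\<forall>x\<in>U. \<forall>\<^sub>F (x', y) in uniformity. x' = x \<longrightarrow> y \<in> U)"

instance
proof
  have range: "0 \<le> crep x" "crep x < 1" for x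
    using crep[of x] by auto
  show "dist x y = 0 \<longleftrightarrow> x = y" for x y :: circle
  proof -
    have "dist x y = 0 \<longleftrightarrow> crep x = crep y"
      using range[of x] range[of y] unfolding dist_circle_def by (auto simp: min_def)
    then show ?thesis by (simp add: crep_inject)
  qed
  show "dist x y \<le> dist x z + dist y z" for x y z :: circle
    using range[of x] range[of y] range[of z]
    unfolding dist_circle_def by (simp add: min_def abs_if)
qed (auto simp: uniformity_circle_def open_circle_def)

end

definition circle_map :: "(real \<Rightarrow> real) \<Rightarrow> circle \<Rightarrow> circle" where
  "circle_map V x = to_circle (crep x * (1 + V (crep x)))"

text \<open>\<^term>\<open>V\<close> is a function on \<open>[0, \<infinity>)\<close>; its values at negative arguments are irrelevant.\<close>

definition admissible_factor :: "(real \<Rightarrow> real) \<Rightarrow> bool" where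
  "admissible_factor V \<longleftrightarrow>
     (\<forall>x\<ge>0. 0 \<le> V x) \<and> continuous_on {0..} V \<and> strict_mono_on {0..} V \<and> V 0 = 0 \<and>
     (\<exists>N::nat. N > 0 \<and> V 1 = real N) \<and>
     (\<exists>\<sigma>\<ge>0. \<forall>t>0. ((\<lambda>x. V (t * x) / V x) \<longlongrightarrow> t powr \<sigma>) (at_right 0))"

definition in_family :: "(circle \<Rightarrow> circle) \<Rightarrow> (real \<Rightarrow> real) \<Rightarrow> bool" where
  "in_family T V \<longleftrightarrow> continuous_on UNIV T \<and> admissible_factor V \<and> T = circle_map V"

definition concave_moduli :: "(real \<Rightarrow> real) set" where
  "concave_moduli =
     {\<omega>. (\<forall>x\<ge>0. 0 \<le> \<omega> x) \<and> concave_on {0..} \<omega> \<and> continuous_on {0..} \<omega> \<and>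
          mono_on {0..} \<omega> \<and> \<omega> 0 = 0}"

definition modulus_space :: "(real \<Rightarrow> real) \<Rightarrow> (circle \<Rightarrow> real) set" where
  "modulus_space \<omega> = {\<phi>. \<exists>C>0. \<forall>x y. \<bar>\<phi> x - \<phi> y\<bar> \<le> C * \<omega> (dist x y)}"

text \<open>The iterated logarithm is the genuine one only where all intermediate values are positive,
  that is, for large arguments. It is only ever used at \<open>1 / x\<close> for small positive \<open>x\<close>.\<close>

definition iter_log :: "nat \<Rightarrow> real \<Rightarrow> real" where
  "iter_log k = (ln ^^ k)"

definition transfer_op ::
  "(circle \<Rightarrow> circle) \<Rightarrow> (circle \<Rightarrow> real) \<Rightarrow> (circle \<Rightarrow> 'a::real_vector) \<Rightarrow> circle \<Rightarrow> 'a" where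
  "transfer_op T f \<phi> x = (\<Sum>y \<in> T -` {x}. exp (f y) *\<^sub>R \<phi> y)"

text \<open>The fibres of the maps in the family are finite, so that no sum degenerates to 0.\<close>

lemma in_family_finite_fibre:
  assumes "in_family T V"
  shows "finite (T -` {x})"
proof -
  define g where "g s = s * (1 + V s)" for s
  have V: "\<And>s. s \<ge> 0 \<Longrightarrow> 0 \<le> V s" "strict_mono_on {0..} V" and T: "T = circle_map V"
    using assms by (auto simp: in_family_def admissible_factor_def)
  have Vle: "V s \<le> V t" if "0 \<le> s" "s \<le> t" for s t
    using V(2) that by (cases "s = t") (auto simp: strict_mono_on_def less_eq_real_def)
  have mono: "g s < g t" if "0 \<le> s" "s < t" for s t
    unfolding g_def using that Vle[of s t] V(1)[of s]
    by (intro mult_less_le_imp_less) auto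
  have rng: "0 \<le> crep y" "crep y < 1" for y
    using crep[of y] by auto
  have inj: "inj (\<lambda>y. g (crep y))"
  proof (rule injI)
    fix y z assume "g (crep y) = g (crep z)"
    then have "crep y = crep z"
      using mono[of "crep y" "crep z"] mono[of "crep z" "crep y"] rng[of y] rng[of z]
      by (cases "crep y" "crep z" rule: linorder_cases) auto
    then show "y = z" by (simp add: crep_inject)
  qed
  have "(\<lambda>y. g (crep y)) ` (T -` {x}) \<subseteq> (\<lambda>i. of_int i + crep x) ` {0..\<lfloor>g 1\<rfloor>}"
  proof (rule image_subsetI)
    fix y assume "y \<in> T -` {x}"
    then have "Abs_circle (frac (g (crep y))) = x"
      by (auto simp: T circle_map_def to_circle_def g_def)
    then have "crep x = frac (g (crep y))"
      by (auto simp: Abs_circle_inverse frac_lt_1)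
    then have "g (crep y) = of_int \<lfloor>g (crep y)\<rfloor> + crep x"
      by (simp add: frac_def)
    moreover have "0 \<le> g (crep y)" "g (crep y) \<le> g 1"
      using mono[of "crep y" 1] rng[of y] V(1)[of "crep y"] by (auto simp: g_def)
    ultimately show "g (crep y) \<in> (\<lambda>i. of_int i + crep x) ` {0..\<lfloor>g 1\<rfloor>}"
      by (intro image_eqI[of _ _ "\<lfloor>g (crep y)\<rfloor>"]) (auto intro: floor_mono)
  qed
  then have "finite ((\<lambda>y. g (crep y)) ` (T -` {x}))"
    by (rule finite_subset) auto
  then show ?thesis
    using inj by (metis finite_imageD inj_on_subset subset_UNIV)
qed

text \<open>\<open>dual_transfer T f m m'\<close> says that the dual operator sends the measure \<open>m\<close> to \<open>m'\<close>. Only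
  finite positive measures are needed: the operator is positive, hence so is its dual.\<close>

definition dual_transfer ::
  "(circle \<Rightarrow> circle) \<Rightarrow> (circle \<Rightarrow> real) \<Rightarrow> circle measure \<Rightarrow> circle measure \<Rightarrow> bool" where
  "dual_transfer T f m m' \<longleftrightarrow>
     sets m = sets borel \<and> finite_measure m \<and> sets m' = sets borel \<and> finite_measure m' \<and>
     (\<forall>\<phi>::circle \<Rightarrow> real. continuous_on UNIV \<phi> \<longrightarrow>
        integral\<^sup>L m' \<phi> = integral\<^sup>L m (transfer_op T f \<phi>))"

definition is_eigenvalue ::
  "('x \<Rightarrow> 'b::field) set \<Rightarrow> (('x \<Rightarrow> 'b) \<Rightarrow> 'x \<Rightarrow> 'b) \<Rightarrow> 'b \<Rightarrow> bool" where
  "is_eigenvalue F L c \<longleftrightarrow> (\<exists>g\<in>F. g \<noteq> (\<lambda>_. 0) \<and> L g = (\<lambda>x. c * g x))"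

text \<open>Simplicity is algebraic: the generalised eigenspace is one-dimensional.\<close>

definition generalised_eigenspace ::
  "('x \<Rightarrow> 'b::field) set \<Rightarrow> (('x \<Rightarrow> 'b) \<Rightarrow> 'x \<Rightarrow> 'b) \<Rightarrow> 'b \<Rightarrow> ('x \<Rightarrow> 'b) set" where
  "generalised_eigenspace F L c =
     {\<phi>\<in>F. \<exists>n. ((\<lambda>\<psi> x. L \<psi> x - c * \<psi> x) ^^ n) \<phi> = (\<lambda>_. 0)}"

definition is_simple_eigenvalue ::
  "('x \<Rightarrow> 'b::field) set \<Rightarrow> (('x \<Rightarrow> 'b) \<Rightarrow> 'x \<Rightarrow> 'b) \<Rightarrow> 'b \<Rightarrow> bool" where
  "is_simple_eigenvalue F L c \<longleftrightarrow>
     is_eigenvalue F L c \<and> (\<exists>g. generalised_eigenspace F L c = {\<lambda>x. a * g x | a. True})"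

definition invariant_probs :: "('a::topological_space \<Rightarrow> 'a) \<Rightarrow> 'a measure set" where
  "invariant_probs T = {m. sets m = sets borel \<and> prob_space m \<and> T \<in> m \<rightarrow>\<^sub>M m \<and> distr m m T = m}"

definition finite_partition :: "'a measure \<Rightarrow> 'a set set \<Rightarrow> bool" where
  "finite_partition m P \<longleftrightarrow> finite P \<and> P \<subseteq> sets m \<and> partition_on (space m) P"

definition partition_entropy :: "'a measure \<Rightarrow> 'a set set \<Rightarrow> real" where
  "partition_entropy m P = - (\<Sum>A\<in>P. measure m A * ln (measure m A))"

text \<open>\<open>refined_partition m T P n\<close> is the join of the preimages of \<open>P\<close> under the iterates
  \<open>T^j\<close> with \<open>j < n\<close>. It may contain the empty set, which does not contribute to the entropy.\<close>

primrec refined_partition :: "'a measure \<Rightarrow> ('a \<Rightarrow> 'a) \<Rightarrow> 'a set set \<Rightarrow> nat \<Rightarrow> 'a set set" where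
  "refined_partition m T P 0 = {space m}"
| "refined_partition m T P (Suc n) =
     {A \<inter> (T -` B \<inter> space m) | A B. A \<in> P \<and> B \<in> refined_partition m T P n}"

text \<open>For \<open>T\<close>-invariant \<open>m\<close> the limit exists by subadditivity; for other \<open>m\<close> the value is
  not meaningful.\<close>

definition entropy_wrt_partition :: "'a measure \<Rightarrow> ('a \<Rightarrow> 'a) \<Rightarrow> 'a set set \<Rightarrow> real" where
  "entropy_wrt_partition m T P =
     lim (\<lambda>n. partition_entropy m (refined_partition m T P n) / real n)"

definition metric_entropy :: "'a measure \<Rightarrow> ('a \<Rightarrow> 'a) \<Rightarrow> ereal" where
  "metric_entropy m T = (SUP P\<in>{P. finite_partition m P}. ereal (entropy_wrt_partition m T P))"

definition pressure :: "('a::topological_space \<Rightarrow> 'a) \<Rightarrow> ('a \<Rightarrow> real) \<Rightarrow> ereal" where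
  "pressure T f = (SUP m\<in>invariant_probs T. metric_entropy m T + ereal (integral\<^sup>L m f))"

definition birkhoff_sum :: "('a \<Rightarrow> 'a) \<Rightarrow> ('a \<Rightarrow> real) \<Rightarrow> nat \<Rightarrow> 'a \<Rightarrow> real" where
  "birkhoff_sum T f n x = (\<Sum>j<n. f ((T ^^ j) x))"

definition dynamical_ball :: "('a::metric_space \<Rightarrow> 'a) \<Rightarrow> nat \<Rightarrow> real \<Rightarrow> 'a \<Rightarrow> 'a set" where
  "dynamical_ball T n r x = {y. \<forall>j\<le>n. dist ((T ^^ j) x) ((T ^^ j) y) < r}"

definition gibbs_bounds ::
  "('a::metric_space \<Rightarrow> 'a) \<Rightarrow> ('a \<Rightarrow> real) \<Rightarrow> real \<Rightarrow> 'a measure \<Rightarrow> bool" where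
  "gibbs_bounds T f p \<mu> \<longleftrightarrow>
     (\<forall>\<^sub>F r in at_right 0. \<exists>K>0. \<forall>x. \<forall>n\<ge>1.
        1 / K \<le> measure \<mu> (dynamical_ball T n r x) / exp (birkhoff_sum T f n x - real n * p) \<and>
        measure \<mu> (dynamical_ball T n r x) / exp (birkhoff_sum T f n x - real n * p) \<le> K)"

end

theory Submission
  imports Defs "HOL-Real_Asymp.Real_Asymp"
begin

text \<open>
  The map expands every arc, but an arc of length \<open>d\<close> to the right of the fixed point only
  by the factor \<open>1 + W d\<close>, which tends to 1 with \<open>d\<close>. The size of \<open>d\<close> is therefore measured by the gauge
  \<open>\<Psi> d = C / ln (ln (c / d))\<close>. In the variable \<open>u = ln (c / d)\<close> one step of the map moves \<open>u\<close> by
  about \<open>W d\<close> and the gauge has derivative of size \<open>1 / (u (ln u)\<^sup>2)\<close>; so the gain of \<open>\<Psi>\<close> in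
  one step is at least of the order of \<open>W d / (u (ln u)\<^sup>2)\<close>, which is the order of \<open>\<omega> d\<close>. If \<open>d'\<close> is
  the distance of two corresponding preimages of points at distance \<open>d\<close>, then the variation of \<open>f\<close>
  between the preimages is at most \<open>\<Psi> d - \<Psi> d'\<close>. This is the axiom \<open>key\<close> of the locale
  \<open>transfer_cone\<close>, verified in \<open>transfer_coneI\<close>; the modulus \<open>\<omega>\<close> enters only there.

  First consequence: the cone of positive functions with \<open>\<phi> x \<le> \<phi> y * exp (\<Psi> (dist x y))\<close> is mapped
  into itself (\<open>cone_L\<close>). The map is not strict, and no spectral gap is to be expected. But ratios
  of iterates of functions in the cone are equicontinuous, and the map is topologically exact
  (\<open>covering\<close>), which makes the oscillation of such ratios tend to 0 uniformly over bounded parts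
  of the cone (\<open>ratio_contraction\<close>). A weak limit of normalised iterates of the dual operator
  gives the conformal measure; the uniformity makes \<open>L\<^sup>n 1 / \<rho>\<^sup>n\<close> a uniform Cauchy sequence, whose
  limit is the eigenfunction \<open>h\<close>, and yields the convergence of \<open>L\<^sup>n \<phi> / \<rho>\<^sup>n\<close> (\<open>convergence\<close>). The claims
  on the spectrum follow from this convergence alone. Since \<open>h\<close> lies in the cone and \<open>\<Psi>\<close> is
  bounded by a multiple of \<open>\<Omega>\<close>, \<open>h\<close> has modulus of continuity \<open>\<Omega>\<close>.

  Second consequence: along an orbit the differences \<open>\<Psi> d - \<Psi> d'\<close> telescope, so Birkhoff sums have
  bounded distortion on dynamical balls and on cylinders. This gives the Gibbs property.

  For the variational principle let \<open>lg\<close> be the logarithm of the weights normalised by \<open>h\<close> and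
  \<open>\<rho>\<close>, which sum to 1 over each fibre. For an invariant probability \<open>m\<close> the entropy is computed by the
  partition into branches, as this is generating (\<open>metric_entropy_generating\<close>). Its entropy
  increments plus the integral of \<open>lg\<close> are minus the relative entropy of the conditional
  probabilities of \<open>m\<close> with respect to the normalised weights, up to the oscillation of \<open>lg\<close> on long
  cylinders; so the limit is at most 0. If it is 0, then relative entropy controls total variation and
  forces \<open>m\<close> to be invariant under the normalised operator, whose iterates converge to the integral
  with respect to \<open>mu\<close>; hence \<open>m = mu\<close>. That \<open>mu\<close> attains 0 follows from bounded distortion on
  cylinders.
\<close>

section \<open>The circle as a quotient of the line\<close>

lemma crep_bounds: "0 \<le> crep x" "crep x < 1"
  using crep[of x] by auto

lemma crep_to_circle: "crep (to_circle t) = frac t"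
  by (simp add: to_circle_def Abs_circle_inverse frac_lt_1)

lemma to_circle_crep [simp]: "to_circle (crep x) = x"
  using crep_bounds[of x] by (simp add: to_circle_def crep_inverse frac_eq_id)

lemma to_circle_add_int [simp]: "to_circle (t + of_int n) = to_circle t"
  by (simp add: to_circle_def)

lemma to_circle_eq_iff: "to_circle s = to_circle t \<longleftrightarrow> (\<exists>n. s = t + of_int n)"
proof
  assume "to_circle s = to_circle t"
  then have "frac s = frac t" by (metis crep_to_circle)
  then have "s = t + of_int (\<lfloor>s\<rfloor> - \<lfloor>t\<rfloor>)" by (simp add: frac_def)
  then show "\<exists>n. s = t + of_int n" ..
qed auto

lemma dist_circle_eq:
  "dist x y = Min {\<bar>crep x - crep y\<bar>, \<bar>crep x - crep y + 1\<bar>, \<bar>crep x - crep y - 1\<bar>}"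
  by (simp add: dist_circle_def)

lemma dist_circle_le_half: "dist (x::circle) y \<le> 1 / 2"
  using crep_bounds[of x] crep_bounds[of y] unfolding dist_circle_eq
  by (auto simp: min_def abs_if)

lemma dist_to_circle_le: "dist (to_circle s) (to_circle t) \<le> \<bar>s - t\<bar>"
proof (cases "\<bar>s - t\<bar> < 1")
  case True
  define n where "n = \<lfloor>s\<rfloor> - \<lfloor>t\<rfloor>"
  have e: "s - t = frac s - frac t + of_int n"
    by (simp add: frac_def n_def)
  have fr: "0 \<le> frac s" "frac s < 1" "0 \<le> frac t" "frac t < 1"
    by (auto simp: frac_lt_1)
  then have "of_int n < (2::real)" "of_int n > (-2::real)" using e True by linarith+
  then have "n = -1 \<or> n = 0 \<or> n = 1" by linarith
  then show ?thesis
    using e fr unfolding dist_circle_eq crep_to_circle by (auto simp: min_def)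
next
  case False
  then show ?thesis using dist_circle_le_half[of "to_circle s" "to_circle t"] by linarith
qed

lemma dist_circle_lift:
  obtains b where "to_circle b = y" "\<bar>crep x - b\<bar> = dist x y"
proof -
  have "dist x y \<in> {\<bar>crep x - crep y\<bar>, \<bar>crep x - crep y + 1\<bar>, \<bar>crep x - crep y - 1\<bar>}"
    unfolding dist_circle_eq by (rule Min_in) auto
  then consider "dist x y = \<bar>crep x - crep y\<bar>" | "dist x y = \<bar>crep x - (crep y - 1)\<bar>"
    | "dist x y = \<bar>crep x - (crep y + 1)\<bar>" by (auto simp: algebra_simps)
  then show ?thesis
  proof cases
    case 2
    then show ?thesis using that[of "crep y - 1"] to_circle_add_int[of "crep y" "-1"] by simp
  next
    case 3
    then show ?thesis using that[of "crep y + 1"] to_circle_add_int[of "crep y" "1"] by simp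
  qed (use that[of "crep y"] in simp)
qed

lemma dist_to_circle_eq:
  assumes "\<bar>s - t\<bar> \<le> 1 / 2"
  shows "dist (to_circle s) (to_circle t) = \<bar>s - t\<bar>"
proof (rule antisym[OF dist_to_circle_le])
  let ?x = "to_circle s" and ?y = "to_circle t"
  obtain b where b: "to_circle b = ?y" "\<bar>crep ?x - b\<bar> = dist ?x ?y"
    using dist_circle_lift .
  obtain m where m: "crep ?x = s + of_int m"
    using to_circle_eq_iff[of "crep ?x" s] by auto
  obtain n where n: "b = t + of_int n" using b(1) to_circle_eq_iff by blast
  have e: "dist ?x ?y = \<bar>s - t + of_int (m - n)\<bar>" using b(2) m n by simp
  show "\<bar>s - t\<bar> \<le> dist ?x ?y"
  proof (cases "m = n")
    case False
    then have "1 \<le> \<bar>of_int (m - n) :: real\<bar>" by linarith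
    then show ?thesis unfolding e using assms by linarith
  qed (simp add: e)
qed

lemma continuous_to_circle: "continuous_on S to_circle"
proof -
  have "1-lipschitz_on S to_circle"
    by (rule lipschitz_onI) (use dist_to_circle_le in \<open>auto simp: dist_real_def\<close>)
  then show ?thesis by (rule lipschitz_on_continuous_on)
qed

lemma compact_circle: "compact (UNIV :: circle set)"
proof -
  have "to_circle ` {0..1} = UNIV"
    using crep_bounds by (auto intro!: image_eqI[of _ to_circle "crep _"] simp: less_imp_le)
  moreover have "compact (to_circle ` {0..1})"
    by (intro compact_continuous_image continuous_to_circle) auto
  ultimately show ?thesis by simp
qed

lemma circle_bounded:
  fixes \<phi> :: "circle \<Rightarrow> real"
  assumes "continuous_on UNIV \<phi>"
  obtains B where "0 < B" "\<And>x. norm (\<phi> x) \<le> B"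
proof -
  have "bounded (range \<phi>)"
    using assms by (intro compact_imp_bounded compact_continuous_image compact_circle)
  then show ?thesis using that by (auto simp: bounded_pos)
qed

text \<open>The representative jumps only at the point \<open>to_circle 0\<close>: elsewhere, the lift of a nearby
  point that realises the distance stays in the fundamental interval.\<close>

lemma isCont_crep:
  assumes "x \<noteq> to_circle 0"
  shows "isCont crep x"
proof -
  have "crep x \<noteq> 0" using assms by (metis to_circle_crep)
  then have r: "0 < crep x" "crep x < 1" using crep_bounds[of x] by auto
  define r where "r = min (crep x) (1 - crep x)"
  have "r > 0" using r by (simp add: r_def)
  have eq: "dist (crep y) (crep x) = dist y x" if "dist y x < r" for y
  proof -
    obtain b where b: "to_circle b = y" "\<bar>crep x - b\<bar> = dist x y" using dist_circle_lift .
    then have "0 \<le> b" "b < 1" using that by (auto simp: dist_commute r_def abs_if split: if_splits)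
    then have "crep y = b" using crep_to_circle[of b] b(1) by (simp add: frac_eq_id)
    then show ?thesis using b(2) by (simp add: dist_real_def dist_commute)
  qed
  show ?thesis
    unfolding continuous_at_eps_delta
  proof (intro allI impI)
    fix e :: real assume "e > 0"
    then show "\<exists>d>0. \<forall>y. dist y x < d \<longrightarrow> dist (crep y) (crep x) < e"
      using \<open>r > 0\<close> eq by (intro exI[of _ "min e r"]) auto
  qed
qed

lemma crep_borel_measurable [measurable]: "crep \<in> borel_measurable borel"
proof (rule borel_measurable_continuous_countable_exceptions[of "{to_circle 0}"])
  show "continuous_on (- {to_circle 0}) crep"
    using isCont_crep by (auto intro!: continuous_at_imp_continuous_on)
qed auto

section \<open>The lift of the map and its inverse\<close>

locale circle_factor =
  fixes V :: "real \<Rightarrow> real"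
  assumes admissible: "admissible_factor V"
begin

definition N :: nat where "N = nat \<lfloor>V 1\<rfloor>"

lemma V_nonneg: "0 \<le> x \<Longrightarrow> 0 \<le> V x"
  and V_0 [simp]: "V 0 = 0"
  and V_cont: "continuous_on {0..} V"
  and V_1: "V 1 = real N"
  using admissible unfolding admissible_factor_def N_def by auto

lemma V_less: "0 \<le> x \<Longrightarrow> x < y \<Longrightarrow> V x < V y"
  using admissible unfolding admissible_factor_def by (auto simp: strict_mono_on_def)

lemma V_mono: "0 \<le> x \<Longrightarrow> x \<le> y \<Longrightarrow> V x \<le> V y"
  using V_less[of x y] by (cases "x = y") auto

definition g :: "real \<Rightarrow> real" where "g s = s * (1 + V s)"

text \<open>The lift of the circle map to the line; it has degree \<open>N + 1\<close>.\<close>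

definition G :: "real \<Rightarrow> real" where
  "G s = real (N + 1) * of_int \<lfloor>s\<rfloor> + g (frac s)"

text \<open>Half the expansion rate at half the distance is a lower bound for the expansion of an
  arc also when the arc crosses the fixed point, where the lift is not convex.\<close>

definition rate :: "real \<Rightarrow> real" where "rate d = V (d / 2) / 2"

lemma rate_nonneg: "0 \<le> d \<Longrightarrow> 0 \<le> rate d"
  by (simp add: rate_def V_nonneg)

lemma rate_pos: "0 < d \<Longrightarrow> 0 < rate d"
  using V_less[of 0 "d / 2"] by (simp add: rate_def)

lemma rate_mono: "0 \<le> d \<Longrightarrow> d \<le> e \<Longrightarrow> rate d \<le> rate e"
  by (simp add: rate_def V_mono)

lemma g_0 [simp]: "g 0 = 0" and g_1: "g 1 = real (N + 1)"
  by (auto simp: g_def V_1)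

lemma g_expand:
  assumes "0 \<le> s" "s \<le> t"
  shows "g t - g s \<ge> (t - s) * (1 + V t)"
proof -
  have "g t - g s - (t - s) * (1 + V t) = s * (V t - V s)" by (simp add: g_def algebra_simps)
  also have "\<dots> \<ge> 0" using assms V_mono by auto
  finally show ?thesis by simp
qed

lemma G_add_int: "G (s + of_int m) = G s + real (N + 1) * of_int m"
  by (simp add: G_def algebra_simps)

lemma G_eq_g: "0 \<le> s \<Longrightarrow> s < 1 \<Longrightarrow> G s = g s"
  by (simp add: G_def frac_eq_id floor_eq_iff)

lemma G_eq_g': "1 \<le> s \<Longrightarrow> s < 2 \<Longrightarrow> G s = real (N + 1) + g (s - 1)"
  using G_add_int[of "s - 1" 1] by (simp add: G_eq_g)

text \<open>An arc inside a fundamental interval is expanded as on the line, by monotonicity of \<open>V\<close>. An arc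
  across an integer has a slow part of length \<open>a\<close> to the right of it and a fast part of length \<open>b\<close> to
  the left; the longer of the two provides the bound, at the cost of the two factors \<open>1 / 2\<close>.\<close>

lemma G_expand:
  assumes "s \<le> t" "t \<le> s + 1"
  shows "G t - G s \<ge> (t - s) * (1 + rate (t - s))"
proof -
  have *: "G t - G s \<ge> (t - s) * (1 + rate (t - s))" if st: "s \<le> t" "t \<le> s + 1" "0 \<le> s" "s < 1" for s t
  proof (cases "t < 1")
    case True
    have "V ((t - s) / 2) \<le> V t" using st by (intro V_mono) auto
    then have "rate (t - s) \<le> V t" using V_nonneg[of t] st V_nonneg[of "(t-s)/2"] unfolding rate_def by simp
    then have "(t - s) * (1 + rate (t - s)) \<le> (t - s) * (1 + V t)"
      using st by (intro mult_left_mono) auto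
    also have "\<dots> \<le> g t - g s" using st by (intro g_expand) auto
    finally show ?thesis using st True by (simp add: G_eq_g)
  next
    case False
    define a where "a = t - 1"
    define b where "b = 1 - s"
    have ab: "0 \<le> a" "0 < b" "b \<le> 1" "a + b = t - s" "a < 1" "a + b \<le> 1"
      using st False by (auto simp: a_def b_def)
    have "G t - G s = g a + (g 1 - g s)" using st False by (simp add: G_eq_g' G_eq_g a_def g_1)
    moreover have "g 1 - g s \<ge> b * (1 + V 1)"
      using g_expand[of s 1] st by (simp add: b_def)
    moreover have "g a + b * (1 + V 1) = (a + b) + (a * V a + b * V 1)"
      by (simp add: g_def algebra_simps)
    ultimately have 1: "G t - G s \<ge> (a + b) + (a * V a + b * V 1)" by linarith
    have 2: "a * V a + b * V 1 \<ge> (a + b) * rate (a + b)"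
    proof (cases "a \<ge> b")
      case True
      have "(a + b) * rate (a + b) \<le> (2 * a) * (V a / 2)"
        unfolding rate_def using ab True V_mono[of "(a+b)/2" a] V_nonneg
        by (intro mult_mono divide_right_mono) auto
      then show ?thesis using ab V_nonneg[of 1] by (simp add: add_increasing2)
    next
      case False
      have "(a + b) * rate (a + b) \<le> (2 * b) * (V 1 / 2)"
        unfolding rate_def using ab False V_mono[of "(a+b)/2" 1] V_nonneg
        by (intro mult_mono divide_right_mono) auto
      then show ?thesis using ab V_nonneg[of a] by (simp add: add_increasing)
    qed
    show ?thesis using 1 2 unfolding ab(4) by (simp add: algebra_simps)
  qed
  have "G (t - of_int \<lfloor>s\<rfloor>) - G (frac s) \<ge> (t - s) * (1 + rate (t - s))"
    using *[of "frac s" "t - of_int \<lfloor>s\<rfloor>"] assms frac_lt_1[of s] by (simp add: frac_def)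
  then show ?thesis
    using G_add_int[of "t - of_int \<lfloor>s\<rfloor>" "\<lfloor>s\<rfloor>"] G_add_int[of "frac s" "\<lfloor>s\<rfloor>"]
    by (simp add: frac_def)
qed

lemma G_strict_mono: "s < t \<Longrightarrow> G s < G t"
proof -
  have small: "G s < G t" if "s < t" "t \<le> s + 1" for s t
    using G_expand[of s t] that rate_nonneg[of "t - s"]
    by (smt (verit) mult_pos_pos)
  assume "s < t"
  define n where "n = \<lfloor>t - s\<rfloor>"
  show "G s < G t"
  proof (cases "t \<le> s + 1")
    case False
    then have n: "n \<ge> 1" "s + of_int n \<le> t" "t < s + of_int n + 1" unfolding n_def by linarith+
    have "G s < G (s + of_int n)" using n by (simp add: G_add_int add_pos_nonneg)
    also have "\<dots> \<le> G t" using small[of "s + of_int n" t] n by (cases "s + of_int n = t") auto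
    finally show ?thesis .
  qed (use small \<open>s < t\<close> in auto)
qed

lemma G_mono: "s \<le> t \<Longrightarrow> G s \<le> G t"
  using G_strict_mono[of s t] by (cases "s = t") auto

lemma G_inj: "G s = G t \<longleftrightarrow> s = t"
  using G_strict_mono by (metis linorder_cases order_less_irrefl)

lemma g_cont: "continuous_on {0..} g"
  unfolding g_def by (intro continuous_intros V_cont)

lemma G_surj: "\<exists>s. G s = y"
proof -
  define q where "q = \<lfloor>y / real (N + 1)\<rfloor>"
  define r where "r = y - real (N + 1) * of_int q"
  have "of_int q \<le> y / real (N + 1)" "y / real (N + 1) < of_int q + 1" unfolding q_def by linarith+
  then have r: "0 \<le> r" "r < real (N + 1)" unfolding r_def by (simp_all add: field_simps)
  have "\<exists>s\<ge>0. s \<le> 1 \<and> g s = r"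
    using r by (intro IVT') (auto simp: g_1 intro!: continuous_on_subset[OF g_cont])
  then obtain s where s: "0 \<le> s" "s \<le> 1" "g s = r" by auto
  have "s \<noteq> 1" using s r g_1 by auto
  then have "G s = r" using s G_eq_g[of s] by auto
  then have "G (s + of_int q) = y" by (simp add: G_add_int r_def)
  then show ?thesis ..
qed

definition H :: "real \<Rightarrow> real" where "H y = (THE s. G s = y)"

lemma G_H [simp]: "G (H y) = y"
proof -
  have "\<exists>!s. G s = y" using G_surj G_inj by metis
  then show ?thesis unfolding H_def by (rule theI')
qed

lemma H_G [simp]: "H (G s) = s"
  using G_inj G_H by blast

lemma H_strict_mono: "a < b \<Longrightarrow> H a < H b"
  by (metis G_H G_mono linorder_not_less)

lemma H_mono: "a \<le> b \<Longrightarrow> H a \<le> H b"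
  using H_strict_mono[of a b] by (cases "a = b") auto

lemma H_add_period: "H (a + real (N + 1) * of_int m) = H a + of_int m"
  by (metis G_H G_add_int H_G)

lemma G_ge_1: "G (s + 1) = G s + real (N + 1)"
  using G_add_int[of s 1] by simp

text \<open>The expansion of \<open>G\<close>, read for its inverse.\<close>

lemma H_contract:
  assumes "\<bar>a - b\<bar> \<le> 1"
  shows "\<bar>H a - H b\<bar> \<le> 1" "\<bar>a - b\<bar> \<ge> \<bar>H a - H b\<bar> * (1 + rate \<bar>H a - H b\<bar>)"
    "\<bar>H a - H b\<bar> \<le> \<bar>a - b\<bar>"
proof -
  have *: "H b - H a \<le> 1 \<and> b - a \<ge> (H b - H a) * (1 + rate (H b - H a))"
    if "a \<le> b" "b \<le> a + 1" for a b
  proof -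
    have "b \<le> G (H a + 1)" using that by (simp add: G_ge_1)
    then have 1: "H b \<le> H a + 1" using H_mono[of b "G (H a + 1)"] by simp
    show ?thesis using G_expand[of "H a" "H b"] 1 H_mono[OF that(1)] by simp
  qed
  have **: "\<bar>H a - H b\<bar> \<le> 1 \<and> \<bar>a - b\<bar> \<ge> \<bar>H a - H b\<bar> * (1 + rate \<bar>H a - H b\<bar>)"
  proof (cases "a \<le> b")
    case True
    then have "b \<le> a + 1" "\<bar>a - b\<bar> = b - a" "\<bar>H a - H b\<bar> = H b - H a"
      using assms H_mono[of a b] by auto
    then show ?thesis using *[of a b] True by simp
  next
    case False
    then have "b \<le> a" "a \<le> b + 1" "\<bar>a - b\<bar> = a - b" "\<bar>H a - H b\<bar> = H a - H b"
      using assms H_mono[of b a] by auto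
    then show ?thesis using *[of b a] by simp
  qed
  then show "\<bar>H a - H b\<bar> \<le> 1" "\<bar>a - b\<bar> \<ge> \<bar>H a - H b\<bar> * (1 + rate \<bar>H a - H b\<bar>)" by auto
  have "\<bar>H a - H b\<bar> * 1 \<le> \<bar>H a - H b\<bar> * (1 + rate \<bar>H a - H b\<bar>)"
    using rate_nonneg by (intro mult_left_mono) auto
  also have "\<dots> \<le> \<bar>a - b\<bar>" using ** by simp
  finally show "\<bar>H a - H b\<bar> \<le> \<bar>a - b\<bar>" by simp
qed

lemma H_0 [simp]: "H 0 = 0"
  by (metis G_eq_g H_G g_0 order_refl zero_less_one)

lemma H_unit: "0 \<le> a \<Longrightarrow> a < real (N + 1) \<Longrightarrow> 0 \<le> H a \<and> H a < 1"
  using H_mono[of 0 a] H_strict_mono[of a "real (N + 1)"] H_add_period[of 0 1] by simp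

abbreviation "T \<equiv> circle_map V"

lemma T_to_circle: "T (to_circle s) = to_circle (G s)"
proof -
  have "to_circle (G s) = to_circle (g (frac s) + of_int (int (N + 1) * \<lfloor>s\<rfloor>))"
    by (simp add: G_def add.commute)
  also have "\<dots> = to_circle (g (frac s))" by (rule to_circle_add_int)
  finally show ?thesis by (simp add: circle_map_def crep_to_circle g_def)
qed

text \<open>The inverse branches, all obtained from the one function \<open>br\<close> of the lift: the preimages of
  \<open>to_circle a\<close> are the points \<open>br (a + i)\<close> with \<open>i \<le> N\<close>. Nearby lifts thus give matching preimages
  without any distinction of cases.\<close>

definition br :: "real \<Rightarrow> circle" where "br a = to_circle (H a)"

lemma T_br [simp]: "T (br a) = to_circle a"
  by (simp add: br_def T_to_circle)

lemma bij_br: "bij_betw (\<lambda>i::nat. br (a + real i)) {..N} (T -` {to_circle a})"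
  unfolding bij_betw_def
proof
  show "inj_on (\<lambda>i::nat. br (a + real i)) {..N}"
  proof (rule inj_onI)
    fix i j :: nat assume ij: "i \<in> {..N}" "j \<in> {..N}" and "br (a + real i) = br (a + real j)"
    then obtain m where "H (a + real i) = H (a + real j) + of_int m"
      by (auto simp: br_def to_circle_eq_iff)
    then have "a + real i = G (H (a + real j) + of_int m)" by (metis G_H)
    then have "real i = real j + real (N + 1) * of_int m" unfolding G_add_int by simp
    then have e: "int i = int j + int (N + 1) * m" by (metis of_int_add of_int_eq_iff of_int_mult of_int_of_nat_eq)
    moreover have "\<bar>int i - int j\<bar> < int (N + 1)" using ij by auto
    ultimately have "\<bar>int (N + 1) * m\<bar> < int (N + 1)" by simp
    then have "int (N + 1) * \<bar>m\<bar> < int (N + 1) * 1" by (simp add: abs_mult)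
    then have "m = 0" by (subst (asm) mult_less_cancel_left_pos) auto
    then show "i = j" using e by simp
  qed
  show "(\<lambda>i::nat. br (a + real i)) ` {..N} = T -` {to_circle a}"
  proof (intro equalityI subsetI)
    fix y assume "y \<in> (\<lambda>i::nat. br (a + real i)) ` {..N}"
    then show "y \<in> T -` {to_circle a}"
      using to_circle_add_int[of a "int _"] by auto
  next
    fix y assume "y \<in> T -` {to_circle a}"
    then have "T (to_circle (crep y)) = to_circle a" by simp
    then obtain m where m: "G (crep y) = a + of_int m" unfolding T_to_circle to_circle_eq_iff by blast
    define q where "q = m div int (N + 1)"
    define i where "i = nat (m mod int (N + 1))"
    have im: "m = int i + int (N + 1) * q" unfolding i_def q_def by simp
    have "i < N + 1" unfolding i_def by (simp add: nat_less_iff)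
    have "G (crep y + of_int (- q)) = a + real i" unfolding G_add_int m im by simp
    then have "H (a + real i) = crep y + of_int (- q)" by (metis H_G)
    then have "br (a + real i) = y" unfolding br_def by (metis to_circle_add_int to_circle_crep)
    then show "y \<in> (\<lambda>i::nat. br (a + real i)) ` {..N}" using \<open>i < N + 1\<close> by auto
  qed
qed

lemma transfer_op_eq:
  "transfer_op T f \<phi> (to_circle a) = (\<Sum>i\<le>N. exp (f (br (a + real i))) *\<^sub>R \<phi> (br (a + real i)))"
  unfolding transfer_op_def
  by (rule sum.reindex_bij_betw[OF bij_br, symmetric])

lemma finite_fibre: "finite (T -` {x})"
  using bij_betw_finite[OF bij_br[of "crep x"]] by simp

end

section \<open>The cone of functions with controlled oscillation\<close>

text \<open>The gauge \<open>\<Psi>\<close> is a Lyapunov function for pairs of points: along each inverse branch it decreases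
  by at least the variation of the potential. The axiom \<open>\<Psi>_linear\<close> puts shifted Lipschitz functions
  into the cone below.\<close>

locale transfer_cone = circle_factor V for V :: "real \<Rightarrow> real" +
  fixes f :: "circle \<Rightarrow> real" and \<Psi> :: "real \<Rightarrow> real"
  assumes T_cont: "continuous_on UNIV (circle_map V)"
    and f_cont: "continuous_on UNIV f"
    and \<Psi>_mono: "0 \<le> x \<Longrightarrow> x \<le> y \<Longrightarrow> y \<le> 1 \<Longrightarrow> \<Psi> x \<le> \<Psi> y"
    and \<Psi>_0: "\<Psi> 0 = 0"
    and \<Psi>_small: "e > 0 \<Longrightarrow> \<exists>d>0. \<forall>x. 0 \<le> x \<longrightarrow> x < d \<longrightarrow> \<Psi> x < e"
    and \<Psi>_linear: "\<exists>c>0. \<forall>x\<in>{0..1}. x \<le> c * \<Psi> x"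
    and key: "\<bar>a - b\<bar> \<le> 1 \<Longrightarrow> \<bar>f (br a) - f (br b)\<bar> \<le> \<Psi> \<bar>a - b\<bar> - \<Psi> \<bar>H a - H b\<bar>"
begin

abbreviation L :: "(circle \<Rightarrow> real) \<Rightarrow> circle \<Rightarrow> real" where "L \<equiv> transfer_op T f"

definition F :: real where "F = (SUP x. \<bar>f x\<bar>)"

lemma f_le_F: "\<bar>f x\<bar> \<le> F"
proof -
  have "compact ((\<lambda>x. \<bar>f x\<bar>) ` UNIV)"
    by (intro compact_continuous_image compact_circle continuous_intros f_cont)
  then have "bdd_above (range (\<lambda>x. \<bar>f x\<bar>))"
    by (intro bounded_imp_bdd_above compact_imp_bounded)
  then show ?thesis unfolding F_def by (rule cSUP_upper[rotated]) auto
qed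

lemma \<Psi>_nonneg: "0 \<le> x \<Longrightarrow> x \<le> 1 \<Longrightarrow> 0 \<le> \<Psi> x"
  using \<Psi>_mono[of 0 x] \<Psi>_0 by simp

definition K :: real where "K = exp (\<Psi> 1)"

lemma K_pos: "0 < K"
  by (simp add: K_def)

lemma exp_\<Psi>_dist: "1 \<le> exp (\<Psi> (dist (x::circle) y))" "exp (\<Psi> (dist (x::circle) y)) \<le> K"
proof -
  have "dist x y \<le> 1" using dist_circle_le_half[of x y] by simp
  then show "1 \<le> exp (\<Psi> (dist (x::circle) y))" "exp (\<Psi> (dist (x::circle) y)) \<le> K"
    using \<Psi>_mono[of "dist x y" 1] \<Psi>_nonneg[of "dist x y"] by (auto simp: K_def)
qed

definition dcone :: "(circle \<Rightarrow> real) set" where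
  "dcone = {\<phi>. (\<forall>x. 0 < \<phi> x) \<and> (\<forall>x y. \<phi> x \<le> \<phi> y * exp (\<Psi> (dist x y)))}"

lemma cone_pos: "\<phi> \<in> dcone \<Longrightarrow> 0 < \<phi> x"
  by (simp add: dcone_def)

lemma cone_le: "\<phi> \<in> dcone \<Longrightarrow> \<phi> x \<le> \<phi> y * exp (\<Psi> (dist x y))"
  by (simp add: dcone_def)

lemma cone_le_K:
  assumes "\<phi> \<in> dcone"
  shows "\<phi> x \<le> \<phi> y * K"
proof -
  have "\<phi> x \<le> \<phi> y * exp (\<Psi> (dist x y))" using assms by (rule cone_le)
  also have "\<dots> \<le> \<phi> y * K"
    using exp_\<Psi>_dist cone_pos[OF assms, of y] by (intro mult_left_mono) auto
  finally show ?thesis .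
qed

lemma one_in_cone: "(\<lambda>_. 1) \<in> dcone"
  using exp_\<Psi>_dist by (auto simp: dcone_def)

lemma cone_scale: "\<phi> \<in> dcone \<Longrightarrow> 0 < c \<Longrightarrow> (\<lambda>x. c * \<phi> x) \<in> dcone"
  by (auto simp: dcone_def mult.assoc)

lemma exp_\<Psi>_small:
  assumes "e > 0"
  shows "\<exists>d>0. \<forall>x y::circle. dist x y < d \<longrightarrow> exp (\<Psi> (dist x y)) < 1 + e"
proof -
  obtain d where "d > 0" "\<And>x. 0 \<le> x \<Longrightarrow> x < d \<Longrightarrow> \<Psi> x < ln (1 + e)"
    using \<Psi>_small[of "ln (1 + e)"] assms by (auto intro: ln_gt_zero)
  moreover have "exp t < 1 + e" if "t < ln (1 + e)" for t
    using that assms by (metis add_pos_pos exp_less_cancel_iff exp_ln zero_less_one)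
  ultimately show ?thesis by (intro exI[of _ d]) auto
qed

lemma cone_continuous:
  assumes "\<phi> \<in> dcone"
  shows "continuous_on UNIV \<phi>"
  unfolding continuous_on_iff
proof (intro ballI allI impI)
  fix x and e :: real assume "e > 0"
  define B where "B = \<phi> x * K"
  have B: "0 < B" "\<And>y. \<phi> y \<le> B" using cone_le_K[OF assms] cone_pos[OF assms] K_pos by (auto simp: B_def)
  obtain d where d: "d > 0" "\<And>x y::circle. dist x y < d \<Longrightarrow> exp (\<Psi> (dist x y)) < 1 + e / B"
    using exp_\<Psi>_small[of "e / B"] \<open>e > 0\<close> B by auto
  have lt: "\<phi> u - \<phi> v < e" if "dist u v < d" for u v
  proof -
    have "\<phi> u \<le> \<phi> v * exp (\<Psi> (dist u v))" using assms by (rule cone_le)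
    also have "\<dots> < \<phi> v * (1 + e / B)"
      using d(2)[OF that] cone_pos[OF assms, of v] by (intro mult_strict_left_mono) auto
    also have "\<dots> = \<phi> v + \<phi> v / B * e" by (simp add: field_simps)
    also have "\<dots> \<le> \<phi> v + 1 * e"
      using B \<open>e > 0\<close> by (intro add_left_mono mult_right_mono) (auto simp: field_simps)
    finally show ?thesis by simp
  qed
  show "\<exists>d>0. \<forall>x'\<in>UNIV. dist x' x < d \<longrightarrow> dist (\<phi> x') (\<phi> x) < e"
    using d(1) lt by (intro exI[of _ d]) (auto simp: dist_real_def abs_less_iff dist_commute)
qed

lemma L_eq: "L \<phi> (to_circle a) = (\<Sum>i\<le>N. exp (f (br (a + real i))) * \<phi> (br (a + real i)))"
  by (simp add: transfer_op_eq)

lemma L_lincomb: "L (\<lambda>x. a * \<phi> x + b * \<psi> x) = (\<lambda>x. a * L \<phi> x + b * L \<psi> x)"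
  by (rule ext) (simp add: transfer_op_def sum.distrib sum_distrib_left algebra_simps)

lemma L_iter_lincomb:
  "(L ^^ n) (\<lambda>x. a * \<phi> x + b * \<psi> x) = (\<lambda>x. a * (L ^^ n) \<phi> x + b * (L ^^ n) \<psi> x)"
  by (induction n) (simp_all add: L_lincomb)

lemma L_iter_scale: "(L ^^ n) (\<lambda>x. a * \<phi> x) = (\<lambda>x. a * (L ^^ n) \<phi> x)"
  using L_iter_lincomb[of n a \<phi> 0 \<phi>] by simp

lemma L_mono: "(\<And>x. \<phi> x \<le> \<psi> x) \<Longrightarrow> L \<phi> x \<le> L \<psi> x"
  unfolding transfer_op_def by (auto intro!: sum_mono mult_left_mono)

lemma L_iter_mono: "(\<And>x. \<phi> x \<le> \<psi> x) \<Longrightarrow> (L ^^ n) \<phi> x \<le> (L ^^ n) \<psi> x"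
  by (induction n arbitrary: x) (simp_all add: L_mono)

text \<open>The increment of \<open>\<Psi>\<close> along an inverse branch pays for the variation of the potential.\<close>

lemma cone_L:
  assumes "\<phi> \<in> dcone"
  shows "L \<phi> \<in> dcone"
  unfolding dcone_def
proof (intro CollectI conjI allI)
  fix x y :: circle
  have "0 < L \<phi> (to_circle (crep x))"
    unfolding L_eq using cone_pos[OF assms] by (intro sum_pos) auto
  then show "0 < L \<phi> x" by simp
  obtain b where b: "to_circle b = y" "\<bar>crep x - b\<bar> = dist x y" using dist_circle_lift .
  define a where "a = crep x"
  have ab: "\<bar>a - b\<bar> = dist x y" "dist x y \<le> 1" "to_circle a = x"
    using b dist_circle_le_half[of x y] by (auto simp: a_def)
  have "L \<phi> (to_circle a) \<le> (\<Sum>i\<le>N. exp (\<Psi> (dist x y)) * (exp (f (br (b + real i))) * \<phi> (br (b + real i))))"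
    unfolding L_eq
  proof (rule sum_mono)
    fix i
    define u v where "u = a + real i" and "v = b + real i"
    have uv: "\<bar>u - v\<bar> = dist x y" using ab by (simp add: u_def v_def)
    have D: "\<bar>H u - H v\<bar> \<le> 1" using H_contract(1)[of u v] uv ab by simp
    have "dist (br u) (br v) \<le> \<bar>H u - H v\<bar>" by (simp add: br_def dist_to_circle_le)
    then have 1: "\<Psi> (dist (br u) (br v)) \<le> \<Psi> \<bar>H u - H v\<bar>" using D by (intro \<Psi>_mono) auto
    have 2: "f (br u) \<le> f (br v) + \<Psi> (dist x y) - \<Psi> \<bar>H u - H v\<bar>" using key[of u v] uv ab by auto
    have "exp (f (br u)) * \<phi> (br u) \<le>
        exp (f (br v) + \<Psi> (dist x y) - \<Psi> \<bar>H u - H v\<bar>) * (\<phi> (br v) * exp (\<Psi> \<bar>H u - H v\<bar>))"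
    proof (rule mult_mono)
      have "\<phi> (br u) \<le> \<phi> (br v) * exp (\<Psi> (dist (br u) (br v)))" using assms by (rule cone_le)
      also have "\<dots> \<le> \<phi> (br v) * exp (\<Psi> \<bar>H u - H v\<bar>)"
        using 1 cone_pos[OF assms, of "br v"] by (intro mult_left_mono) auto
      finally show "\<phi> (br u) \<le> \<phi> (br v) * exp (\<Psi> \<bar>H u - H v\<bar>)" .
    qed (use 2 cone_pos[OF assms, of "br u"] in auto)
    also have "\<dots> = exp (\<Psi> (dist x y)) * (exp (f (br v)) * \<phi> (br v))"
      by (simp add: exp_add exp_diff)
    finally show "exp (f (br (a + real i))) * \<phi> (br (a + real i)) \<le>
      exp (\<Psi> (dist x y)) * (exp (f (br (b + real i))) * \<phi> (br (b + real i)))"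
      unfolding u_def v_def .
  qed
  also have "\<dots> = exp (\<Psi> (dist x y)) * L \<phi> (to_circle b)"
    by (simp add: L_eq sum_distrib_left)
  finally show "L \<phi> x \<le> L \<phi> y * exp (\<Psi> (dist x y))" using ab b by (simp add: mult.commute)
qed

lemma cone_L_iter: "\<phi> \<in> dcone \<Longrightarrow> (L ^^ n) \<phi> \<in> dcone"
  by (induction n) (simp_all add: cone_L)

text \<open>Only one preimage is kept in the sum that defines the iterate.\<close>

lemma L_iter_lower:
  assumes "\<And>x. 0 \<le> \<phi> x"
  shows "exp (- real n * F) * \<phi> y \<le> (L ^^ n) \<phi> ((T ^^ n) y)"
proof (induction n)
  case (Suc n)
  let ?z = "(T ^^ n) y"
  have nn: "0 \<le> (L ^^ n) \<phi> x" for x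
    using L_iter_mono[of "\<lambda>_. 0" \<phi> n x] assms L_iter_scale[of n 0 \<phi>] by simp
  have "exp (- real (Suc n) * F) * \<phi> y = exp (- F) * (exp (- real n * F) * \<phi> y)"
    by (simp add: ring_distribs exp_add[symmetric] mult.assoc[symmetric])
  also have "\<dots> \<le> exp (f ?z) * (L ^^ n) \<phi> ?z"
    using Suc f_le_F[of ?z] assms by (intro mult_mono) auto
  also have "\<dots> \<le> L ((L ^^ n) \<phi>) (T ?z)"
    unfolding transfer_op_def[of T f "(L ^^ n) \<phi>"] real_scaleR_def
    by (rule member_le_sum) (use nn finite_fibre in auto)
  finally show ?case by simp
qed simp

definition D :: real where "D = real (N + 1) * exp F"

lemma D_pos: "0 < D"
  by (simp add: D_def)

lemma L_iter_upper:
  assumes "\<And>x. \<phi> x \<le> B" "0 \<le> B"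
  shows "(L ^^ n) \<phi> x \<le> B * D ^ n"
proof (induction n arbitrary: x)
  case (Suc n)
  have "L ((L ^^ n) \<phi>) (to_circle (crep x)) \<le> (\<Sum>i\<le>N. exp F * (B * D ^ n))"
    unfolding L_eq
  proof (rule sum_mono)
    fix i
    have "exp (f (br (crep x + real i))) * (L ^^ n) \<phi> (br (crep x + real i))
        \<le> exp (f (br (crep x + real i))) * (B * D ^ n)"
      by (intro mult_left_mono Suc) auto
    also have "\<dots> \<le> exp F * (B * D ^ n)"
      using f_le_F[of "br (crep x + real i)"] assms(2) D_pos by (intro mult_right_mono) auto
    finally show "exp (f (br (crep x + real i))) * (L ^^ n) \<phi> (br (crep x + real i))
        \<le> exp F * (B * D ^ n)" .
  qed
  also have "\<dots> = B * D ^ Suc n" by (simp add: D_def)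
  finally show ?case by simp
qed (use assms in auto)

end

section \<open>Topological exactness\<close>

context circle_factor
begin

lemma T_iter_to_circle: "(T ^^ n) (to_circle s) = to_circle ((G ^^ n) s)"
  by (induction n) (simp_all add: T_to_circle)

text \<open>In every step an arc of length at least \<open>d\<close> gains at least \<open>d * rate d\<close>, until its length reaches 1 and
  it covers the circle.\<close>

lemma G_iter_growth:
  assumes "0 < d" "d \<le> 1"
  shows "(G ^^ n) (s + d) - (G ^^ n) s \<ge> min 1 (d + real n * (d * rate d))"
proof (induction n)
  case (Suc n)
  define l where "l = (G ^^ n) (s + d) - (G ^^ n) s"
  have r: "0 < d * rate d" using assms rate_pos by simp
  show ?case
  proof (cases "l \<ge> 1")
    case True
    have "G ((G ^^ n) (s + d)) \<ge> G ((G ^^ n) s + 1)" using True by (intro G_mono) (simp add: l_def)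
    then have "(G ^^ Suc n) (s + d) - (G ^^ Suc n) s \<ge> 1" by (simp add: G_ge_1)
    then show ?thesis by linarith
  next
    case False
    then have l: "d + real n * (d * rate d) \<le> l" using Suc by (simp add: l_def min_def split: if_splits)
    have "d \<le> l" using l r by (smt (verit) mult_nonneg_nonneg of_nat_0_le_iff)
    have "G ((G ^^ n) (s + d)) - G ((G ^^ n) s) \<ge> l * (1 + rate l)"
      unfolding l_def by (rule G_expand) (use \<open>d \<le> l\<close> assms False in \<open>auto simp: l_def\<close>)
    moreover have "l * rate l \<ge> d * rate d"
      using \<open>d \<le> l\<close> assms rate_mono[of d l] rate_nonneg[of d] by (intro mult_mono) auto
    ultimately have "(G ^^ Suc n) (s + d) - (G ^^ Suc n) s \<ge> d + real (Suc n) * (d * rate d)"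
      using l by (simp add: algebra_simps)
    then show ?thesis by linarith
  qed
qed simp

lemma H_iter_mono: "a \<le> b \<Longrightarrow> (H ^^ n) a \<le> (H ^^ n) b"
  by (induction n) (simp_all add: H_mono)

lemma G_H_iter: "(G ^^ n) ((H ^^ n) a) = a"
  by (induction n arbitrary: a) (simp_all add: funpow_swap1)

lemma H_G_iter: "(H ^^ n) ((G ^^ n) a) = a"
  by (induction n arbitrary: a) (simp_all add: funpow_swap1)

text \<open>Topological exactness, with a time \<open>p\<close> that depends on \<open>\<delta>\<close> alone: after \<open>p\<close> steps the arc from
  \<open>z\<close> to its right has covered the circle.\<close>

lemma covering:
  assumes "\<delta> > 0"
  shows "\<exists>p. \<forall>x z. \<exists>y. (T ^^ p) y = x \<and> dist z y < \<delta>"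
proof -
  define d where "d = min (\<delta> / 2) 1"
  have d: "0 < d" "d \<le> 1" "d < \<delta>" using assms by (auto simp: d_def)
  obtain p where "1 / (d * rate d) < real p" using reals_Archimedean2 by blast
  then have p: "1 \<le> real p * (d * rate d)" using d rate_pos[of d] by (simp add: field_simps)
  show ?thesis
  proof (intro exI[of _ p] allI)
    fix x z :: circle
    define s u where "s = crep z" and "u = (G ^^ p) s"
    have up: "u + 1 \<le> (G ^^ p) (s + d)"
      using G_iter_growth[of d p s] d p by (simp add: u_def)
    define b where "b = crep x + of_int \<lceil>u - crep x\<rceil>"
    have b: "u \<le> b" "b \<le> u + 1" "to_circle b = x" unfolding b_def by (linarith, linarith, simp)
    define t where "t = (H ^^ p) b"
    have "(H ^^ p) u \<le> t" "t \<le> (H ^^ p) ((G ^^ p) (s + d))"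
      unfolding t_def using b up by (auto intro: H_iter_mono)
    then have t: "s \<le> t" "t \<le> s + d" unfolding u_def H_G_iter by auto
    have "(T ^^ p) (to_circle t) = x" by (simp add: T_iter_to_circle t_def G_H_iter b)
    moreover have "dist z (to_circle t) < \<delta>"
      using dist_to_circle_le[of s t] t d by (simp add: s_def)
    ultimately show "\<exists>y. (T ^^ p) y = x \<and> dist z y < \<delta>" by blast
  qed
qed

end

section \<open>Uniform contraction of ratios\<close>

context transfer_cone
begin

text \<open>The ratio of \<open>\<phi>\<close> and \<open>\<psi>\<close> at one point \<open>z\<close> is at distance at least \<open>\<epsilon> / 2\<close> from one of its bounds
  \<open>m\<close> and \<open>M\<close>, and by equicontinuity at distance at least \<open>\<epsilon> / 4\<close> on a ball around \<open>z\<close>. After \<open>p\<close> steps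
  every point has a preimage in this ball, so this bound can be improved by a fixed amount \<open>\<kappa>\<close>.\<close>

lemma ratio_step:
  assumes "\<epsilon> > 0" "B > 0"
  shows "\<exists>p \<kappa>. \<kappa> > 0 \<and> (\<forall>\<phi>\<in>dcone. \<forall>\<psi>\<in>dcone. \<forall>m M. (\<forall>x. \<phi> x \<le> B * \<psi> x) \<longrightarrow>
    (\<forall>x. m * \<psi> x \<le> \<phi> x \<and> \<phi> x \<le> M * \<psi> x) \<longrightarrow> \<epsilon> \<le> M - m \<longrightarrow>
    (\<exists>m' M'. M' - m' \<le> M - m - \<kappa> \<and>
      (\<forall>x. m' * (L ^^ p) \<psi> x \<le> (L ^^ p) \<phi> x \<and> (L ^^ p) \<phi> x \<le> M' * (L ^^ p) \<psi> x)))"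
proof -
  \<comment> \<open>The square of \<open>1 + e\<close> changes ratios up to \<open>B\<close> by at most \<open>\<epsilon> / 4\<close>.\<close>
  define e where "e = min 1 (\<epsilon> / (12 * B))"
  have e: "0 < e" "e \<le> 1" "3 * e * B \<le> \<epsilon> / 4" using assms by (auto simp: e_def min_def field_simps)
  obtain \<delta> where \<delta>: "\<delta> > 0" "\<And>x y::circle. dist x y < \<delta> \<Longrightarrow> exp (\<Psi> (dist x y)) < 1 + e"
    using exp_\<Psi>_small[OF e(1)] by auto
  obtain p where p: "\<And>x z. \<exists>y. (T ^^ p) y = x \<and> dist z y < \<delta>" using covering[OF \<delta>(1)] by blast
  define \<kappa> where "\<kappa> = exp (- real p * F) * (\<epsilon> / 4) / (K * D ^ p)"
  have \<kappa>: "\<kappa> > 0" using assms K_pos D_pos by (simp add: \<kappa>_def)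
  have gain: "\<kappa> * (L ^^ p) \<psi> x \<le> (L ^^ p) \<theta> x"
    if \<psi>: "\<psi> \<in> dcone" and \<theta>: "\<And>x. 0 \<le> \<theta> x" and near: "\<And>y. dist z y < \<delta> \<Longrightarrow> \<epsilon> / 4 * \<psi> y \<le> \<theta> y" for \<psi> \<theta> x z
  proof -
    obtain y where y: "(T ^^ p) y = x" "dist z y < \<delta>" using p by blast
    have "(L ^^ p) \<psi> x \<le> (\<psi> y * K) * D ^ p"
      using cone_le_K[OF \<psi>] cone_pos[OF \<psi>] K_pos by (intro L_iter_upper) (auto simp: less_imp_le)
    then have "\<kappa> * (L ^^ p) \<psi> x \<le> \<kappa> * ((\<psi> y * K) * D ^ p)" using \<kappa> by (intro mult_left_mono) auto
    also have "\<dots> = exp (- real p * F) * (\<epsilon> / 4 * \<psi> y)"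
      using K_pos D_pos by (simp add: \<kappa>_def field_simps)
    also have "\<dots> \<le> exp (- real p * F) * \<theta> y" using near[OF y(2)] by (intro mult_left_mono) auto
    also have "\<dots> \<le> (L ^^ p) \<theta> ((T ^^ p) y)" using \<theta> by (rule L_iter_lower)
    finally show ?thesis using y by simp
  qed
  have main: "\<exists>m' M'. M' - m' \<le> M - m - \<kappa> \<and>
      (\<forall>x. m' * (L ^^ p) \<psi> x \<le> (L ^^ p) \<phi> x \<and> (L ^^ p) \<phi> x \<le> M' * (L ^^ p) \<psi> x)"
    if \<phi>: "\<phi> \<in> dcone" and \<psi>: "\<psi> \<in> dcone" and B: "\<And>x. \<phi> x \<le> B * \<psi> x"
      and mM: "\<And>x. m * \<psi> x \<le> \<phi> x" "\<And>x. \<phi> x \<le> M * \<psi> x" and osc: "\<epsilon> \<le> M - m" for \<phi> \<psi> m M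
  proof -
    define z where "z = to_circle 0"
    define \<rho> where "\<rho> = \<phi> z / \<psi> z"
    have \<rho>: "\<phi> z = \<rho> * \<psi> z" "0 \<le> \<rho>" "\<rho> \<le> B"
      using cone_pos[OF \<psi>, of z] cone_pos[OF \<phi>, of z] B[of z] by (auto simp: \<rho>_def field_simps)
    have sq: "(1 + e) * (1 + e) \<le> 1 + 3 * e"
      using e mult_left_mono[of e 1 e] by (simp add: algebra_simps)
    have near: "\<phi> y \<le> (\<rho> + \<epsilon> / 4) * \<psi> y" "(\<rho> - \<epsilon> / 4) * \<psi> y \<le> \<phi> y" if "dist z y < \<delta>" for y
    proof -
      have ex: "exp (\<Psi> (dist z y)) \<le> 1 + e" "exp (\<Psi> (dist y z)) \<le> 1 + e"
        using \<delta>(2)[OF that] by (auto simp: dist_commute)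
      have step: "\<alpha> u \<le> \<alpha> v * (1 + e)" if "\<alpha> \<in> dcone" "exp (\<Psi> (dist u v)) \<le> 1 + e" for \<alpha> u v
        using cone_le[OF that(1), of u v] mult_left_mono[OF that(2), of "\<alpha> v"] cone_pos[OF that(1), of v]
        by linarith
      have small: "3 * e * \<rho> \<le> \<epsilon> / 4"
        using mult_left_mono[OF \<rho>(3), of "3 * e"] e by linarith
      have "\<phi> y \<le> \<phi> z * (1 + e)" by (intro step \<phi> ex)
      also have "\<dots> \<le> \<rho> * (\<psi> y * (1 + e)) * (1 + e)"
        unfolding \<rho>(1) using \<rho>(2) e step[OF \<psi> ex(1)] by (intro mult_right_mono mult_left_mono) auto
      also have "\<dots> = \<rho> * \<psi> y * ((1 + e) * (1 + e))" by (simp add: mult_ac)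
      also have "\<dots> \<le> \<rho> * \<psi> y * (1 + 3 * e)"
        using sq \<rho>(2) cone_pos[OF \<psi>, of y] by (intro mult_left_mono) auto
      also have "\<dots> = \<rho> * \<psi> y + (3 * e * \<rho>) * \<psi> y" by (simp add: algebra_simps)
      also have "\<dots> \<le> \<rho> * \<psi> y + (\<epsilon> / 4) * \<psi> y"
        using small cone_pos[OF \<psi>, of y] by (intro add_left_mono mult_right_mono) auto
      finally show "\<phi> y \<le> (\<rho> + \<epsilon> / 4) * \<psi> y" by (simp add: algebra_simps)
      have "\<psi> y \<le> \<psi> z * (1 + e)" by (intro step \<psi> ex)
      then have "\<rho> * \<psi> y \<le> \<rho> * (\<psi> z * (1 + e))" using \<rho>(2) by (intro mult_left_mono) auto
      also have "\<dots> = \<phi> z * (1 + e)" by (simp add: \<rho>(1))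
      also have "\<dots> \<le> \<phi> y * (1 + e) * (1 + e)"
        using e step[OF \<phi> ex(1)] by (intro mult_right_mono) auto
      also have "\<dots> = \<phi> y * ((1 + e) * (1 + e))" by simp
      also have "\<dots> \<le> \<phi> y * (1 + 3 * e)"
        using sq cone_pos[OF \<phi>, of y] by (intro mult_left_mono) auto
      finally have r: "\<rho> * \<psi> y \<le> \<phi> y * (1 + 3 * e)" .
      have "\<phi> y * (3 * e) \<le> (B * \<psi> y) * (3 * e)" using B e by (intro mult_right_mono) auto
      also have "\<dots> = (3 * e * B) * \<psi> y" by simp
      also have "\<dots> \<le> \<epsilon> / 4 * \<psi> y" using e cone_pos[OF \<psi>, of y] by (intro mult_right_mono) auto
      finally show "(\<rho> - \<epsilon> / 4) * \<psi> y \<le> \<phi> y" using r by (simp add: algebra_simps)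
    qed
    have bounds: "m * (L ^^ p) \<psi> x \<le> (L ^^ p) \<phi> x" "(L ^^ p) \<phi> x \<le> M * (L ^^ p) \<psi> x" for x
      using L_iter_mono[of "\<lambda>x. m * \<psi> x" \<phi> p x] L_iter_mono[of \<phi> "\<lambda>x. M * \<psi> x" p x] mM
      by (simp_all add: L_iter_scale)
    show ?thesis
    proof (cases "\<rho> \<le> (m + M) / 2")
      case True
      have "\<kappa> * (L ^^ p) \<psi> x \<le> (L ^^ p) (\<lambda>x. M * \<psi> x + (- 1) * \<phi> x) x" for x
      proof (rule gain[OF \<psi>])
        fix y assume "dist z y < \<delta>"
        then have "\<phi> y \<le> (\<rho> + \<epsilon> / 4) * \<psi> y" by (rule near)
        also have "\<dots> \<le> (M - \<epsilon> / 4) * \<psi> y"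
          using True osc cone_pos[OF \<psi>, of y] by (intro mult_right_mono) auto
        finally show "\<epsilon> / 4 * \<psi> y \<le> M * \<psi> y + (- 1) * \<phi> y" by (simp add: algebra_simps)
      qed (use mM in auto)
      then have "(L ^^ p) \<phi> x \<le> (M - \<kappa>) * (L ^^ p) \<psi> x" for x
        unfolding L_iter_lincomb by (simp add: algebra_simps)
      then show ?thesis using bounds by (intro exI[of _ m] exI[of _ "M - \<kappa>"]) auto
    next
      case False
      have "\<kappa> * (L ^^ p) \<psi> x \<le> (L ^^ p) (\<lambda>x. 1 * \<phi> x + (- m) * \<psi> x) x" for x
      proof (rule gain[OF \<psi>])
        fix y assume "dist z y < \<delta>"
        then have "(\<rho> - \<epsilon> / 4) * \<psi> y \<le> \<phi> y" by (rule near)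
        moreover have "(m + \<epsilon> / 4) * \<psi> y \<le> (\<rho> - \<epsilon> / 4) * \<psi> y"
          using False osc cone_pos[OF \<psi>, of y] by (intro mult_right_mono) auto
        ultimately show "\<epsilon> / 4 * \<psi> y \<le> 1 * \<phi> y + (- m) * \<psi> y" by (simp add: algebra_simps)
      qed (use mM in auto)
      then have "(m + \<kappa>) * (L ^^ p) \<psi> x \<le> (L ^^ p) \<phi> x" for x
        unfolding L_iter_lincomb by (simp add: algebra_simps)
      then show ?thesis using bounds by (intro exI[of _ "m + \<kappa>"] exI[of _ M]) auto
    qed
  qed
  show ?thesis
    by (rule exI[of _ p], rule exI[of _ \<kappa>], intro conjI \<kappa> ballI allI impI, rule main) auto
qed

text \<open>The improvement by \<open>\<kappa>\<close> can be repeated as long as the bounds differ by \<open>\<epsilon>\<close>; starting from the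
  bounds 0 and \<open>B\<close>, this is the case at most \<open>B / \<kappa>\<close> times.\<close>

lemma ratio_contraction:
  assumes "\<epsilon> > 0" "B > 0"
  shows "\<exists>n0. \<forall>\<phi>\<in>dcone. \<forall>\<psi>\<in>dcone. (\<forall>x. \<phi> x \<le> B * \<psi> x) \<longrightarrow>
    (\<forall>n\<ge>n0. \<exists>m M. M - m < \<epsilon> \<and>
      (\<forall>x. m * (L ^^ n) \<psi> x \<le> (L ^^ n) \<phi> x \<and> (L ^^ n) \<phi> x \<le> M * (L ^^ n) \<psi> x))"
proof -
  obtain p \<kappa> where \<kappa>: "\<kappa> > 0" and step: "\<And>\<phi> \<psi> m M. \<phi> \<in> dcone \<Longrightarrow> \<psi> \<in> dcone \<Longrightarrow>
    (\<forall>x. \<phi> x \<le> B * \<psi> x) \<Longrightarrow> (\<forall>x. m * \<psi> x \<le> \<phi> x \<and> \<phi> x \<le> M * \<psi> x) \<Longrightarrow> \<epsilon> \<le> M - m \<Longrightarrow>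
    (\<exists>m' M'. M' - m' \<le> M - m - \<kappa> \<and>
      (\<forall>x. m' * (L ^^ p) \<psi> x \<le> (L ^^ p) \<phi> x \<and> (L ^^ p) \<phi> x \<le> M' * (L ^^ p) \<psi> x))"
    using ratio_step[OF assms] by metis
  have push: "m * (L ^^ n) \<psi> x \<le> (L ^^ n) \<phi> x" "(L ^^ n) \<phi> x \<le> M * (L ^^ n) \<psi> x"
    if "\<forall>x. m * \<psi> x \<le> \<phi> x \<and> \<phi> x \<le> M * \<psi> x" for m M n \<phi> \<psi> and x :: circle
    using L_iter_mono[of "\<lambda>x. m * \<psi> x" \<phi> n x] L_iter_mono[of \<phi> "\<lambda>x. M * \<psi> x" n x] that
    by (simp_all add: L_iter_scale)
  obtain j :: nat where "B / \<kappa> < real j" using reals_Archimedean2 by blast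
  then have j: "B - real j * \<kappa> < 0" using \<kappa> by (simp add: field_simps)
  have "\<exists>m M. M - m < \<epsilon> \<and>
      (\<forall>x. m * (L ^^ n) \<psi> x \<le> (L ^^ n) \<phi> x \<and> (L ^^ n) \<phi> x \<le> M * (L ^^ n) \<psi> x)"
    if \<phi>: "\<phi> \<in> dcone" and \<psi>: "\<psi> \<in> dcone" and B: "\<forall>x. \<phi> x \<le> B * \<psi> x" and n: "n \<ge> j * p" for \<phi> \<psi> n
  proof -
    have "\<exists>m M. (M - m < \<epsilon> \<or> M - m \<le> B - real i * \<kappa>) \<and>
      (\<forall>x. m * (L ^^ (i * p)) \<psi> x \<le> (L ^^ (i * p)) \<phi> x \<and> (L ^^ (i * p)) \<phi> x \<le> M * (L ^^ (i * p)) \<psi> x)" for i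
    proof (induction i)
      case 0
      then show ?case using B cone_pos[OF \<phi>]
        by (intro exI[of _ 0] exI[of _ B]) (auto simp: less_imp_le)
    next
      case (Suc i)
      let ?\<phi> = "(L ^^ (i * p)) \<phi>" and ?\<psi> = "(L ^^ (i * p)) \<psi>"
      obtain m M where mM: "M - m < \<epsilon> \<or> M - m \<le> B - real i * \<kappa>"
        "\<forall>x. m * ?\<psi> x \<le> ?\<phi> x \<and> ?\<phi> x \<le> M * ?\<psi> x" using Suc by blast
      have eq: "(L ^^ (Suc i * p)) \<alpha> = (L ^^ p) ((L ^^ (i * p)) \<alpha>)" for \<alpha>
        by (simp add: funpow_add)
      show ?case
      proof (cases "M - m < \<epsilon>")
        case True
        then show ?thesis unfolding eq using push[OF mM(2), of p] by blast
      next
        case False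
        have "\<forall>x. ?\<phi> x \<le> B * ?\<psi> x"
          using push(2)[of 0 \<psi> \<phi> B] B cone_pos[OF \<phi>] by (auto simp: less_imp_le)
        then obtain m' M' where "M' - m' \<le> M - m - \<kappa>"
          "\<forall>x. m' * (L ^^ p) ?\<psi> x \<le> (L ^^ p) ?\<phi> x \<and> (L ^^ p) ?\<phi> x \<le> M' * (L ^^ p) ?\<psi> x"
          using step[of ?\<phi> ?\<psi> m M] mM(2) False cone_L_iter[OF \<phi>] cone_L_iter[OF \<psi>] by force
        moreover have "M' - m' \<le> B - real (Suc i) * \<kappa>"
          using mM(1) False calculation(1) by (simp add: algebra_simps)
        ultimately show ?thesis unfolding eq by blast
      qed
    qed
    from this[of j] obtain m M where osc: "M - m < \<epsilon>"
      and bd: "\<forall>x. m * (L ^^ (j * p)) \<psi> x \<le> (L ^^ (j * p)) \<phi> x \<and> (L ^^ (j * p)) \<phi> x \<le> M * (L ^^ (j * p)) \<psi> x"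
      using j assms(1) by force
    have eq: "(L ^^ n) \<alpha> = (L ^^ (n - j * p)) ((L ^^ (j * p)) \<alpha>)" for \<alpha>
      using n by (metis comp_apply funpow_add le_add_diff_inverse2)
    show ?thesis
      using osc push[OF bd, of "n - j * p"] unfolding eq by blast
  qed
  then show ?thesis by blast
qed

end

section \<open>Measures on the circle\<close>

text \<open>Weak compactness on the circle is inherited from the line: unrolled on the unit interval, any
  sequence of probabilities is tight.\<close>

lemma circle_weak_compactness:
  fixes B :: "nat \<Rightarrow> circle set" and w :: "nat \<Rightarrow> circle \<Rightarrow> real"
  assumes fin: "\<And>n. finite (B n)" and nn: "\<And>n y. 0 \<le> w n y" and one: "\<And>n. (\<Sum>y\<in>B n. w n y) = 1"
  shows "\<exists>(\<nu> :: circle measure) r. sets \<nu> = sets borel \<and> prob_space \<nu> \<and> strict_mono (r :: nat \<Rightarrow> nat) \<and>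
    (\<forall>\<phi>. continuous_on UNIV \<phi> \<longrightarrow>
      (\<lambda>n. \<Sum>y\<in>B (r n). w (r n) y * \<phi> y) \<longlonglongrightarrow> (integral\<^sup>L \<nu> \<phi> :: real))"
proof -
  define P where "P n = point_measure (B n) (\<lambda>y. ennreal (w n y))" for n
  define M where "M n = distr (P n) borel crep" for n
  have P: "prob_space (P n)" for n
    by (rule prob_spaceI)
      (simp add: P_def space_point_measure emeasure_point_measure_finite fin nn one sum_ennreal)
  have crep_P: "crep \<in> borel_measurable (P n)" for n by (simp add: P_def)
  have rd: "real_distribution (M n)" for n
    unfolding M_def using P crep_P by (rule prob_space.real_distribution_distr)
  have int_M: "integral\<^sup>L (M n) \<psi> = (\<Sum>y\<in>B n. w n y * \<psi> (crep y))"
    if "\<psi> \<in> borel_measurable borel" for \<psi> :: "real \<Rightarrow> real" and n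
    unfolding M_def integral_distr[OF crep_P that]
    unfolding P_def by (subst lebesgue_integral_point_measure_finite) (auto simp: fin nn)
  have "measure (M n) {-1<..1} = 1" for n
  proof -
    have "crep y \<in> {-1<..1}" for y using crep_bounds[of y] by simp
    then have U: "crep -` {-1<..1} = UNIV" by blast
    have "measure (M n) {-1<..1} = measure (P n) (space (P n))"
      unfolding M_def measure_distr[OF crep_P, of "{-1<..1}", simplified]
      using U by (intro arg_cong2[where f=measure]) auto
    then show ?thesis using P prob_space.prob_space by metis
  qed
  then have "\<forall>n. measure (M n) {-1<..1} > 1 - e" if "e > 0" for e using that by simp
  then have "\<exists>a b. a < b \<and> (\<forall>n. measure (M n) {a<..b} > 1 - e)" if "e > 0" for e
    using that by (intro exI[of _ "-1::real"] exI[of _ "1::real"]) simp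
  then have "tight M" unfolding tight_def using rd by blast
  moreover have "strict_mono (\<lambda>n::nat. n)" by (simp add: strict_mono_def)
  ultimately obtain r \<eta> where r: "strict_mono r" "real_distribution \<eta>" "weak_conv_m (\<lambda>n. M (r n)) \<eta>"
    using tight_imp_convergent_subsubsequence[of M "\<lambda>n. n"] unfolding comp_def by blast
  interpret l: real_distribution \<eta> by fact
  have tm: "to_circle \<in> borel_measurable \<eta>"
    using borel_measurable_continuous_onI[OF continuous_to_circle] by simp
  define \<nu> where "\<nu> = distr \<eta> borel to_circle"
  have "(\<lambda>n. \<Sum>y\<in>B (r n). w (r n) y * \<phi> y) \<longlonglongrightarrow> integral\<^sup>L \<nu> \<phi>"
    if \<phi>: "continuous_on UNIV \<phi>" for \<phi> :: "circle \<Rightarrow> real"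
  proof -
    obtain b where "0 < b" and b: "\<And>x. norm (\<phi> x) \<le> b"
      by (rule circle_bounded[OF \<phi>], rule that)
    have c: "continuous_on UNIV (\<lambda>t. \<phi> (to_circle t))"
      by (rule continuous_on_compose2[OF \<phi> continuous_to_circle]) auto
    have cm: "(\<lambda>t. \<phi> (to_circle t)) \<in> borel_measurable borel" "\<phi> \<in> borel_measurable borel"
      using c \<phi> by (auto intro: borel_measurable_continuous_onI)
    have "isCont (\<lambda>t. \<phi> (to_circle t)) t" for t
      using c by (simp add: continuous_on_eq_continuous_at)
    then have "(\<lambda>n. integral\<^sup>L (M (r n)) (\<lambda>t. \<phi> (to_circle t))) \<longlonglongrightarrow> integral\<^sup>L \<eta> (\<lambda>t. \<phi> (to_circle t))"
      by (rule weak_conv_imp_integral_bdd_continuous_conv[OF rd r(2,3)]) (rule b)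
    then show ?thesis unfolding int_M[OF cm(1)] \<nu>_def integral_distr[OF tm cm(2)] to_circle_crep .
  qed
  moreover have "prob_space \<nu>" unfolding \<nu>_def using tm by (rule l.prob_space_distr)
  moreover have "sets \<nu> = sets borel" by (simp add: \<nu>_def)
  ultimately show ?thesis using r(1) by blast
qed

locale circle_prob = prob_space \<nu> for \<nu> :: "circle measure" +
  assumes sets_eq [measurable_cong, simp]: "sets \<nu> = sets borel"
begin

lemma space_eq [simp]: "space \<nu> = UNIV"
  using sets_eq_imp_space_eq[OF sets_eq] by simp

lemma prob_UNIV [simp]: "prob UNIV = 1"
  using prob_space by simp

lemma integrable_continuous:
  fixes \<phi> :: "circle \<Rightarrow> real"
  assumes \<phi>: "continuous_on UNIV \<phi>"
  shows "integrable \<nu> \<phi>"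
proof -
  obtain b where "0 < b" and b: "\<And>x. norm (\<phi> x) \<le> b"
    by (rule circle_bounded[OF \<phi>], rule that)
  show ?thesis
    using b borel_measurable_continuous_onI[OF \<phi>] by (intro integrable_const_bound[of _ b]) auto
qed

lemma integral_le_const: "integrable \<nu> \<phi> \<Longrightarrow> (\<And>x. \<phi> x \<le> (c::real)) \<Longrightarrow> integral\<^sup>L \<nu> \<phi> \<le> c"
  using integral_mono[of \<nu> \<phi> "\<lambda>_. c"] prob_space by simp

lemma integral_ge_const: "integrable \<nu> \<phi> \<Longrightarrow> (\<And>x. (c::real) \<le> \<phi> x) \<Longrightarrow> c \<le> integral\<^sup>L \<nu> \<phi>"
  using integral_mono[of \<nu> "\<lambda>_. c" \<phi>] prob_space by simp

end

text \<open>By the Stone-Weierstrass theorem: Lipschitz functions form an algebra, and the distance to a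
  point separates it from the others.\<close>

lemma circle_lipschitz_dense:
  fixes \<phi> :: "circle \<Rightarrow> real"
  assumes "continuous_on UNIV \<phi>" "e > 0"
  shows "\<exists>\<psi> C. 0 \<le> C \<and> (\<forall>x y. \<bar>\<psi> x - \<psi> y\<bar> \<le> C * dist x y) \<and> (\<forall>x. \<bar>\<phi> x - \<psi> x\<bar> < e)"
proof -
  define R :: "(circle \<Rightarrow> real) set" where "R = {\<psi>. \<exists>C\<ge>0. \<forall>x y. \<bar>\<psi> x - \<psi> y\<bar> \<le> C * dist x y}"
  have RD: "\<exists>C\<ge>0. \<forall>x y. \<bar>\<psi> x - \<psi> y\<bar> \<le> C * dist x y" if "\<psi> \<in> R" for \<psi>
    using that by (simp only: R_def mem_Collect_eq)
  have RI: "\<psi> \<in> R" if "0 \<le> C" "\<And>x y. \<bar>\<psi> x - \<psi> y\<bar> \<le> C * dist x y" for C \<psi>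
    unfolding R_def mem_Collect_eq using that by (intro exI[of _ C]) simp
  have cont: "continuous_on UNIV \<psi>" if "\<psi> \<in> R" for \<psi>
  proof -
    obtain C where "0 \<le> C" "\<And>x y. \<bar>\<psi> x - \<psi> y\<bar> \<le> C * dist x y" using RD[OF \<open>\<psi> \<in> R\<close>] by metis
    then have "C-lipschitz_on UNIV \<psi>" by (intro lipschitz_onI) (auto simp: dist_real_def)
    then show ?thesis by (rule lipschitz_on_continuous_on)
  qed
  have "function_ring_on R UNIV"
  proof
    fix \<alpha> \<beta> assume "\<alpha> \<in> R" "\<beta> \<in> R"
    obtain C where C: "0 \<le> C" "\<And>x y. \<bar>\<alpha> x - \<alpha> y\<bar> \<le> C * dist x y"
      using RD[OF \<open>\<alpha> \<in> R\<close>] by metis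
    obtain D where D: "0 \<le> D" "\<And>x y. \<bar>\<beta> x - \<beta> y\<bar> \<le> D * dist x y"
      using RD[OF \<open>\<beta> \<in> R\<close>] by metis
    have "\<bar>\<alpha> x + \<beta> x - (\<alpha> y + \<beta> y)\<bar> \<le> (C + D) * dist x y" for x y
      using C(2)[of x y] D(2)[of x y] by (simp add: algebra_simps)
    then show "(\<lambda>x. \<alpha> x + \<beta> x) \<in> R" using C(1) D(1) by (intro RI[of "C + D"]) auto
    have "compact ((\<lambda>x. \<bar>\<alpha> x\<bar> + \<bar>\<beta> x\<bar>) ` UNIV)"
      using cont[OF \<open>\<alpha> \<in> R\<close>] cont[OF \<open>\<beta> \<in> R\<close>]
      by (intro compact_continuous_image compact_circle continuous_intros)
    then obtain b where b: "\<And>x. \<bar>\<alpha> x\<bar> + \<bar>\<beta> x\<bar> \<le> b" using compact_imp_bounded by (force simp: bounded_iff)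
    have b0: "0 \<le> b" using b[of undefined] by linarith
    have "\<bar>\<alpha> x * \<beta> x - \<alpha> y * \<beta> y\<bar> \<le> (b * D + C * b) * dist x y" for x y
    proof -
      have "\<bar>\<alpha> x * \<beta> x - \<alpha> y * \<beta> y\<bar> = \<bar>\<alpha> x * (\<beta> x - \<beta> y) + (\<alpha> x - \<alpha> y) * \<beta> y\<bar>"
        by (simp add: algebra_simps)
      also have "\<dots> \<le> \<bar>\<alpha> x\<bar> * \<bar>\<beta> x - \<beta> y\<bar> + \<bar>\<alpha> x - \<alpha> y\<bar> * \<bar>\<beta> y\<bar>"
        by (metis abs_mult abs_triangle_ineq)
      also have "\<dots> \<le> b * (D * dist x y) + (C * dist x y) * b"
        using b[of x] b[of y] C(2)[of x y] D(2)[of x y] b0 C(1) by (intro add_mono mult_mono) auto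
      finally show ?thesis by (simp add: algebra_simps)
    qed
    then show "(\<lambda>x. \<alpha> x * \<beta> x) \<in> R" using C(1) D(1) b0 by (intro RI[of "b * D + C * b"]) auto
  next
    show "(\<lambda>_. c) \<in> R" for c by (rule RI[of 0]) auto
  next
    fix x y :: circle assume "x \<noteq> y"
    moreover have "\<bar>dist x u - dist x v\<bar> \<le> 1 * dist u v" for u v
      using dist_triangle[of x u v] dist_triangle[of x v u] by (simp add: dist_commute)
    then have "dist x \<in> R" by (intro RI[of 1]) auto
    ultimately show "\<exists>f\<in>R. f x \<noteq> f y" by (intro bexI[of _ "dist x"]) auto
  qed (use cont compact_circle in auto)
  from function_ring_on.Stone_Weierstrass_basic[OF this assms] obtain \<psi> where
    \<psi>: "\<psi> \<in> R" "\<forall>x. \<bar>\<phi> x - \<psi> x\<bar> < e" by auto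
  then show ?thesis using RD[OF \<psi>(1)] by blast
qed

section \<open>Iterates of the transfer operator\<close>

context transfer_cone
begin

lemma finite_fibre_iter: "finite ((T ^^ n) -` {x})"
proof (induction n arbitrary: x)
  case (Suc n)
  have eq: "(T ^^ Suc n) -` {x} = (\<Union>z\<in>T -` {x}. (T ^^ n) -` {z})" by auto
  show ?case unfolding eq by (rule finite_UN_I[OF finite_fibre Suc])
qed auto

lemma L_iter_eq: "(L ^^ n) \<phi> x = (\<Sum>y\<in>(T ^^ n) -` {x}. exp (birkhoff_sum T f n y) * \<phi> y)"
proof (induction n arbitrary: x)
  case 0
  have "id -` {x} = {x}" by auto
  then show ?case by (simp add: birkhoff_sum_def)
next
  case (Suc n)
  have eq: "(T ^^ Suc n) -` {x} = (\<Union>z\<in>T -` {x}. (T ^^ n) -` {z})" by auto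
  have "(\<Sum>y\<in>(T ^^ Suc n) -` {x}. exp (birkhoff_sum T f (Suc n) y) * \<phi> y)
    = (\<Sum>z\<in>T -` {x}. \<Sum>y\<in>(T ^^ n) -` {z}. exp (birkhoff_sum T f (Suc n) y) * \<phi> y)"
    unfolding eq by (rule sum.UNION_disjoint) (use finite_fibre finite_fibre_iter in auto)
  also have "\<dots> = (\<Sum>z\<in>T -` {x}. exp (f z) * (L ^^ n) \<phi> z)"
    unfolding Suc sum_distrib_left
    by (intro sum.cong refl) (auto simp: birkhoff_sum_def exp_add)
  also have "\<dots> = (L ^^ Suc n) \<phi> x" by (simp add: transfer_op_def)
  finally show ?case ..
qed

lemma br_continuous: "continuous_on S br"
proof -
  have "dist (br a) (br b) \<le> \<bar>a - b\<bar>" for a b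
  proof (cases "\<bar>a - b\<bar> \<le> 1")
    case True
    then show ?thesis using dist_to_circle_le[of "H a" "H b"] H_contract(3)[of a b] by (simp add: br_def)
  next
    case False
    then show ?thesis using dist_circle_le_half[of "br a" "br b"] by linarith
  qed
  then have "1-lipschitz_on S br" by (intro lipschitz_onI) (auto simp: dist_real_def)
  then show ?thesis by (rule lipschitz_on_continuous_on)
qed

lemma L_eq_crep: "L \<phi> x = (\<Sum>i\<le>N. exp (f (br (crep x + real i))) * \<phi> (br (crep x + real i)))"
  using L_eq[of \<phi> "crep x"] by simp

lemma f_measurable [measurable]: "f \<in> borel_measurable borel"
  using f_cont by (rule borel_measurable_continuous_onI)

lemma br_measurable [measurable]: "br \<in> borel_measurable borel"
  using br_continuous by (rule borel_measurable_continuous_onI)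

lemma L_measurable [measurable]:
  assumes "\<phi> \<in> borel_measurable borel"
  shows "L \<phi> \<in> borel_measurable borel"
proof -
  have b: "(\<lambda>x. br (crep x + real i)) \<in> borel_measurable borel" for i
    by measurable
  have "(\<lambda>x. exp (f x) * \<phi> x) \<in> borel_measurable borel"
    using assms f_measurable by simp
  from measurable_compose[OF b this] show ?thesis
    unfolding L_eq_crep[abs_def] by (intro borel_measurable_sum)
qed

lemma L_iter_measurable [measurable]:
  "\<phi> \<in> borel_measurable borel \<Longrightarrow> (L ^^ n) \<phi> \<in> borel_measurable borel"
  by (induction n) (auto intro: L_measurable)

lemma L_continuous:
  assumes "continuous_on UNIV \<phi>"
  shows "continuous_on UNIV (L \<phi>)"
proof -
  have cont: "continuous_on UNIV (\<lambda>a. L \<phi> (to_circle a))"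
    unfolding L_eq
    by (intro continuous_intros continuous_on_compose2[OF assms] continuous_on_compose2[OF f_cont]
        continuous_on_compose2[OF br_continuous]) auto
  \<comment> \<open>A continuous function of the lift is continuous on the circle, as lifts realise distances.\<close>
  show ?thesis
    unfolding continuous_on_iff
  proof (intro ballI allI impI)
    fix x and e :: real assume "e > 0"
    then obtain d where d: "d > 0" "\<And>b. dist b (crep x) < d \<Longrightarrow>
        dist (L \<phi> (to_circle b)) (L \<phi> (to_circle (crep x))) < e"
      using cont unfolding continuous_on_iff by (metis UNIV_I)
    have "dist (L \<phi> y) (L \<phi> x) < e" if y: "dist y x < d" for y
    proof -
      obtain b where "to_circle b = y" "\<bar>crep x - b\<bar> = dist x y" using dist_circle_lift .
      then show ?thesis using d(2)[of b] y by (simp add: dist_real_def dist_commute abs_minus_commute)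
    qed
    then show "\<exists>d>0. \<forall>x'\<in>UNIV. dist x' x < d \<longrightarrow> dist (L \<phi> x') (L \<phi> x) < e" using d(1) by blast
  qed
qed

lemma L_iter_continuous: "continuous_on UNIV \<phi> \<Longrightarrow> continuous_on UNIV ((L ^^ n) \<phi>)"
  by (induction n) (auto intro: L_continuous)

lemma L_iter_one_pos: "0 < (L ^^ n) (\<lambda>_. 1) x"
  using cone_pos[OF cone_L_iter[OF one_in_cone]] .

section \<open>The conformal measure and the eigenfunction\<close>

definition base :: circle where "base = to_circle 0"

lemma conformal_limit_exists:
  "\<exists>(\<nu> :: circle measure) r. sets \<nu> = sets borel \<and> prob_space \<nu> \<and> strict_mono (r :: nat \<Rightarrow> nat) \<and>
    (\<forall>\<phi>. continuous_on UNIV \<phi> \<longrightarrow>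
      (\<lambda>n. (L ^^ r n) \<phi> base / (L ^^ r n) (\<lambda>_. 1) base) \<longlonglongrightarrow> integral\<^sup>L \<nu> \<phi>)"
proof -
  define w where "w n y = exp (birkhoff_sum T f n y) / (L ^^ n) (\<lambda>_. 1) base" for n y
  have eq: "(\<Sum>y\<in>(T ^^ n) -` {base}. w n y * \<phi> y) = (L ^^ n) \<phi> base / (L ^^ n) (\<lambda>_. 1) base" for n \<phi>
    unfolding w_def L_iter_eq[of n \<phi>] sum_divide_distrib by simp
  have "(\<Sum>y\<in>(T ^^ n) -` {base}. w n y) = 1" for n
    using eq[of n "\<lambda>_. 1"] L_iter_one_pos[of n base] by simp
  then show ?thesis
    using circle_weak_compactness[of "\<lambda>n. (T ^^ n) -` {base}" w] L_iter_one_pos[of _ base]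
    unfolding eq by (simp add: w_def finite_fibre_iter less_imp_le)
qed

text \<open>A limit point of the normalised iterates of the dual operator on the point mass at \<open>base\<close>. The
  choice does not matter: by \<open>ratio_tendsto\<close> the whole sequence converges on the cone.\<close>

definition conf :: "circle measure" where
  "conf = (SOME \<nu>. sets \<nu> = sets borel \<and> prob_space \<nu> \<and> (\<exists>r. strict_mono (r :: nat \<Rightarrow> nat) \<and>
    (\<forall>\<phi>. continuous_on UNIV \<phi> \<longrightarrow>
      (\<lambda>n. (L ^^ r n) \<phi> base / (L ^^ r n) (\<lambda>_. 1) base) \<longlonglongrightarrow> integral\<^sup>L \<nu> \<phi>)))"

lemma conf_props: "sets conf = sets borel" "prob_space conf"
    "\<exists>r. strict_mono (r :: nat \<Rightarrow> nat) \<and> (\<forall>\<phi>. continuous_on UNIV \<phi> \<longrightarrow>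
      (\<lambda>n. (L ^^ r n) \<phi> base / (L ^^ r n) (\<lambda>_. 1) base) \<longlonglongrightarrow> integral\<^sup>L conf \<phi>)"
proof -
  have "\<exists>\<nu>. sets \<nu> = sets borel \<and> prob_space \<nu> \<and> (\<exists>r. strict_mono (r :: nat \<Rightarrow> nat) \<and>
    (\<forall>\<phi>. continuous_on UNIV \<phi> \<longrightarrow>
      (\<lambda>n. (L ^^ r n) \<phi> base / (L ^^ r n) (\<lambda>_. 1) base) \<longlonglongrightarrow> integral\<^sup>L \<nu> \<phi>))"
    using conformal_limit_exists by blast
  from someI_ex[OF this, folded conf_def]
  show "sets conf = sets borel" "prob_space conf"
    "\<exists>r. strict_mono (r :: nat \<Rightarrow> nat) \<and> (\<forall>\<phi>. continuous_on UNIV \<phi> \<longrightarrow>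
      (\<lambda>n. (L ^^ r n) \<phi> base / (L ^^ r n) (\<lambda>_. 1) base) \<longlonglongrightarrow> integral\<^sup>L conf \<phi>)" by auto
qed

end

sublocale transfer_cone \<subseteq> nu: circle_prob conf
  using conf_props by (simp add: circle_prob_def circle_prob_axioms_def)

context transfer_cone
begin

text \<open>Bounds for the ratio at time \<open>n\<close> persist at later times and so enclose the limit along the
  subsequence that defines \<open>conf\<close>. The time \<open>n0\<close> depends on the functions only through their bound.\<close>

lemma ratio_limit:
  assumes "\<epsilon> > 0" "B > 0"
  shows "\<exists>n0. \<forall>\<phi>\<in>dcone. (\<forall>x. \<phi> x \<le> B) \<longrightarrow> (\<forall>n\<ge>n0. \<forall>x.
    \<bar>(L ^^ n) \<phi> x - integral\<^sup>L conf \<phi> * (L ^^ n) (\<lambda>_. 1) x\<bar> \<le> \<epsilon> * (L ^^ n) (\<lambda>_. 1) x)"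
proof -
  obtain r where r: "strict_mono (r :: nat \<Rightarrow> nat)" "\<And>\<phi>. continuous_on UNIV \<phi> \<Longrightarrow>
      (\<lambda>n. (L ^^ r n) \<phi> base / (L ^^ r n) (\<lambda>_. 1) base) \<longlonglongrightarrow> integral\<^sup>L conf \<phi>"
    using conf_props(3) by blast
  let ?one = "\<lambda>_::circle. 1::real"
  from ratio_contraction[OF assms] obtain n0 where contr: "\<forall>\<phi>\<in>dcone. \<forall>\<psi>\<in>dcone. (\<forall>x. \<phi> x \<le> B * \<psi> x) \<longrightarrow>
    (\<forall>n\<ge>n0. \<exists>m M. M - m < \<epsilon> \<and>
      (\<forall>x. m * (L ^^ n) \<psi> x \<le> (L ^^ n) \<phi> x \<and> (L ^^ n) \<phi> x \<le> M * (L ^^ n) \<psi> x))" ..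
  have n0: "\<exists>m M. M - m < \<epsilon> \<and>
      (\<forall>x. m * (L ^^ n) ?one x \<le> (L ^^ n) \<phi> x \<and> (L ^^ n) \<phi> x \<le> M * (L ^^ n) ?one x)"
    if "\<phi> \<in> dcone" "\<forall>x. \<phi> x \<le> B" "n \<ge> n0" for \<phi> n
    using bspec[OF bspec[OF contr that(1)] one_in_cone] that(2,3) by simp
  have main: "\<bar>(L ^^ n) \<phi> x - integral\<^sup>L conf \<phi> * (L ^^ n) ?one x\<bar> \<le> \<epsilon> * (L ^^ n) ?one x"
    if \<phi>: "\<phi> \<in> dcone" "\<forall>x. \<phi> x \<le> B" and n: "n \<ge> n0" for \<phi> n x
  proof -
    obtain m M where mM0: "M - m < \<epsilon> \<and>
      (\<forall>x. m * (L ^^ n) ?one x \<le> (L ^^ n) \<phi> x \<and> (L ^^ n) \<phi> x \<le> M * (L ^^ n) ?one x)"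
      using n0[OF \<phi> n] by (elim exE)
    then have mM: "M - m < \<epsilon>"
      "\<And>x. m * (L ^^ n) ?one x \<le> (L ^^ n) \<phi> x" "\<And>x. (L ^^ n) \<phi> x \<le> M * (L ^^ n) ?one x"
      by simp_all
    have *: "m \<le> (L ^^ k) \<phi> base / (L ^^ k) ?one base \<and> (L ^^ k) \<phi> base / (L ^^ k) ?one base \<le> M"
      if "k \<ge> n" for k
    proof -
      have eq: "(L ^^ k) \<alpha> = (L ^^ (k - n)) ((L ^^ n) \<alpha>)" for \<alpha>
        using that by (metis comp_apply funpow_add le_add_diff_inverse2)
      have "m * (L ^^ k) ?one base \<le> (L ^^ k) \<phi> base" "(L ^^ k) \<phi> base \<le> M * (L ^^ k) ?one base"
        using L_iter_mono[of "\<lambda>x. m * (L ^^ n) ?one x" "(L ^^ n) \<phi>" "k - n" base]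
          L_iter_mono[of "(L ^^ n) \<phi>" "\<lambda>x. M * (L ^^ n) ?one x" "k - n" base] mM
        unfolding eq by (simp_all add: L_iter_scale)
      then show ?thesis using L_iter_one_pos[of k base] by (simp add: field_simps)
    qed
    have ev: "\<forall>\<^sub>F k in sequentially. m \<le> (L ^^ r k) \<phi> base / (L ^^ r k) ?one base \<and>
        (L ^^ r k) \<phi> base / (L ^^ r k) ?one base \<le> M"
      using eventually_ge_at_top[of n]
    proof eventually_elim
      case (elim k)
      show ?case by (rule *) (rule le_trans[OF elim seq_suble[OF r(1)]])
    qed
    have lim: "(\<lambda>k. (L ^^ r k) \<phi> base / (L ^^ r k) ?one base) \<longlonglongrightarrow> integral\<^sup>L conf \<phi>"
      using r(2)[OF cone_continuous[OF \<phi>(1)]] .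
    have I: "m \<le> integral\<^sup>L conf \<phi>" "integral\<^sup>L conf \<phi> \<le> M"
      using tendsto_lowerbound[OF lim, of m] tendsto_upperbound[OF lim, of M] ev
      unfolding eventually_conj_iff by auto
    define u where "u = (L ^^ n) ?one x"
    have u: "0 < u" using L_iter_one_pos by (simp add: u_def)
    have "(M - \<epsilon>) * u \<le> integral\<^sup>L conf \<phi> * u" "integral\<^sup>L conf \<phi> * u \<le> (m + \<epsilon>) * u"
      using I mM(1) u by (intro mult_right_mono; linarith)+
    then show ?thesis using mM(2)[of x] mM(3)[of x] unfolding u_def by (simp add: algebra_simps abs_le_iff)
  qed
  show ?thesis
    by (rule exI[of _ n0], intro ballI allI impI, rule main) assumption+
qed

lemma ratio_tendsto:
  assumes "\<phi> \<in> dcone"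
  shows "(\<lambda>n. (L ^^ n) \<phi> x / (L ^^ n) (\<lambda>_. 1) x) \<longlonglongrightarrow> integral\<^sup>L conf \<phi>"
proof (rule LIMSEQ_I)
  fix e :: real assume "e > 0"
  define B where "B = \<phi> base * K"
  have B: "B > 0" "\<forall>x. \<phi> x \<le> B"
    using cone_le_K[OF assms, of _ base] cone_pos[OF assms, of base] K_pos by (auto simp: B_def)
  have "e / 2 > 0" using \<open>e > 0\<close> by simp
  from ratio_limit[OF this B(1)] assms B(2) obtain n0 where
    n0: "\<And>n. n \<ge> n0 \<Longrightarrow> \<bar>(L ^^ n) \<phi> x - integral\<^sup>L conf \<phi> * (L ^^ n) (\<lambda>_. 1) x\<bar> \<le> e / 2 * (L ^^ n) (\<lambda>_. 1) x"
    by blast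
  have "norm ((L ^^ n) \<phi> x / (L ^^ n) (\<lambda>_. 1) x - integral\<^sup>L conf \<phi>) < e" if "n \<ge> n0" for n
  proof -
    define u v where "u = (L ^^ n) (\<lambda>_. 1::real) x" and "v = (L ^^ n) \<phi> x"
    have u: "0 < u" using L_iter_one_pos by (simp add: u_def)
    have "v / u - integral\<^sup>L conf \<phi> = (v - integral\<^sup>L conf \<phi> * u) / u"
      using u by (simp add: field_simps)
    then have "\<bar>v / u - integral\<^sup>L conf \<phi>\<bar> = \<bar>v - integral\<^sup>L conf \<phi> * u\<bar> / u"
      using u by (simp add: abs_divide)
    also have "\<dots> \<le> e / 2" using n0[OF that] u by (simp add: u_def v_def field_simps)
    finally show ?thesis using \<open>e > 0\<close> by (simp add: u_def v_def)
  qed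
  then show "\<exists>n0. \<forall>n\<ge>n0. norm ((L ^^ n) \<phi> x / (L ^^ n) (\<lambda>_. 1) x - integral\<^sup>L conf \<phi>) < e" by blast
qed

definition \<rho> :: real where "\<rho> = integral\<^sup>L conf (L (\<lambda>_. 1))"

lemma \<rho>_pos: "0 < \<rho>"
proof -
  have c: "L (\<lambda>_. 1) \<in> dcone" by (intro cone_L one_in_cone)
  have "0 < L (\<lambda>_. 1) base / K" using cone_pos[OF c] K_pos by simp
  also have "\<dots> \<le> \<rho>"
    unfolding \<rho>_def using cone_le_K[OF c, of base] K_pos
    by (intro nu.integral_ge_const nu.integrable_continuous cone_continuous c) (simp add: field_simps)
  finally show ?thesis .
qed

lemma integral_L_cone:
  assumes "\<phi> \<in> dcone"
  shows "integral\<^sup>L conf (L \<phi>) = \<rho> * integral\<^sup>L conf \<phi>"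
proof -
  let ?one = "\<lambda>_::circle. 1::real"
  have 1: "(\<lambda>n. (L ^^ n) (L \<phi>) base / (L ^^ n) ?one base) \<longlonglongrightarrow> integral\<^sup>L conf (L \<phi>)"
    using assms by (intro ratio_tendsto cone_L)
  have "(\<lambda>n. (L ^^ n) (L ?one) base / (L ^^ n) ?one base * ((L ^^ Suc n) \<phi> base / (L ^^ Suc n) ?one base))
      \<longlonglongrightarrow> \<rho> * integral\<^sup>L conf \<phi>"
    unfolding \<rho>_def
    by (intro tendsto_mult ratio_tendsto cone_L one_in_cone LIMSEQ_Suc assms)
  moreover have "(L ^^ n) (L ?one) base / (L ^^ n) ?one base * ((L ^^ Suc n) \<phi> base / (L ^^ Suc n) ?one base)
     = (L ^^ n) (L \<phi>) base / (L ^^ n) ?one base" for n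
    using L_iter_one_pos[of n base] L_iter_one_pos[of "Suc n" base]
    by (simp add: funpow_swap1 field_simps)
  ultimately show ?thesis using 1 LIMSEQ_unique by auto
qed

lemma integral_L_iter_cone: "\<phi> \<in> dcone \<Longrightarrow> integral\<^sup>L conf ((L ^^ n) \<phi>) = \<rho> ^ n * integral\<^sup>L conf \<phi>"
  by (induction n) (simp_all add: integral_L_cone cone_L_iter)

definition hn :: "nat \<Rightarrow> circle \<Rightarrow> real" where "hn n x = (L ^^ n) (\<lambda>_. 1) x / \<rho> ^ n"

lemma hn_cone: "hn n \<in> dcone"
proof -
  have "(\<lambda>x. (1 / \<rho> ^ n) * (L ^^ n) (\<lambda>_. 1) x) \<in> dcone"
    using \<rho>_pos by (intro cone_scale cone_L_iter one_in_cone) auto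
  then show ?thesis by (simp add: hn_def[abs_def])
qed

lemma integral_hn: "integral\<^sup>L conf (hn n) = 1"
  using integral_L_iter_cone[OF one_in_cone, of n] \<rho>_pos
  by (simp add: hn_def[abs_def] nu.prob_space)

lemma cone_normalised_bounds:
  assumes "\<phi> \<in> dcone" "integral\<^sup>L conf \<phi> = 1"
  shows "\<phi> x \<le> K" "1 / K \<le> \<phi> x"
proof -
  have i: "integrable conf \<phi>" by (intro nu.integrable_continuous cone_continuous assms)
  have "\<phi> x / K \<le> 1"
    unfolding assms(2)[symmetric] using cone_le_K[OF assms(1), of x] K_pos
    by (intro nu.integral_ge_const i) (simp add: field_simps)
  then show "\<phi> x \<le> K" using K_pos by (simp add: field_simps)
  have "1 \<le> \<phi> x * K"
    unfolding assms(2)[symmetric] using cone_le_K[OF assms(1)] by (intro nu.integral_le_const i)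
  then show "1 / K \<le> \<phi> x" using K_pos by (simp add: field_simps)
qed

lemma hn_bounds: "hn n x \<le> K" "1 / K \<le> hn n x"
  using cone_normalised_bounds[OF hn_cone integral_hn] by auto

lemma hn_add: "hn (n + m) x = (L ^^ n) (hn m) x / \<rho> ^ n"
proof -
  have "(L ^^ n) (hn m) x = (L ^^ n) (\<lambda>x. (1 / \<rho> ^ m) * (L ^^ m) (\<lambda>_. 1) x) x"
    by (simp add: hn_def[abs_def])
  also have "\<dots> = (1 / \<rho> ^ m) * (L ^^ (n + m)) (\<lambda>_. 1) x"
    by (simp only: L_iter_scale funpow_add comp_apply)
  finally show ?thesis by (simp add: hn_def power_add)
qed

text \<open>Uniformity of the limit over the cone, applied to the functions \<open>hn m\<close> themselves, makes
  the sequence uniformly Cauchy.\<close>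

lemma hn_Cauchy:
  assumes "e > 0"
  shows "\<exists>n0. \<forall>n\<ge>n0. \<forall>m x. \<bar>hn (n + m) x - hn n x\<bar> \<le> e"
proof -
  obtain n0 where n0: "\<And>\<phi> n x. \<phi> \<in> dcone \<Longrightarrow> (\<forall>x. \<phi> x \<le> K) \<Longrightarrow> n \<ge> n0 \<Longrightarrow>
    \<bar>(L ^^ n) \<phi> x - integral\<^sup>L conf \<phi> * (L ^^ n) (\<lambda>_. 1) x\<bar> \<le> e / K * (L ^^ n) (\<lambda>_. 1) x"
    using ratio_limit[OF divide_pos_pos[OF assms K_pos] K_pos] by blast
  have "\<bar>hn (n + m) x - hn n x\<bar> \<le> e" if "n \<ge> n0" for n m x
  proof -
    have "\<bar>(L ^^ n) (hn m) x - (L ^^ n) (\<lambda>_. 1) x\<bar> \<le> e / K * (L ^^ n) (\<lambda>_. 1) x"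
      using n0[OF hn_cone _ that, of m x] hn_bounds(1) by (simp add: integral_hn)
    then have "\<bar>(L ^^ n) (hn m) x - (L ^^ n) (\<lambda>_. 1) x\<bar> / \<rho> ^ n \<le> e / K * hn n x"
      using \<rho>_pos by (simp add: hn_def field_simps)
    also have "\<dots> \<le> e / K * K" using hn_bounds(1) assms K_pos by (intro mult_left_mono) auto
    finally show ?thesis using \<rho>_pos K_pos unfolding hn_add
      by (simp add: hn_def diff_divide_distrib[symmetric])
  qed
  then show ?thesis by blast
qed

definition h :: "circle \<Rightarrow> real" where "h x = lim (\<lambda>n. hn n x)"

lemma hn_tendsto: "(\<lambda>n. hn n x) \<longlonglongrightarrow> h x"
proof -
  have "Cauchy (\<lambda>n. hn n x)"
  proof (rule CauchyI')
    fix e :: real assume "e > 0"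
    then obtain n0 where "\<And>n m x. n \<ge> n0 \<Longrightarrow> \<bar>hn (n + m) x - hn n x\<bar> \<le> e / 2"
      using hn_Cauchy[of "e / 2"] by auto
    note n0 = this
    have "norm (hn m x - hn n x) < e" if "m \<ge> n0" "n > m" for m n
      using n0[OF that(1), of "n - m" x] that(2) \<open>e > 0\<close> by (simp add: abs_minus_commute)
    then show "\<exists>M. \<forall>m\<ge>M. \<forall>n>m. dist (hn m x) (hn n x) < e" by (auto simp: dist_norm)
  qed
  then show ?thesis by (simp add: h_def Cauchy_convergent_iff convergent_LIMSEQ_iff)
qed

lemma hn_uniform:
  assumes "e > 0"
  shows "\<exists>n0. \<forall>n\<ge>n0. \<forall>x. \<bar>hn n x - h x\<bar> \<le> e"
proof -
  obtain n0 where n0: "\<And>n m x. n \<ge> n0 \<Longrightarrow> \<bar>hn (n + m) x - hn n x\<bar> \<le> e"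
    using hn_Cauchy[OF assms] by auto
  have "\<bar>hn n x - h x\<bar> \<le> e" if "n \<ge> n0" for n x
  proof -
    have "(\<lambda>m. \<bar>hn (m + n) x - hn n x\<bar>) \<longlonglongrightarrow> \<bar>h x - hn n x\<bar>"
      using hn_tendsto[of x] by (intro tendsto_intros LIMSEQ_ignore_initial_segment)
    then have "\<bar>h x - hn n x\<bar> \<le> e"
      by (rule tendsto_upperbound) (use n0[OF that] in \<open>auto simp: add.commute\<close>)
    then show ?thesis by (simp add: abs_minus_commute)
  qed
  then show ?thesis by blast
qed

lemma h_cone: "h \<in> dcone"
  unfolding dcone_def
proof (intro CollectI conjI allI)
  fix x y
  have "1 / K \<le> h x" using hn_tendsto by (rule tendsto_lowerbound) (simp_all add: hn_bounds)
  moreover have "0 < 1 / K" using K_pos by simp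
  ultimately show "0 < h x" by linarith
  have "(\<lambda>n. hn n y * exp (\<Psi> (dist x y))) \<longlonglongrightarrow> h y * exp (\<Psi> (dist x y))"
    by (intro tendsto_intros hn_tendsto)
  then show "h x \<le> h y * exp (\<Psi> (dist x y))"
    by (rule LIMSEQ_le[OF hn_tendsto]) (use cone_le[OF hn_cone] in auto)
qed

lemma integral_h: "integral\<^sup>L conf h = 1"
proof -
  have "(\<lambda>n. integral\<^sup>L conf (hn n)) \<longlonglongrightarrow> integral\<^sup>L conf h"
  proof (rule integral_dominated_convergence[where w="\<lambda>_. K"])
    show "h \<in> borel_measurable conf" "hn n \<in> borel_measurable conf" for n
      using borel_measurable_continuous_onI[OF cone_continuous] h_cone hn_cone by auto
    show "AE x in conf. norm (hn n x) \<le> K" for n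
      using hn_bounds(1) cone_pos[OF hn_cone] by (auto simp: less_imp_le abs_of_pos)
  qed (use hn_tendsto in auto)
  then show ?thesis by (simp add: integral_hn LIMSEQ_const_iff)
qed

lemma L_h: "L h = (\<lambda>x. \<rho> * h x)"
proof
  fix x
  have "(\<lambda>n. L (hn n) x) \<longlonglongrightarrow> L h x"
    unfolding L_eq_crep by (intro tendsto_intros hn_tendsto)
  moreover have "L (hn n) x = \<rho> * hn (Suc n) x" for n
    using hn_add[of 1 n x] \<rho>_pos by simp
  moreover have "(\<lambda>n. \<rho> * hn (Suc n) x) \<longlonglongrightarrow> \<rho> * h x"
    by (intro tendsto_intros LIMSEQ_Suc hn_tendsto)
  ultimately show "L h x = \<rho> * h x" using LIMSEQ_unique by auto
qed

end

section \<open>Convergence for continuous functions and its consequences\<close>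

context transfer_cone
begin

lemma h_pos: "0 < h x"
  using cone_pos[OF h_cone] .

lemma h_bounds: "h x \<le> K" "1 / K \<le> h x"
  using cone_normalised_bounds[OF h_cone integral_h] by auto

lemma h_cont: "continuous_on UNIV h"
  using h_cone by (rule cone_continuous)

text \<open>Adding a large constant makes the function large compared to its Lipschitz constant, and then
  \<open>1 + \<Psi>\<close> bounds the relative variation.\<close>

lemma lipschitz_shift_in_cone:
  assumes "0 \<le> C" "\<And>x y. \<bar>\<phi> x - \<phi> y\<bar> \<le> C * dist x y"
  shows "\<exists>c. (\<lambda>x. \<phi> x + c) \<in> dcone"
proof -
  obtain c0 where c0: "c0 > 0" "\<And>x. 0 \<le> x \<Longrightarrow> x \<le> 1 \<Longrightarrow> x \<le> c0 * \<Psi> x"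
    using \<Psi>_linear by auto
  define c where "c = \<bar>\<phi> base\<bar> + C + C * c0 + 1"
  have low: "C * c0 + 1 \<le> \<phi> x + c" for x
  proof -
    have "\<bar>\<phi> x - \<phi> base\<bar> \<le> C * dist x base" using assms(2) .
    also have "\<dots> \<le> C * 1" using dist_circle_le_half[of x base] assms(1) by (intro mult_left_mono) auto
    finally show ?thesis unfolding c_def by linarith
  qed
  have Cc: "0 \<le> C * c0" using c0 assms by simp
  have "\<phi> x + c \<le> (\<phi> y + c) * exp (\<Psi> (dist x y))" for x y
  proof -
    have d: "dist x y \<le> 1" using dist_circle_le_half[of x y] by simp
    have P: "0 \<le> \<Psi> (dist x y)" using d by (intro \<Psi>_nonneg) auto
    have "\<phi> x + c \<le> \<phi> y + c + C * dist x y" using assms(2)[of x y] by linarith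
    also have "\<dots> \<le> \<phi> y + c + C * (c0 * \<Psi> (dist x y))"
      using c0(2)[of "dist x y"] d assms(1) by (intro add_left_mono mult_left_mono) auto
    also have "\<dots> \<le> (\<phi> y + c) + (\<phi> y + c) * \<Psi> (dist x y)"
      using mult_right_mono[OF _ P, of "C * c0" "\<phi> y + c"] low[of y] by simp
    also have "\<dots> = (\<phi> y + c) * (1 + \<Psi> (dist x y))" by (simp add: algebra_simps)
    also have "\<dots> \<le> (\<phi> y + c) * exp (\<Psi> (dist x y))"
      using low[of y] Cc by (intro mult_left_mono) auto
    finally show ?thesis .
  qed
  moreover have "0 < \<phi> x + c" for x using low[of x] Cc by linarith
  ultimately show ?thesis by (intro exI[of _ c]) (simp add: dcone_def)
qed

lemma cone_approx:
  assumes "continuous_on UNIV \<phi>" "e > 0"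
  shows "\<exists>\<alpha>\<in>dcone. \<exists>c. \<forall>x. \<bar>\<phi> x - (1 * \<alpha> x + c * 1)\<bar> \<le> e"
proof -
  obtain \<psi> C where \<psi>: "0 \<le> C" "\<forall>x y. \<bar>\<psi> x - \<psi> y\<bar> \<le> C * dist x y" "\<forall>x. \<bar>\<phi> x - \<psi> x\<bar> < e"
    using circle_lipschitz_dense[OF assms] by (elim exE conjE)
  obtain c where c: "(\<lambda>x. \<psi> x + c) \<in> dcone"
    using lipschitz_shift_in_cone[of C \<psi>] \<psi>(1,2) by auto
  show ?thesis
    by (rule bexI[OF _ c], rule exI[of _ "- c"]) (use \<psi>(3) in \<open>simp add: less_imp_le\<close>)
qed

lemma L_iter_dist:
  assumes "\<And>x. \<bar>\<phi> x - \<psi> x\<bar> \<le> e"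
  shows "\<bar>(L ^^ n) \<phi> x - (L ^^ n) \<psi> x\<bar> \<le> e * (L ^^ n) (\<lambda>_. 1) x"
proof -
  have b: "\<phi> x \<le> 1 * \<psi> x + e * 1" "1 * \<psi> x + (- e) * 1 \<le> \<phi> x" for x
    using assms[of x] by (auto simp: abs_le_iff)
  have "(L ^^ n) \<phi> x \<le> (L ^^ n) (\<lambda>x. 1 * \<psi> x + e * 1) x"
    by (rule L_iter_mono) (rule b(1))
  moreover have "(L ^^ n) (\<lambda>x. 1 * \<psi> x + (- e) * 1) x \<le> (L ^^ n) \<phi> x"
    by (rule L_iter_mono) (rule b(2))
  ultimately show ?thesis unfolding L_iter_lincomb by (simp add: abs_le_iff)
qed

lemma integral_diff_le:
  fixes \<phi> \<psi> :: "circle \<Rightarrow> real"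
  assumes "continuous_on UNIV \<phi>" "continuous_on UNIV \<psi>" "\<And>x. \<bar>\<phi> x - \<psi> x\<bar> \<le> e"
  shows "\<bar>integral\<^sup>L conf \<phi> - integral\<^sup>L conf \<psi>\<bar> \<le> e"
proof -
  have i: "integrable conf \<phi>" "integrable conf \<psi>"
    by (rule nu.integrable_continuous[OF assms(1)], rule nu.integrable_continuous[OF assms(2)])
  have b: "\<phi> x - \<psi> x \<le> e" "- e \<le> \<phi> x - \<psi> x" for x using assms(3)[of x] by linarith+
  have "integral\<^sup>L conf (\<lambda>x. \<phi> x - \<psi> x) \<le> e" "- e \<le> integral\<^sup>L conf (\<lambda>x. \<phi> x - \<psi> x)"
    using b by (intro nu.integral_le_const nu.integral_ge_const Bochner_Integration.integrable_diff i; simp)+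
  then show ?thesis using i by (simp add: abs_le_iff)
qed

lemma convergence_cone:
  assumes "\<phi> \<in> dcone" "e > 0"
  shows "\<forall>\<^sub>F n in sequentially. \<forall>x. \<bar>(L ^^ n) \<phi> x / \<rho> ^ n - h x * integral\<^sup>L conf \<phi>\<bar> \<le> e"
proof -
  define B where "B = \<phi> base * K"
  have B: "B > 0" "\<forall>x. \<phi> x \<le> B"
    using cone_le_K[OF assms(1), of _ base] cone_pos[OF assms(1), of base] K_pos by (auto simp: B_def)
  define I where "I = integral\<^sup>L conf \<phi>"
  have e: "e / (2 * K) > 0" "e / (2 * (\<bar>I\<bar> + 1)) > 0" using assms(2) K_pos by auto
  obtain n1 where n1: "\<And>n x. n \<ge> n1 \<Longrightarrow>
      \<bar>(L ^^ n) \<phi> x - I * (L ^^ n) (\<lambda>_. 1) x\<bar> \<le> e / (2 * K) * (L ^^ n) (\<lambda>_. 1) x"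
    using ratio_limit[OF e(1) B(1)] assms(1) B(2) unfolding I_def by blast
  obtain n2 where n2: "\<And>n x. n \<ge> n2 \<Longrightarrow> \<bar>hn n x - h x\<bar> \<le> e / (2 * (\<bar>I\<bar> + 1))"
    using hn_uniform[OF e(2)] by blast
  have "\<bar>(L ^^ n) \<phi> x / \<rho> ^ n - h x * I\<bar> \<le> e" if n: "n \<ge> max n1 n2" for n x
  proof -
    have "(L ^^ n) \<phi> x / \<rho> ^ n - I * hn n x = ((L ^^ n) \<phi> x - I * (L ^^ n) (\<lambda>_. 1) x) / \<rho> ^ n"
      using \<rho>_pos by (simp add: hn_def field_simps)
    then have "\<bar>(L ^^ n) \<phi> x / \<rho> ^ n - I * hn n x\<bar>
        = \<bar>(L ^^ n) \<phi> x - I * (L ^^ n) (\<lambda>_. 1) x\<bar> / \<rho> ^ n"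
      using \<rho>_pos by (simp add: abs_divide)
    also have "\<dots> \<le> (e / (2 * K) * (L ^^ n) (\<lambda>_. 1) x) / \<rho> ^ n"
      using n1[of n x] n \<rho>_pos by (intro divide_right_mono) auto
    also have "\<dots> = e / (2 * K) * hn n x" by (simp add: hn_def)
    also have "\<dots> \<le> e / (2 * K) * K"
      using hn_bounds(1) assms(2) K_pos by (intro mult_left_mono) auto
    also have "\<dots> = e / 2" using K_pos by simp
    finally have 1: "\<bar>(L ^^ n) \<phi> x / \<rho> ^ n - I * hn n x\<bar> \<le> e / 2" .
    have "\<bar>I * hn n x - h x * I\<bar> = \<bar>I\<bar> * \<bar>hn n x - h x\<bar>"
      by (simp add: abs_mult[symmetric] algebra_simps)
    also have "\<dots> \<le> (\<bar>I\<bar> + 1) * (e / (2 * (\<bar>I\<bar> + 1)))"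
      using n2[of n x] n by (intro mult_mono) auto
    also have "\<dots> = e / 2" by (simp add: field_simps add_nonneg_eq_0_iff)
    finally have "\<bar>I * hn n x - h x * I\<bar> \<le> e / 2" .
    then show ?thesis using 1 by linarith
  qed
  then show ?thesis unfolding I_def eventually_sequentially by blast
qed

text \<open>The operators \<open>L\<^sup>n / \<rho>\<^sup>n\<close> are bounded by \<open>K\<close> uniformly in \<open>n\<close>, so that convergence passes from
  the span of the cone to its closure.\<close>

theorem convergence:
  assumes "continuous_on UNIV \<phi>" "e > 0"
  shows "\<forall>\<^sub>F n in sequentially. \<forall>x. \<bar>(L ^^ n) \<phi> x / \<rho> ^ n - h x * integral\<^sup>L conf \<phi>\<bar> \<le> e"
proof -
  define d where "d = e / (4 * K)"
  have d: "d > 0" using assms K_pos by (simp add: d_def)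
  obtain \<alpha> c where "\<alpha> \<in> dcone" and near: "\<forall>x. \<bar>\<phi> x - (1 * \<alpha> x + c * 1)\<bar> \<le> d"
    by (rule bexE[OF cone_approx[OF assms(1) d]], elim exE, rule that)
  note \<alpha> = \<open>\<alpha> \<in> dcone\<close> spec[OF near]
  let ?\<psi> = "\<lambda>x. 1 * \<alpha> x + c * 1"
  have e4: "e / 4 > 0" "e / (4 * (\<bar>c\<bar> + 1)) > 0" using assms by auto
  show ?thesis
    using convergence_cone[OF \<alpha>(1) e4(1)] convergence_cone[OF one_in_cone e4(2)]
  proof eventually_elim
    case (elim n)
    show ?case
    proof
      fix x
      have a_cont: "continuous_on UNIV \<alpha>" using \<alpha>(1) by (rule cone_continuous)
      have I\<psi>: "integral\<^sup>L conf ?\<psi> = integral\<^sup>L conf \<alpha> + c"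
        using nu.integrable_continuous[OF a_cont] by simp
      have I: "\<bar>integral\<^sup>L conf \<phi> - (integral\<^sup>L conf \<alpha> + c)\<bar> \<le> d"
        unfolding I\<psi>[symmetric]
        by (rule integral_diff_le[OF assms(1) _ \<alpha>(2)]) (intro continuous_intros a_cont)
      have "\<bar>(L ^^ n) \<phi> x / \<rho> ^ n - (L ^^ n) ?\<psi> x / \<rho> ^ n\<bar> = \<bar>(L ^^ n) \<phi> x - (L ^^ n) ?\<psi> x\<bar> / \<rho> ^ n"
        using \<rho>_pos by (simp add: diff_divide_distrib[symmetric] abs_divide)
      also have "\<dots> \<le> d * (L ^^ n) (\<lambda>_. 1) x / \<rho> ^ n"
        using L_iter_dist[of \<phi> ?\<psi> d n x, OF \<alpha>(2)] \<rho>_pos by (intro divide_right_mono) auto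
      also have "\<dots> = d * hn n x" by (simp add: hn_def)
      also have "\<dots> \<le> d * K" using d hn_bounds(1) by (intro mult_left_mono) auto
      also have "\<dots> = e / 4" using K_pos by (simp add: d_def)
      finally have 1: "\<bar>(L ^^ n) \<phi> x / \<rho> ^ n - (L ^^ n) ?\<psi> x / \<rho> ^ n\<bar> \<le> e / 4" .
      have 2: "(L ^^ n) ?\<psi> x / \<rho> ^ n = (L ^^ n) \<alpha> x / \<rho> ^ n + c * ((L ^^ n) (\<lambda>_. 1) x / \<rho> ^ n)"
        unfolding L_iter_lincomb by (simp add: add_divide_distrib)
      have 3: "\<bar>(L ^^ n) \<alpha> x / \<rho> ^ n - h x * integral\<^sup>L conf \<alpha>\<bar> \<le> e / 4" using elim(1) by blast
      have "\<bar>c * ((L ^^ n) (\<lambda>_. 1) x / \<rho> ^ n) - c * h x\<bar> = \<bar>c\<bar> * \<bar>(L ^^ n) (\<lambda>_. 1) x / \<rho> ^ n - h x\<bar>"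
        by (simp add: abs_mult[symmetric] right_diff_distrib)
      also have "\<dots> \<le> (\<bar>c\<bar> + 1) * (e / (4 * (\<bar>c\<bar> + 1)))"
        using elim(2) by (intro mult_mono) auto
      also have "\<dots> = e / 4" by (simp add: field_simps add_nonneg_eq_0_iff)
      finally have 4: "\<bar>c * ((L ^^ n) (\<lambda>_. 1) x / \<rho> ^ n) - c * h x\<bar> \<le> e / 4" .
      have "\<bar>h x * (integral\<^sup>L conf \<alpha> + c) - h x * integral\<^sup>L conf \<phi>\<bar>
          = h x * \<bar>integral\<^sup>L conf \<phi> - (integral\<^sup>L conf \<alpha> + c)\<bar>"
        using h_pos[of x] by (simp add: right_diff_distrib[symmetric] abs_mult abs_minus_commute)
      also have "\<dots> \<le> K * d" using h_bounds(1)[of x] h_pos[of x] I K_pos by (intro mult_mono) auto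
      also have "\<dots> = e / 4" using K_pos by (simp add: d_def)
      finally have 5: "\<bar>h x * (integral\<^sup>L conf \<alpha> + c) - h x * integral\<^sup>L conf \<phi>\<bar> \<le> e / 4" .
      have 6: "h x * (integral\<^sup>L conf \<alpha> + c) = h x * integral\<^sup>L conf \<alpha> + c * h x"
        by (simp add: algebra_simps)
      show "\<bar>(L ^^ n) \<phi> x / \<rho> ^ n - h x * integral\<^sup>L conf \<phi>\<bar> \<le> e"
        using 1 3 4 5 unfolding 2 6 by linarith
    qed
  qed
qed

corollary convergence_uniform_limit:
  assumes "continuous_on UNIV \<phi>"
  shows "uniform_limit UNIV (\<lambda>n x. inverse (\<rho> ^ n) * (L ^^ n) \<phi> x) (\<lambda>x. h x * integral\<^sup>L conf \<phi>) sequentially"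
  unfolding uniform_limit_iff
proof (intro allI impI)
  fix e :: real assume "e > 0"
  then have "\<forall>\<^sub>F n in sequentially. \<forall>x. \<bar>(L ^^ n) \<phi> x / \<rho> ^ n - h x * integral\<^sup>L conf \<phi>\<bar> \<le> e / 2"
    using assms by (intro convergence) auto
  then show "\<forall>\<^sub>F n in sequentially. \<forall>x\<in>UNIV. dist (inverse (\<rho> ^ n) * (L ^^ n) \<phi> x) (h x * integral\<^sup>L conf \<phi>) < e"
  proof eventually_elim
    case (elim n)
    have "dist (inverse (\<rho> ^ n) * (L ^^ n) \<phi> x) (h x * integral\<^sup>L conf \<phi>) < e" for x
    proof -
      have "inverse (\<rho> ^ n) * (L ^^ n) \<phi> x = (L ^^ n) \<phi> x / \<rho> ^ n" by (simp add: field_simps)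
      then show ?thesis using spec[OF elim, of x] \<open>e > 0\<close> unfolding dist_real_def by simp
    qed
    then show ?case by blast
  qed
qed

corollary convergence_pointwise:
  assumes "continuous_on UNIV \<phi>"
  shows "(\<lambda>n. (L ^^ n) \<phi> x / \<rho> ^ n) \<longlonglongrightarrow> h x * integral\<^sup>L conf \<phi>"
  using tendsto_uniform_limitI[OF convergence_uniform_limit[OF assms], of x]
  by (simp add: field_simps)

theorem integral_L:
  assumes "continuous_on UNIV \<phi>"
  shows "integral\<^sup>L conf (L \<phi>) = \<rho> * integral\<^sup>L conf \<phi>"
proof -
  have 1: "(\<lambda>n. (L ^^ n) (L \<phi>) base / \<rho> ^ n) \<longlonglongrightarrow> h base * integral\<^sup>L conf (L \<phi>)"
    by (intro convergence_pointwise L_continuous assms)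
  have 2: "(\<lambda>n. \<rho> * ((L ^^ Suc n) \<phi> base / \<rho> ^ Suc n)) \<longlonglongrightarrow> \<rho> * (h base * integral\<^sup>L conf \<phi>)"
    by (intro tendsto_mult tendsto_const LIMSEQ_Suc convergence_pointwise assms)
  have eq: "\<rho> * ((L ^^ Suc n) \<phi> base / \<rho> ^ Suc n) = (L ^^ n) (L \<phi>) base / \<rho> ^ n" for n
    using \<rho>_pos by (simp add: funpow_swap1)
  have "\<rho> * (h base * integral\<^sup>L conf \<phi>) = h base * integral\<^sup>L conf (L \<phi>)"
    using 2 unfolding eq by (rule LIMSEQ_unique[OF _ 1])
  then show ?thesis using h_pos[of base] by simp
qed

lemma integral_L_iter:
  "continuous_on UNIV \<phi> \<Longrightarrow> integral\<^sup>L conf ((L ^^ n) \<phi>) = \<rho> ^ n * integral\<^sup>L conf \<phi>"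
  by (induction n) (simp_all add: integral_L L_iter_continuous)

section \<open>The peripheral spectrum\<close>

abbreviation LC :: "(circle \<Rightarrow> complex) \<Rightarrow> circle \<Rightarrow> complex" where "LC \<equiv> transfer_op T f"

lemma LC_Complex: "LC \<phi> x = Complex (L (\<lambda>y. Re (\<phi> y)) x) (L (\<lambda>y. Im (\<phi> y)) x)"
  by (simp add: transfer_op_def complex_eq_iff)

lemma LC_iter_Complex: "(LC ^^ n) \<phi> x = Complex ((L ^^ n) (\<lambda>y. Re (\<phi> y)) x) ((L ^^ n) (\<lambda>y. Im (\<phi> y)) x)"
  by (induction n arbitrary: x) (simp_all add: LC_Complex)

definition cint :: "(circle \<Rightarrow> complex) \<Rightarrow> complex" where
  "cint \<phi> = Complex (integral\<^sup>L conf (\<lambda>y. Re (\<phi> y))) (integral\<^sup>L conf (\<lambda>y. Im (\<phi> y)))"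

lemma convergence_complex:
  assumes "continuous_on UNIV \<phi>"
  shows "(\<lambda>n. (LC ^^ n) \<phi> x / of_real \<rho> ^ n) \<longlonglongrightarrow> of_real (h x) * cint \<phi>"
proof -
  have c: "continuous_on UNIV (\<lambda>y. Re (\<phi> y))" "continuous_on UNIV (\<lambda>y. Im (\<phi> y))"
    using assms by (auto intro: continuous_intros)
  have "(LC ^^ n) \<phi> x / of_real \<rho> ^ n = Complex ((L ^^ n) (\<lambda>y. Re (\<phi> y)) x / \<rho> ^ n) ((L ^^ n) (\<lambda>y. Im (\<phi> y)) x / \<rho> ^ n)" for n
    unfolding LC_iter_Complex of_real_power[symmetric] by (simp add: complex_eq_iff)
  then have "(\<lambda>n. (LC ^^ n) \<phi> x / of_real \<rho> ^ n) \<longlonglongrightarrow>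
      Complex (h x * integral\<^sup>L conf (\<lambda>y. Re (\<phi> y))) (h x * integral\<^sup>L conf (\<lambda>y. Im (\<phi> y)))"
    using convergence_pointwise[OF c(1), of x] convergence_pointwise[OF c(2), of x]
    by (simp add: tendsto_Complex)
  moreover have "Complex (h x * integral\<^sup>L conf (\<lambda>y. Re (\<phi> y))) (h x * integral\<^sup>L conf (\<lambda>y. Im (\<phi> y)))
      = of_real (h x) * cint \<phi>" by (simp add: cint_def complex_eq_iff)
  ultimately show ?thesis by simp
qed

end

text \<open>Both simplicity claims, over the real and over the complex numbers, follow from convergence
  of the normalised iterates alone: a Jordan block would make them grow linearly. The powers of
  \<open>L - c\<close> are followed in the larger space \<open>F'\<close>.\<close>

lemma simple_eigenvalue_of_convergence:
  fixes L :: "('x \<Rightarrow> 'b::real_normed_field) \<Rightarrow> 'x \<Rightarrow> 'b"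
  assumes lin: "\<And>a b \<phi> \<psi>. L (\<lambda>x. a * \<phi> x + b * \<psi> x) = (\<lambda>x. a * L \<phi> x + b * L \<psi> x)"
    and sub: "F \<subseteq> F'"
    and F: "\<And>\<phi>. \<phi> \<in> F' \<Longrightarrow> (\<lambda>x. L \<phi> x - c * \<phi> x) \<in> F'" "\<And>a. (\<lambda>x. a * h x) \<in> F"
    and h: "L h = (\<lambda>x. c * h x)" "h x0 \<noteq> 0" and c: "c \<noteq> 0"
    and conv: "\<And>\<phi> x. \<phi> \<in> F' \<Longrightarrow> (\<lambda>n. (L ^^ n) \<phi> x / c ^ n) \<longlonglongrightarrow> h x * J \<phi>"
  shows "is_simple_eigenvalue F L c"
proof -
  define D where "D \<phi> = (\<lambda>x. L \<phi> x - c * \<phi> x)" for \<phi>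
  have scale: "L (\<lambda>x. a * \<phi> x) = (\<lambda>x. a * L \<phi> x)" for a \<phi> using lin[of a \<phi> 0 \<phi>] by simp
  have eig: "\<phi> = (\<lambda>x. J \<phi> * h x)" if "\<phi> \<in> F'" "D \<phi> = (\<lambda>_. 0)" for \<phi>
  proof -
    have "L \<phi> = (\<lambda>x. c * \<phi> x)" using that(2) unfolding D_def by (simp add: fun_eq_iff)
    then have it: "(L ^^ n) \<phi> = (\<lambda>x. c ^ n * \<phi> x)" for n
      by (induction n) (simp_all add: scale mult.assoc mult.left_commute)
    have "\<phi> x = h x * J \<phi>" for x
      using conv[OF that(1), of x] c by (simp add: it LIMSEQ_const_iff)
    then show ?thesis by (simp add: fun_eq_iff mult.commute)
  qed
  have jordan: "D \<phi> = (\<lambda>_. 0)" if "\<phi> \<in> F'" "D (D \<phi>) = (\<lambda>_. 0)" for \<phi>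
  proof -
    define \<psi> where "\<psi> = D \<phi>"
    have L\<psi>: "L \<psi> = (\<lambda>x. c * \<psi> x)" using that(2) unfolding D_def \<psi>_def by (simp add: fun_eq_iff)
    have L\<phi>: "L \<phi> = (\<lambda>x. c * \<phi> x + 1 * \<psi> x)" unfolding \<psi>_def D_def by simp
    have "(L ^^ n) \<phi> = (\<lambda>x. c ^ n * \<phi> x + (of_nat n * c ^ n / c) * \<psi> x)" for n
    proof (induction n)
      case (Suc n)
      have "(L ^^ Suc n) \<phi> = L (\<lambda>x. c ^ n * \<phi> x + (of_nat n * c ^ n / c) * \<psi> x)" using Suc by simp
      also have "\<dots> = (\<lambda>x. c ^ n * L \<phi> x + (of_nat n * c ^ n / c) * L \<psi> x)" by (rule lin)
      also have "\<dots> = (\<lambda>x. c ^ Suc n * \<phi> x + (of_nat (Suc n) * c ^ Suc n / c) * \<psi> x)"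
        using c unfolding L\<phi> L\<psi> by (simp add: fun_eq_iff field_simps)
      finally show ?case .
    qed simp
    then have it: "(L ^^ n) \<phi> x / c ^ n = \<phi> x + of_nat n * (\<psi> x / c)" for n x
      using c by (simp add: field_simps)
    have "\<psi> x = 0" for x
    proof -
      define v where "v = \<psi> x / c"
      have l: "(\<lambda>n. \<phi> x + of_nat n * v) \<longlonglongrightarrow> h x * J \<phi>"
        using conv[OF that(1), of x] unfolding it v_def .
      have "(\<lambda>n. (\<phi> x + of_nat (Suc n) * v) - (\<phi> x + of_nat n * v)) \<longlonglongrightarrow> h x * J \<phi> - h x * J \<phi>"
        by (intro tendsto_diff LIMSEQ_Suc[OF l] l)
      moreover have "(\<phi> x + of_nat (Suc n) * v) - (\<phi> x + of_nat n * v) = v" for n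
        by (simp add: algebra_simps)
      ultimately have "(\<lambda>n::nat. v) \<longlonglongrightarrow> 0" by simp
      then show ?thesis using c by (simp add: LIMSEQ_const_iff v_def)
    qed
    then show ?thesis by (simp add: \<psi>_def fun_eq_iff)
  qed
  have D0: "D (\<lambda>_. 0) = (\<lambda>_. 0)" using scale[of 0 "\<lambda>_. 0"] by (simp add: D_def)
  have DF: "(D ^^ n) \<phi> \<in> F'" if "\<phi> \<in> F'" for n \<phi>
    using that F(1) by (induction n) (auto simp: D_def)
  have gen: "D \<phi> = (\<lambda>_. 0)" if "\<phi> \<in> F'" "(D ^^ n) \<phi> = (\<lambda>_. 0)" for n \<phi>
    using that(2)
  proof (induction n)
    case 0
    then show ?case using D0 by simp
  next
    case (Suc n)
    show ?case
    proof (cases n)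
      case 0
      then show ?thesis using Suc by simp
    next
      case (Suc k)
      then have "D (D ((D ^^ k) \<phi>)) = (\<lambda>_. 0)" using Suc.prems by simp
      then have "D ((D ^^ k) \<phi>) = (\<lambda>_. 0)" using jordan[OF DF[OF that(1)]] by blast
      then show ?thesis using Suc Suc.IH by simp
    qed
  qed
  have Dh: "D (\<lambda>x. a * h x) = (\<lambda>_. 0)" for a unfolding D_def scale h by (simp add: fun_eq_iff)
  have "{\<phi> \<in> F. \<exists>n. (D ^^ n) \<phi> = (\<lambda>_. 0)} = {\<lambda>x. a * h x | a. True}"
  proof (intro equalityI subsetI)
    fix \<phi> assume "\<phi> \<in> {\<phi> \<in> F. \<exists>n. (D ^^ n) \<phi> = (\<lambda>_. 0)}"
    then show "\<phi> \<in> {\<lambda>x. a * h x | a. True}" using eig gen sub by blast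
  next
    fix \<phi> assume "\<phi> \<in> {\<lambda>x. a * h x | a. True}"
    then obtain a where "\<phi> = (\<lambda>x. a * h x)" by blast
    then show "\<phi> \<in> {\<phi> \<in> F. \<exists>n. (D ^^ n) \<phi> = (\<lambda>_. 0)}"
      using F(2) Dh by (auto intro!: exI[of _ 1])
  qed
  then have "generalised_eigenspace F L c = {\<lambda>x. a * h x | a. True}"
    unfolding generalised_eigenspace_def D_def .
  moreover have "is_eigenvalue F L c"
    unfolding is_eigenvalue_def using h F(2)[of 1] by (intro bexI[of _ h]) auto
  ultimately show ?thesis unfolding is_simple_eigenvalue_def by blast
qed

lemma power_convergent_imp_one:
  fixes z :: complex
  assumes "cmod z \<ge> 1" "(\<lambda>n. z ^ n) \<longlonglongrightarrow> l"
  shows "z = 1"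
proof -
  have "(\<lambda>n. z * z ^ n) \<longlonglongrightarrow> l" using LIMSEQ_Suc[OF assms(2)] by simp
  moreover have "(\<lambda>n. z * z ^ n) \<longlonglongrightarrow> z * l" by (intro tendsto_intros assms)
  ultimately have "l = z * l" by (rule LIMSEQ_unique)
  moreover have "l \<noteq> 0"
  proof
    assume "l = 0"
    then have "(\<lambda>n. cmod (z ^ n)) \<longlonglongrightarrow> 0" using assms(2) tendsto_norm_zero by blast
    moreover have "1 \<le> cmod (z ^ n)" for n using assms(1) by (simp add: norm_power one_le_power)
    ultimately show False using LIMSEQ_le_const[of "\<lambda>n. cmod (z ^ n)" 0 1] by auto
  qed
  ultimately show ?thesis by simp
qed

context transfer_cone
begin

lemma no_other_peripheral_eigenvalue:
  assumes "is_eigenvalue {\<phi> :: circle \<Rightarrow> complex. continuous_on UNIV \<phi>} LC c" "cmod c \<ge> \<rho>"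
  shows "c = of_real \<rho>"
proof -
  obtain g where g: "continuous_on UNIV g" "g \<noteq> (\<lambda>_. 0)" "LC g = (\<lambda>x. c * g x)"
    using assms(1) unfolding is_eigenvalue_def by blast
  then obtain x where x: "g x \<noteq> 0" by auto
  have scale: "LC (\<lambda>x. a * \<phi> x) = (\<lambda>x. a * LC \<phi> x)" for a \<phi>
    by (rule ext) (simp add: transfer_op_def sum_distrib_left)
  have it: "(LC ^^ n) g = (\<lambda>x. c ^ n * g x)" for n
    by (induction n) (simp_all add: scale g(3) mult.assoc mult.left_commute)
  have "(\<lambda>n. c ^ n * g x / of_real \<rho> ^ n) \<longlonglongrightarrow> of_real (h x) * cint g"
    using convergence_complex[OF g(1), of x] by (simp add: it)
  then have "(\<lambda>n. c ^ n * g x / of_real \<rho> ^ n / g x) \<longlonglongrightarrow> of_real (h x) * cint g / g x"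
    using x by (intro tendsto_divide tendsto_const) auto
  moreover have "c ^ n * g x / of_real \<rho> ^ n / g x = (c / of_real \<rho>) ^ n" for n
    using x by (simp add: power_divide)
  ultimately have "(\<lambda>n. (c / of_real \<rho>) ^ n) \<longlonglongrightarrow> of_real (h x) * cint g / g x" by simp
  moreover have "cmod (c / of_real \<rho>) \<ge> 1" using assms(2) \<rho>_pos by (simp add: norm_divide)
  ultimately have "c / of_real \<rho> = 1" by (intro power_convergent_imp_one)
  then show ?thesis using \<rho>_pos by (simp add: divide_eq_1_iff)
qed

lemma simple_complex: "is_simple_eigenvalue {\<phi> :: circle \<Rightarrow> complex. continuous_on UNIV \<phi>} LC (of_real \<rho>)"
proof (rule simple_eigenvalue_of_convergence[OF _ order_refl, where h = "\<lambda>x. of_real (h x)" and J = cint and ?x0.0 = base])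
  show "LC (\<lambda>x. a * \<phi> x + b * \<psi> x) = (\<lambda>x. a * LC \<phi> x + b * LC \<psi> x)" for a b \<phi> \<psi>
    by (rule ext) (simp add: transfer_op_def sum.distrib sum_distrib_left scaleR_add_right)
  have LCc: "continuous_on UNIV (LC \<phi>)" if "continuous_on UNIV \<phi>" for \<phi>
    unfolding LC_Complex[abs_def] Complex_eq
    by (intro continuous_intros L_continuous that)
  show "(\<lambda>x. LC \<phi> x - of_real \<rho> * \<phi> x) \<in> {\<phi>. continuous_on UNIV \<phi>}" if "\<phi> \<in> {\<phi>. continuous_on UNIV \<phi>}" for \<phi>
    using that LCc by (auto intro!: continuous_intros)
  show "(\<lambda>x. a * of_real (h x)) \<in> {\<phi>. continuous_on UNIV \<phi>}" for a :: complex
    using h_cont by (auto intro!: continuous_intros)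
  show "LC (\<lambda>x. of_real (h x)) = (\<lambda>x. of_real \<rho> * of_real (h x))"
  proof
    fix x
    have "L (\<lambda>y. 0) x = 0" by (simp add: transfer_op_def)
    then show "LC (\<lambda>x. of_real (h x)) x = of_real \<rho> * of_real (h x)"
      unfolding LC_Complex by (simp add: L_h complex_eq_iff)
  qed
qed (use h_pos[of base] \<rho>_pos convergence_complex in auto)

end

section \<open>From continuous functions to Borel sets\<close>

lemma closed_indicator_limit:
  fixes C :: "circle set"
  assumes "closed C"
  shows "\<exists>s. (\<forall>n. continuous_on UNIV (s n)) \<and> (\<forall>n x. \<bar>s n x\<bar> \<le> 1) \<and>
    (\<forall>x. (\<lambda>n. s n x) \<longlonglongrightarrow> (indicator C x :: real))"
proof (cases "C = {}")
  case True
  then show ?thesis by (intro exI[of _ "\<lambda>_ _. 0"]) auto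
next
  case False
  define s where "s n x = max 0 (1 - real n * infdist x C)" for n :: nat and x
  have "continuous_on UNIV (s n)" for n
    unfolding s_def by (intro continuous_intros)
  moreover have "\<bar>s n x\<bar> \<le> 1" for n x
    using infdist_nonneg[of x C] by (auto simp: s_def max_def)
  moreover have "(\<lambda>n. s n x) \<longlonglongrightarrow> indicator C x" for x
  proof (cases "x \<in> C")
    case True
    then show ?thesis by (simp add: s_def)
  next
    case nC: False
    then have pos: "infdist x C > 0"
      using in_closed_iff_infdist_zero[OF assms False] infdist_nonneg[of x C] by (metis less_eq_real_def)
    obtain n0 :: nat where "1 / infdist x C < real n0" using reals_Archimedean2 by blast
    then have n0: "1 < real n0 * infdist x C" using pos by (simp add: field_simps)
    have "s n x = 0" if "n \<ge> n0" for n
    proof -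
      have "real n0 * infdist x C \<le> real n * infdist x C" using that pos by (intro mult_right_mono) auto
      then show ?thesis using n0 by (simp add: s_def)
    qed
    then have "\<forall>\<^sub>F n in sequentially. s n x = 0" unfolding eventually_sequentially by blast
    then show ?thesis using nC by (simp add: tendsto_eventually)
  qed
  ultimately show ?thesis by (intro exI[of _ s]) simp
qed

text \<open>A functional that is linear and continuous under bounded pointwise limits is, like an
  integral, determined by its values on continuous functions.\<close>

definition integral_like :: "((circle \<Rightarrow> real) \<Rightarrow> real) \<Rightarrow> bool" where
  "integral_like I \<longleftrightarrow>
    (\<forall>\<phi> \<psi> a b. \<phi> \<in> borel_measurable borel \<longrightarrow> \<psi> \<in> borel_measurable borel \<longrightarrow>
      (\<forall>x. \<bar>\<phi> x\<bar> \<le> 1) \<longrightarrow> (\<forall>x. \<bar>\<psi> x\<bar> \<le> 1) \<longrightarrow> I (\<lambda>x. a * \<phi> x + b * \<psi> x) = a * I \<phi> + b * I \<psi>) \<and>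
    (\<forall>s u. (\<forall>n. s n \<in> borel_measurable borel) \<longrightarrow> (\<forall>n x. \<bar>s n x\<bar> \<le> 1) \<longrightarrow>
      (\<forall>x. (\<lambda>n. s n x) \<longlonglongrightarrow> u x) \<longrightarrow> u \<in> borel_measurable borel \<longrightarrow> (\<lambda>n. I (s n)) \<longlonglongrightarrow> I u)"

lemma integral_like_ext:
  assumes I: "integral_like I" and J: "integral_like J"
    and cont: "\<And>\<phi>. continuous_on UNIV \<phi> \<Longrightarrow> I \<phi> = J \<phi>"
    and A: "A \<in> sets borel"
  shows "I (indicator A) = J (indicator A)"
proof -
  have lin: "E (\<lambda>x. a * indicator A x + b * indicator B x) = a * E (indicator A) + b * E (indicator B)"
    if "integral_like E" "A \<in> sets borel" "B \<in> sets borel" for E A B a b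
    using that unfolding integral_like_def
    by (elim conjE allE[of _ "indicator A"] allE[of _ "indicator B"]) (auto simp: indicator_def)
  have lim: "(\<lambda>n. E (s n)) \<longlonglongrightarrow> E u"
    if "integral_like E" "\<And>n. s n \<in> borel_measurable borel" "\<And>n x. \<bar>s n x\<bar> \<le> 1"
      "\<And>x. (\<lambda>n. s n x) \<longlonglongrightarrow> u x" "u \<in> borel_measurable borel" for E s u
    using that(1) unfolding integral_like_def by (elim conjE allE[of _ s] allE[of _ u]) (simp add: that(2-5))
  have st: "Int_stable (Collect closed :: circle set set)" "Collect closed \<subseteq> Pow (UNIV :: circle set)"
    by (auto simp: Int_stable_def)
  have "A \<in> sigma_sets UNIV (Collect closed)"
    using A unfolding borel_eq_closed by simp
  with st show ?thesis
  proof (induction rule: sigma_sets_induct_disjoint)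
    case (basic C)
    then have C: "closed C" by simp
    obtain s where s: "\<And>n. continuous_on UNIV (s n)" "\<And>n x. \<bar>s n x\<bar> \<le> 1"
      "\<And>x. (\<lambda>n. s n x) \<longlonglongrightarrow> (indicator C x :: real)"
      using closed_indicator_limit[OF C] by auto
    have m: "s n \<in> borel_measurable borel" for n using s(1) by (rule borel_measurable_continuous_onI)
    have u: "(indicator C :: circle \<Rightarrow> real) \<in> borel_measurable borel" using C by simp
    have "(\<lambda>n. I (s n)) \<longlonglongrightarrow> J (indicator C)"
      using lim[OF J m s(2,3) u] by (simp add: cont s(1))
    then show ?case using lim[OF I m s(2,3) u] LIMSEQ_unique by blast
  next
    case empty
    show ?case by (rule cont) simp
  next
    case (compl A)
    then have A: "A \<in> sets borel" unfolding borel_eq_closed by simp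
    have U: "UNIV \<in> sets (borel :: circle measure)" by simp
    have eq: "indicator (UNIV - A) = (\<lambda>x. 1 * indicator UNIV x + (- 1) * indicator A x :: real)"
      by (auto simp: indicator_def)
    have "I (indicator UNIV) = J (indicator UNIV)" by (rule cont) simp
    then show ?case
      unfolding eq lin[OF I U A] lin[OF J U A] using compl by simp
  next
    case (union A)
    then have A: "A i \<in> sets borel" for i unfolding borel_eq_closed by auto
    define s :: "nat \<Rightarrow> circle \<Rightarrow> real" where "s n = indicator (\<Union>i<n. A i)" for n
    have UA: "(\<Union>i<n. A i) \<in> sets borel" for n using A by auto
    have eq: "I (s n) = J (s n)" for n
    proof (induction n)
      case 0
      show ?case by (rule cont) (simp add: s_def)
    next
      case (Suc n)
      have "A n \<inter> A i = {}" if "i < n" for i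
        using disjoint_family_onD[OF union(1), of n i] that by simp
      then have "A n \<inter> (\<Union>i<n. A i) = {}" by blast
      then have "s (Suc n) = (\<lambda>x. 1 * indicator (\<Union>i<n. A i) x + 1 * indicator (A n) x)"
        by (auto simp: s_def indicator_def lessThan_Suc fun_eq_iff)
      then show ?case
        using Suc union(3)[of n] by (simp only: lin[OF I UA A] lin[OF J UA A] s_def)
    qed
    have l: "(\<lambda>n. s n x) \<longlonglongrightarrow> (indicator (\<Union>i. A i) x :: real)" for x
      unfolding s_def by (rule LIMSEQ_indicator_UN)
    have m: "s n \<in> borel_measurable borel" for n using UA by (simp add: s_def)
    have b: "\<bar>s n x\<bar> \<le> 1" for n x by (simp add: s_def indicator_def)
    have u: "(indicator (\<Union>i. A i) :: circle \<Rightarrow> real) \<in> borel_measurable borel" using A by auto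
    show ?case
      using lim[OF I m b l u] lim[OF J m b l u] unfolding eq by (rule LIMSEQ_unique)
  qed
qed

lemma (in circle_prob) measurable_eq [simp]: "measurable \<nu> M = measurable borel M"
  by (rule measurable_cong_sets) simp_all

lemma (in circle_prob) integral_like_integral: "integral_like (\<lambda>\<phi>. integral\<^sup>L \<nu> \<phi>)"
  unfolding integral_like_def
proof (intro conjI allI impI)
  fix \<phi> \<psi> :: "circle \<Rightarrow> real" and a b :: real
  assume "\<phi> \<in> borel_measurable borel" "\<psi> \<in> borel_measurable borel" "\<forall>x. \<bar>\<phi> x\<bar> \<le> 1" "\<forall>x. \<bar>\<psi> x\<bar> \<le> 1"
  then have "integrable \<nu> \<phi>" "integrable \<nu> \<psi>" by (auto intro!: integrable_const_bound[of _ 1])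
  then show "integral\<^sup>L \<nu> (\<lambda>x. a * \<phi> x + b * \<psi> x) = a * integral\<^sup>L \<nu> \<phi> + b * integral\<^sup>L \<nu> \<psi>" by simp
next
  fix s :: "nat \<Rightarrow> circle \<Rightarrow> real" and u
  assume "\<forall>n. s n \<in> borel_measurable borel" "\<forall>n x. \<bar>s n x\<bar> \<le> 1" "\<forall>x. (\<lambda>n. s n x) \<longlonglongrightarrow> u x"
    "u \<in> borel_measurable borel"
  then show "(\<lambda>n. integral\<^sup>L \<nu> (s n)) \<longlonglongrightarrow> integral\<^sup>L \<nu> u"
    by (intro integral_dominated_convergence[where w="\<lambda>_. 1"]) auto
qed

lemma circle_prob_eqI:
  assumes "circle_prob m" "circle_prob m'"
    and "\<And>\<phi> :: circle \<Rightarrow> real. continuous_on UNIV \<phi> \<Longrightarrow> integral\<^sup>L m \<phi> = integral\<^sup>L m' \<phi>"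
  shows "m = m'"
proof -
  interpret m: circle_prob m by fact
  interpret m': circle_prob m' by fact
  show ?thesis
  proof (rule measure_eqI)
    fix A assume "A \<in> sets m"
    then have A: "A \<in> sets borel" by simp
    have "measure m A = measure m' A"
      using integral_like_ext[OF m.integral_like_integral m'.integral_like_integral assms(3) A] A by simp
    then show "emeasure m A = emeasure m' A" by (simp add: m.emeasure_eq_measure m'.emeasure_eq_measure)
  qed simp
qed

context transfer_cone
begin

text \<open>Both sides are integral-like in the indicator function, and on continuous functions this is
  the duality relation.\<close>

lemma conf_iter_indicator:
  assumes "A \<in> sets borel"
  shows "integral\<^sup>L conf ((L ^^ n) (indicator A)) = \<rho> ^ n * measure conf A"
proof -
  have I: "integral_like (\<lambda>\<phi>. integral\<^sup>L conf ((L ^^ n) \<phi>))"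
    unfolding integral_like_def
  proof (intro conjI allI impI)
    fix \<phi> \<psi> :: "circle \<Rightarrow> real" and a b :: real
    assume "\<phi> \<in> borel_measurable borel" "\<psi> \<in> borel_measurable borel" "\<forall>x. \<bar>\<phi> x\<bar> \<le> 1" "\<forall>x. \<bar>\<psi> x\<bar> \<le> 1"
    moreover have "\<bar>(L ^^ n) \<alpha> x\<bar> \<le> D ^ n" if "\<forall>x. \<bar>\<alpha> x\<bar> \<le> 1" for \<alpha> x
      using L_iter_dist[of \<alpha> "\<lambda>_. 0" 1 n x] that L_iter_upper[of "\<lambda>_. 1" 1 n x] L_iter_scale[of n 0 \<alpha>] by simp
    ultimately have "integrable conf ((L ^^ n) \<phi>)" "integrable conf ((L ^^ n) \<psi>)"
      using L_iter_measurable by (auto intro!: nu.integrable_const_bound[of _ "D ^ n"])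
    then show "integral\<^sup>L conf ((L ^^ n) (\<lambda>x. a * \<phi> x + b * \<psi> x)) =
        a * integral\<^sup>L conf ((L ^^ n) \<phi>) + b * integral\<^sup>L conf ((L ^^ n) \<psi>)"
      by (simp add: L_iter_lincomb)
  next
    fix s :: "nat \<Rightarrow> circle \<Rightarrow> real" and u
    assume s: "\<forall>k. s k \<in> borel_measurable borel" "\<forall>k x. \<bar>s k x\<bar> \<le> 1" "\<forall>x. (\<lambda>k. s k x) \<longlonglongrightarrow> u x"
      "u \<in> borel_measurable borel"
    have b: "\<bar>(L ^^ n) (s k) x\<bar> \<le> D ^ n" for k x
      using L_iter_dist[of "s k" "\<lambda>_. 0" 1 n x] s(2) L_iter_upper[of "\<lambda>_. 1" 1 n x] L_iter_scale[of n 0 "s k"] by simp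
    have mk: "(L ^^ n) (s k) \<in> borel_measurable borel" "(L ^^ n) u \<in> borel_measurable borel" for k
      using s(1,4) by (intro L_iter_measurable; simp)+
    have l: "(\<lambda>k. (L ^^ n) (s k) x) \<longlonglongrightarrow> (L ^^ n) u x" for x
      unfolding L_iter_eq using s(3) by (intro tendsto_intros) simp
    show "(\<lambda>k. integral\<^sup>L conf ((L ^^ n) (s k))) \<longlonglongrightarrow> integral\<^sup>L conf ((L ^^ n) u)"
      using b l mk by (intro integral_dominated_convergence[where w="\<lambda>_. D ^ n"]) auto
  qed
  have J: "integral_like (\<lambda>\<phi>. \<rho> ^ n * integral\<^sup>L conf \<phi>)"
    using nu.integral_like_integral unfolding integral_like_def
    by (auto simp: ring_distribs mult.left_commute intro!: tendsto_mult_left)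
  have "integral\<^sup>L conf ((L ^^ n) (indicator A)) = \<rho> ^ n * integral\<^sup>L conf (indicator A)"
    by (rule integral_like_ext[OF I J integral_L_iter assms])
  then show ?thesis using assms by simp
qed

section \<open>The invariant measure\<close>

definition mu :: "circle measure" where "mu = density conf (\<lambda>x. ennreal (h x))"

lemma h_measurable [measurable]: "h \<in> borel_measurable borel"
  using h_cont by (rule borel_measurable_continuous_onI)

lemma integral_mu:
  fixes \<phi> :: "circle \<Rightarrow> real"
  assumes "\<phi> \<in> borel_measurable borel"
  shows "integral\<^sup>L mu \<phi> = integral\<^sup>L conf (\<lambda>x. h x * \<phi> x)"
  unfolding mu_def using assms h_pos by (subst integral_density) (auto simp: less_imp_le)

lemma circle_prob_mu: "circle_prob mu"
proof (intro circle_prob.intro prob_spaceI circle_prob_axioms.intro)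
  show "sets mu = sets borel" by (simp add: mu_def)
  have "emeasure mu (space mu) = (\<integral>\<^sup>+ x. ennreal (h x) \<partial>conf)"
    by (simp add: mu_def emeasure_density)
  also have "\<dots> = ennreal (integral\<^sup>L conf h)"
    using h_pos nu.integrable_continuous[OF h_cont] by (intro nn_integral_eq_integral) (auto simp: less_imp_le)
  finally show "emeasure mu (space mu) = 1" by (simp add: integral_h)
qed

end

sublocale transfer_cone \<subseteq> mu: circle_prob mu
  by (rule circle_prob_mu)

context transfer_cone
begin

lemma T_measurable: "T \<in> borel_measurable borel"
  using T_cont by (rule borel_measurable_continuous_onI)

text \<open>Since \<open>L (h * (\<phi> \<circ> T)) = \<phi> * L h\<close>.\<close>

lemma mu_invariant: "mu \<in> invariant_probs T"
proof -
  have Tm: "T \<in> mu \<rightarrow>\<^sub>M mu" using T_measurable by simp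
  have "circle_prob (distr mu mu T)"
    using mu.prob_space_distr[OF Tm] by (simp add: circle_prob_def circle_prob_axioms_def)
  then have "distr mu mu T = mu"
  proof (rule circle_prob_eqI[OF _ circle_prob_mu])
    fix \<phi> :: "circle \<Rightarrow> real" assume \<phi>: "continuous_on UNIV \<phi>"
    have \<phi>m: "\<phi> \<in> borel_measurable borel" using \<phi> by (rule borel_measurable_continuous_onI)
    have \<phi>T: "continuous_on UNIV (\<lambda>x. \<phi> (T x))"
      using \<phi> T_cont by (rule continuous_on_compose2) auto
    have "integral\<^sup>L (distr mu mu T) \<phi> = integral\<^sup>L mu (\<lambda>x. \<phi> (T x))"
      using Tm \<phi>m by (intro integral_distr) auto
    also have "\<dots> = integral\<^sup>L conf (\<lambda>x. h x * \<phi> (T x))"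
      using \<phi>T by (intro integral_mu borel_measurable_continuous_onI)
    also have "\<dots> = (1 / \<rho>) * integral\<^sup>L conf (L (\<lambda>x. h x * \<phi> (T x)))"
      using integral_L[of "\<lambda>x. h x * \<phi> (T x)"] \<phi>T h_cont \<rho>_pos
      by (simp add: continuous_on_mult)
    also have "L (\<lambda>x. h x * \<phi> (T x)) = (\<lambda>x. \<rho> * (h x * \<phi> x))"
    proof
      fix x
      have "L (\<lambda>x. h x * \<phi> (T x)) x = L h x * \<phi> x"
        unfolding transfer_op_def sum_distrib_right by (intro sum.cong) auto
      then show "L (\<lambda>x. h x * \<phi> (T x)) x = \<rho> * (h x * \<phi> x)" by (simp add: L_h)
    qed
    also have "(1 / \<rho>) * integral\<^sup>L conf (\<lambda>x. \<rho> * (h x * \<phi> x)) = integral\<^sup>L mu \<phi>"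
      using \<rho>_pos by (simp add: integral_mu[OF \<phi>m])
    finally show "integral\<^sup>L (distr mu mu T) \<phi> = integral\<^sup>L mu \<phi>" .
  qed
  then show ?thesis using Tm mu.prob_space_axioms by (simp add: invariant_probs_def)
qed

lemma mu_conf_bounds:
  assumes "A \<in> sets borel"
  shows "measure mu A \<le> K * measure conf A" "measure conf A / K \<le> measure mu A"
proof -
  have A: "(indicator A :: circle \<Rightarrow> real) \<in> borel_measurable borel" using assms by simp
  have eq: "measure mu A = integral\<^sup>L conf (\<lambda>x. h x * indicator A x)"
    using integral_mu[OF A] assms by simp
  have i: "integrable conf (indicator A :: circle \<Rightarrow> real)"
    using A by (intro nu.integrable_const_bound[of _ 1]) (auto simp: indicator_def)
  have ih: "integrable conf (\<lambda>x. h x * indicator A x)"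
  proof (rule nu.integrable_const_bound[of _ K])
    show "AE x in conf. norm (h x * indicator A x) \<le> K"
      using h_bounds(1) h_pos K_pos by (auto simp: indicator_def less_imp_le abs_of_pos)
    show "(\<lambda>x. h x * indicator A x) \<in> borel_measurable conf"
      using A h_measurable by simp
  qed
  have "integral\<^sup>L conf (\<lambda>x. h x * indicator A x) \<le> integral\<^sup>L conf (\<lambda>x. K * indicator A x)"
    by (intro integral_mono integrable_mult_right i ih) (auto simp: indicator_def h_bounds)
  then show "measure mu A \<le> K * measure conf A" using i assms by (simp add: eq)
  have "integral\<^sup>L conf (\<lambda>x. 1 / K * indicator A x) \<le> integral\<^sup>L conf (\<lambda>x. h x * indicator A x)"
    by (intro integral_mono integrable_mult_right i ih) (auto simp: indicator_def h_bounds)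
  then show "measure conf A / K \<le> measure mu A" using i assms by (simp add: eq)
qed

end

section \<open>The Gibbs property\<close>

context circle_factor
begin

lemma G_small:
  shows "\<exists>r>0. \<forall>s t. \<bar>s - t\<bar> < r \<longrightarrow> \<bar>G s - G t\<bar> < 1 / 2"
proof -
  have "uniformly_continuous_on {0..1} g"
    by (intro compact_uniformly_continuous continuous_on_subset[OF g_cont]) auto
  then obtain d where d: "d > 0"
    "\<And>x y. x \<in> {0..1} \<Longrightarrow> y \<in> {0..1} \<Longrightarrow> dist y x < d \<Longrightarrow> dist (g y) (g x) < 1 / 4"
    unfolding uniformly_continuous_on_def by (metis zero_less_divide_iff zero_less_numeral zero_less_one)
  define r where "r = min d (1 / 2)"
  have *: "G t - G s < 1 / 2" if st: "s \<le> t" "t - s < r" for s t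
  proof -
    have fl: "\<lfloor>t\<rfloor> = \<lfloor>s\<rfloor> \<or> \<lfloor>t\<rfloor> = \<lfloor>s\<rfloor> + 1" using st by (simp add: r_def) linarith
    have fr: "0 \<le> frac s" "frac s < 1" "0 \<le> frac t" "frac t < 1" by (auto simp: frac_lt_1)
    from fl show ?thesis
    proof
      assume e: "\<lfloor>t\<rfloor> = \<lfloor>s\<rfloor>"
      then have "frac t - frac s = t - s" by (simp add: frac_def)
      then have "dist (g (frac t)) (g (frac s)) < 1 / 4"
        using st fr by (intro d(2)) (auto simp: dist_real_def r_def)
      then have "g (frac t) - g (frac s) < 1 / 4" unfolding dist_real_def by linarith
      then show ?thesis using e by (simp add: G_def)
    next
      assume e: "\<lfloor>t\<rfloor> = \<lfloor>s\<rfloor> + 1"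
      then have f: "frac t + (1 - frac s) = t - s" by (simp add: frac_def)
      have "t - s < d" using st by (simp add: r_def)
      then have fd: "frac t < d" "1 - frac s < d" using f fr by linarith+
      have "dist (g (frac t)) (g 0) < 1 / 4" "dist (g 1) (g (frac s)) < 1 / 4"
        using fd fr by (intro d(2); simp add: dist_real_def)+
      then have "g (frac t) < 1 / 4" "real (N + 1) - g (frac s) < 1 / 4"
        unfolding dist_real_def g_0 g_1 by linarith+
      moreover have "G t - G s = real (N + 1) + g (frac t) - g (frac s)"
        by (simp add: G_def e algebra_simps)
      ultimately show ?thesis by linarith
    qed
  qed
  have "\<bar>G s - G t\<bar> < 1 / 2" if "\<bar>s - t\<bar> < r" for s t
    using *[of s t] *[of t s] that G_mono[of s t] G_mono[of t s] by (cases "s \<le> t") auto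
  moreover have "r > 0" using d by (simp add: r_def)
  ultimately show ?thesis by blast
qed

text \<open>At small scales the map acts on lifts of arcs, so that no wrapping around occurs.\<close>

lemma local_lift:
  shows "\<exists>r>0. \<forall>u v. dist u v < r \<longrightarrow> (\<exists>a b. u = br a \<and> v = br b \<and> T u = to_circle a \<and> T v = to_circle b \<and>
    \<bar>H a - H b\<bar> = dist u v \<and> \<bar>a - b\<bar> = dist (T u) (T v) \<and> \<bar>a - b\<bar> \<le> 1)"
proof -
  obtain r where r: "r > 0" "\<And>s t. \<bar>s - t\<bar> < r \<Longrightarrow> \<bar>G s - G t\<bar> < 1 / 2" using G_small by auto
  have "\<exists>a b. u = br a \<and> v = br b \<and> T u = to_circle a \<and> T v = to_circle b \<and>
    \<bar>H a - H b\<bar> = dist u v \<and> \<bar>a - b\<bar> = dist (T u) (T v) \<and> \<bar>a - b\<bar> \<le> 1" if "dist u v < r" for u v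
  proof -
    obtain t where t: "to_circle t = v" "\<bar>crep u - t\<bar> = dist u v" using dist_circle_lift .
    have "\<bar>G (crep u) - G t\<bar> < 1 / 2" using r(2) t that by simp
    moreover have "T u = to_circle (G (crep u))" "T v = to_circle (G t)"
      using T_to_circle[of "crep u"] T_to_circle[of t] t by simp_all
    ultimately show ?thesis using t
      by (intro exI[of _ "G (crep u)"] exI[of _ "G t"]) (simp add: br_def dist_to_circle_eq)
  qed
  then show ?thesis using r(1) by blast
qed

lemma preimage_near: "\<exists>v. T v = z \<and> dist u v \<le> dist (T u) z"
proof -
  obtain c where c: "to_circle c = z" "\<bar>crep (T u) - c\<bar> = dist (T u) z" using dist_circle_lift .
  have "to_circle (crep (T u)) = to_circle (G (crep u))"
    using T_to_circle[of "crep u"] by simp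
  then obtain m where m: "crep (T u) = G (crep u) + of_int m" unfolding to_circle_eq_iff by blast
  define b where "b = c + of_int (- m)"
  have b: "to_circle b = z" "\<bar>G (crep u) - b\<bar> = dist (T u) z"
  proof -
    show "to_circle b = z" unfolding b_def to_circle_add_int by (rule c)
    have "G (crep u) - b = crep (T u) - c" using m by (simp add: b_def)
    then show "\<bar>G (crep u) - b\<bar> = dist (T u) z" using c(2) by simp
  qed
  have "dist u (br b) \<le> \<bar>H (G (crep u)) - H b\<bar>"
    using dist_to_circle_le[of "crep u" "H b"] by (simp add: br_def)
  also have "\<dots> \<le> \<bar>G (crep u) - b\<bar>"
    using b(2) dist_circle_le_half[of "T u" z] by (intro H_contract(3)) auto
  finally show ?thesis using b by (intro exI[of _ "br b"]) simp
qed

lemma preimage_near_iter: "\<exists>v. (T ^^ n) v = z \<and> (\<forall>j\<le>n. dist ((T ^^ j) u) ((T ^^ j) v) \<le> dist ((T ^^ n) u) z)"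
proof (induction n arbitrary: z)
  case (Suc n)
  obtain w where w: "T w = z" "dist ((T ^^ n) u) w \<le> dist (T ((T ^^ n) u)) z" using preimage_near by blast
  obtain v where v: "(T ^^ n) v = w" "\<forall>j\<le>n. dist ((T ^^ j) u) ((T ^^ j) v) \<le> dist ((T ^^ n) u) w"
    using Suc by blast
  show ?case
  proof (intro exI[of _ v] conjI allI impI)
    show "(T ^^ Suc n) v = z" using v w by simp
    fix j assume "j \<le> Suc n"
    then show "dist ((T ^^ j) u) ((T ^^ j) v) \<le> dist ((T ^^ Suc n) u) z"
      using v w(1) order_trans[OF _ w(2)] by (cases "j = Suc n") auto
  qed
qed auto

end

context transfer_cone
begin

text \<open>By topological exactness some iterate of the indicator function of the ball is bounded below
  everywhere, with constants independent of the centre.\<close>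

lemma conf_ball_lower:
  assumes "r > 0"
  shows "\<exists>c>0. \<forall>z. c \<le> measure conf (ball z r)"
proof -
  obtain p where p: "\<And>x z. \<exists>y. (T ^^ p) y = x \<and> dist z y < r" using covering[OF assms] by blast
  define c where "c = exp (- real p * F) / \<rho> ^ p"
  have "c \<le> measure conf (ball z r)" for z
  proof -
    have low: "exp (- real p * F) \<le> (L ^^ p) (indicator (ball z r)) x" for x
    proof -
      obtain y where y: "(T ^^ p) y = x" "dist z y < r" using p by blast
      have "exp (- real p * F) * indicator (ball z r) y \<le> (L ^^ p) (indicator (ball z r)) ((T ^^ p) y)"
        by (rule L_iter_lower) auto
      then show ?thesis using y by simp
    qed
    have m: "(L ^^ p) (indicator (ball z r)) \<in> borel_measurable borel"
      by (intro L_iter_measurable borel_measurable_indicator) simp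
    have pos: "0 \<le> (L ^^ p) (indicator (ball z r)) x" for x
      using low[of x] exp_ge_zero order_trans by blast
    have "(L ^^ p) (indicator (ball z r)) x \<le> D ^ p" for x
      using L_iter_upper[of "indicator (ball z r)" 1 p x] by (simp add: indicator_def)
    then have "integrable conf ((L ^^ p) (indicator (ball z r)))"
      using pos m by (intro nu.integrable_const_bound[of _ "D ^ p"]) auto
    then have "exp (- real p * F) \<le> integral\<^sup>L conf ((L ^^ p) (indicator (ball z r)))"
      using low by (rule nu.integral_ge_const)
    then show ?thesis using \<rho>_pos by (simp add: conf_iter_indicator c_def field_simps)
  qed
  moreover have "c > 0" using \<rho>_pos by (simp add: c_def)
  ultimately show ?thesis by blast
qed

text \<open>For small \<open>r\<close> the iterate \<open>T\<^sup>n\<close> maps the dynamical ball bijectively onto the \<open>r\<close>-ball around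
  \<open>T\<^sup>n x\<close>, and by telescoping the weight \<open>exp (birkhoff_sum T f n)\<close> is constant on the dynamical ball up
  to the factor \<open>K\<close>. The conformal measure of the dynamical ball is therefore, up to constants, this
  weight times \<open>\<rho>\<^sup>-\<^sup>n\<close> times the measure of an \<open>r\<close>-ball.\<close>

theorem gibbs: "gibbs_bounds T f (ln \<rho>) mu"
proof -
  obtain r0 where r0: "r0 > 0" "\<And>u v. dist u v < r0 \<Longrightarrow> (\<exists>a b. u = br a \<and> v = br b \<and> T u = to_circle a \<and> T v = to_circle b \<and>
    \<bar>H a - H b\<bar> = dist u v \<and> \<bar>a - b\<bar> = dist (T u) (T v) \<and> \<bar>a - b\<bar> \<le> 1)"
    using local_lift by auto
  have local: "dist u v \<le> dist (T u) (T v)" "\<bar>f u - f v\<bar> \<le> \<Psi> (dist (T u) (T v)) - \<Psi> (dist u v)"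
    if "dist u v < r0" for u v
  proof -
    obtain a b where "u = br a" "v = br b" "\<bar>H a - H b\<bar> = dist u v" "\<bar>a - b\<bar> = dist (T u) (T v)" "\<bar>a - b\<bar> \<le> 1"
      using r0(2)[OF \<open>dist u v < r0\<close>] by auto
    then show "dist u v \<le> dist (T u) (T v)" "\<bar>f u - f v\<bar> \<le> \<Psi> (dist (T u) (T v)) - \<Psi> (dist u v)"
      using H_contract(3)[of a b] key[of a b] by simp_all
  qed
  have bounds: "\<exists>C>0. \<forall>x. \<forall>n\<ge>1.
        1 / C \<le> measure mu (dynamical_ball T n r x) / exp (birkhoff_sum T f n x - real n * ln \<rho>) \<and>
        measure mu (dynamical_ball T n r x) / exp (birkhoff_sum T f n x - real n * ln \<rho>) \<le> C"
    if r: "0 < r" "r < r0 / 2" for r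
  proof -
    obtain c where c: "c > 0" "\<And>z. c \<le> measure conf (ball z r)" using conf_ball_lower[OF r(1)] by auto
    have c1: "c \<le> 1" using c(2)[of base] nu.prob_le_1[of "ball base r"] by linarith
    have main: "c / (K * K) \<le> measure mu (dynamical_ball T n r x) / exp (birkhoff_sum T f n x - real n * ln \<rho>) \<and>
        measure mu (dynamical_ball T n r x) / exp (birkhoff_sum T f n x - real n * ln \<rho>) \<le> K * K" for x n
    proof -
      define B where "B = dynamical_ball T n r x"
      define E where "E = exp (birkhoff_sum T f n x)"
      have E: "E > 0" by (simp add: E_def)
      have Tc: "continuous_on UNIV (T ^^ j)" for j
      proof (induction j)
        case (Suc j)
        show ?case unfolding funpow.simps
          by (rule continuous_on_compose[OF Suc continuous_on_subset[OF T_cont]]) simp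
      qed (simp add: id_def)
      have "B = (\<Inter>j\<in>{..n}. (T ^^ j) -` ball ((T ^^ j) x) r)"
        by (auto simp: B_def dynamical_ball_def)
      moreover have "open ((T ^^ j) -` ball ((T ^^ j) x) r)" for j
        using Tc by (intro open_vimage) auto
      ultimately have "open B" by auto
      then have B: "B \<in> sets borel" by simp
      \<comment> \<open>Along an orbit that stays close, the increments of \<open>\<Psi>\<close> telescope.\<close>
      have dist_f: "\<bar>birkhoff_sum T f n x - birkhoff_sum T f n y\<bar> \<le> \<Psi> 1" if "y \<in> B" for y
      proof -
        have d: "dist ((T ^^ j) x) ((T ^^ j) y) < r0" if "j \<le> n" for j
          using \<open>y \<in> B\<close> that r by (force simp: B_def dynamical_ball_def)
        have "\<bar>birkhoff_sum T f k x - birkhoff_sum T f k y\<bar> \<le> \<Psi> (dist ((T ^^ k) x) ((T ^^ k) y))" if "k \<le> n" for k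
          using that
        proof (induction k)
          case 0
          then show ?case by (simp add: birkhoff_sum_def \<Psi>_nonneg dist_circle_le_half[THEN order_trans])
        next
          case (Suc k)
          then show ?case using local(2)[OF d[of k]] by (simp add: birkhoff_sum_def)
        qed
        from this[of n] show ?thesis
          using \<Psi>_mono[of "dist ((T ^^ n) x) ((T ^^ n) y)" 1] dist_circle_le_half[of "(T ^^ n) x" "(T ^^ n) y"] by simp
      qed
      have inj: "y = y'" if "y \<in> B" "y' \<in> B" "(T ^^ n) y = (T ^^ n) y'" for y y'
      proof -
        have d: "dist ((T ^^ j) y) ((T ^^ j) y') < r0" if "j \<le> n" for j
        proof -
          have "dist ((T ^^ j) x) ((T ^^ j) y) < r" "dist ((T ^^ j) x) ((T ^^ j) y') < r"
            using \<open>y \<in> B\<close> \<open>y' \<in> B\<close> that by (auto simp: B_def dynamical_ball_def)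
          then show ?thesis using dist_triangle3[of "(T ^^ j) y" "(T ^^ j) y'" "(T ^^ j) x"] r by linarith
        qed
        have "dist y y' \<le> dist ((T ^^ k) y) ((T ^^ k) y')" if "k \<le> n" for k
          using that
        proof (induction k)
          case (Suc k)
          then show ?case using local(1)[OF d[of k]] by simp
        qed simp
        from this[of n] show ?thesis using that by simp
      qed
      have EK: "E / K \<le> exp (birkhoff_sum T f n y)" "exp (birkhoff_sum T f n y) \<le> K * E" if "y \<in> B" for y
        using dist_f[OF that] by (auto simp: E_def K_def exp_diff[symmetric] exp_add[symmetric] abs_le_iff)
      have Lsum: "(L ^^ n) (indicator B) z = (\<Sum>y\<in>(T ^^ n) -` {z} \<inter> B. exp (birkhoff_sum T f n y))" for z
        unfolding L_iter_eq using finite_fibre_iter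
        by (simp add: indicator_def if_distrib[of "\<lambda>a. _ * a"] sum.inter_restrict cong: if_cong)
      have upper: "(L ^^ n) (indicator B) z \<le> K * E" for z
      proof (cases "(T ^^ n) -` {z} \<inter> B = {}")
        case True
        then show ?thesis using E K_pos by (simp add: Lsum)
      next
        case False
        then obtain y where "y \<in> B" "(T ^^ n) y = z" by auto
        then have "(T ^^ n) -` {z} \<inter> B = {y}" using inj by blast
        then show ?thesis using EK(2)[OF \<open>y \<in> B\<close>] by (simp add: Lsum)
      qed
      have lower: "E / K * indicator (ball ((T ^^ n) x) r) z \<le> (L ^^ n) (indicator B) z" for z
      proof (cases "dist ((T ^^ n) x) z < r")
        case True
        obtain y where y: "(T ^^ n) y = z" "\<forall>j\<le>n. dist ((T ^^ j) x) ((T ^^ j) y) \<le> dist ((T ^^ n) x) z"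
          using preimage_near_iter by blast
        then have "y \<in> B" using True by (force simp: B_def dynamical_ball_def)
        then have "(T ^^ n) -` {z} \<inter> B = {y}" using inj y(1) by blast
        then show ?thesis using EK(1)[OF \<open>y \<in> B\<close>] True by (simp add: Lsum)
      next
        case False
        have "0 \<le> (L ^^ n) (indicator B) z" unfolding Lsum by (intro sum_nonneg) auto
        then show ?thesis using False by simp
      qed
      have pos: "0 \<le> (L ^^ n) (indicator B) z" for z unfolding Lsum by (intro sum_nonneg) auto
      have i: "integrable conf ((L ^^ n) (indicator B))"
        using upper pos B L_iter_measurable[of "indicator B" n]
        by (intro nu.integrable_const_bound[of _ "K * E"]) auto
      have up: "\<rho> ^ n * measure conf B \<le> K * E"
        unfolding conf_iter_indicator[OF B, symmetric] using i upper by (rule nu.integral_le_const)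
      have ib: "integrable conf (\<lambda>z. E / K * indicator (ball ((T ^^ n) x) r) z)"
      proof (rule integrable_mult_right, rule nu.integrable_const_bound[of _ 1])
        have "(indicator (ball ((T ^^ n) x) r) :: circle \<Rightarrow> real) \<in> borel_measurable borel"
          by (intro borel_measurable_indicator) simp
        then show "(indicator (ball ((T ^^ n) x) r) :: circle \<Rightarrow> real) \<in> borel_measurable conf"
          by simp
      qed (rule AE_I2, simp add: indicator_def)
      have "integral\<^sup>L conf (\<lambda>z. E / K * indicator (ball ((T ^^ n) x) r) z) \<le> \<rho> ^ n * measure conf B"
        unfolding conf_iter_indicator[OF B, symmetric] using lower by (intro integral_mono i ib)
      then have "E / K * measure conf (ball ((T ^^ n) x) r) \<le> \<rho> ^ n * measure conf B" by simp
      moreover have "E / K * c \<le> E / K * measure conf (ball ((T ^^ n) x) r)"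
        using c(2) E K_pos by (intro mult_left_mono) auto
      ultimately have lo: "E / K * c \<le> \<rho> ^ n * measure conf B" by linarith
      have eE: "exp (birkhoff_sum T f n x - real n * ln \<rho>) = E / \<rho> ^ n"
        using \<rho>_pos by (simp add: E_def exp_diff exp_of_nat_mult)
      have "measure mu B / (E / \<rho> ^ n) \<le> (K * measure conf B) / (E / \<rho> ^ n)"
        using mu_conf_bounds(1)[OF B] E \<rho>_pos by (intro divide_right_mono) auto
      also have "\<dots> = K * (\<rho> ^ n * measure conf B / E)" using E \<rho>_pos by (simp add: field_simps)
      also have "\<dots> \<le> K * K" using up E K_pos by (intro mult_left_mono) (auto simp: field_simps)
      finally have u: "measure mu B / (E / \<rho> ^ n) \<le> K * K" .
      have "c / (K * K) \<le> (\<rho> ^ n * measure conf B / E) / K" using lo E K_pos by (simp add: field_simps)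
      also have "\<dots> = (measure conf B / K) / (E / \<rho> ^ n)" using E \<rho>_pos by (simp add: field_simps)
      also have "\<dots> \<le> measure mu B / (E / \<rho> ^ n)"
        using mu_conf_bounds(2)[OF B] E \<rho>_pos by (intro divide_right_mono) auto
      finally show ?thesis using u unfolding eE B_def[symmetric] by simp
    qed
    have C: "1 / (K * K / c) = c / (K * K)" "K * K \<le> K * K / c"
      using c c1 K_pos by (auto simp: field_simps)
    show ?thesis
    proof (intro exI[of _ "K * K / c"] conjI allI impI)
      show "0 < K * K / c" using c K_pos by simp
      fix x and n :: nat
      show "1 / (K * K / c) \<le> measure mu (dynamical_ball T n r x) / exp (birkhoff_sum T f n x - real n * ln \<rho>)"
        unfolding C(1) by (rule conjunct1[OF main])
      show "measure mu (dynamical_ball T n r x) / exp (birkhoff_sum T f n x - real n * ln \<rho>) \<le> K * K / c"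
        by (rule order_trans[OF conjunct2[OF main] C(2)])
    qed
  qed
  have "\<forall>\<^sub>F r in at_right 0. 0 < r \<and> r < r0 / 2"
    using r0(1) by (intro eventually_conj eventually_at_right_less eventually_at_rightI[of 0 "r0 / 2"]) auto
  then show ?thesis
    unfolding gibbs_bounds_def by eventually_elim (use bounds in simp)
qed

end

section \<open>Entropy of functions with finitely many values\<close>

context circle_prob
begin

definition pr :: "(circle \<Rightarrow> 'b) \<Rightarrow> 'b \<Rightarrow> real" where "pr X v = prob (X -` {v})"

definition ent :: "(circle \<Rightarrow> 'b) \<Rightarrow> real" where
  "ent X = - (\<Sum>v\<in>range X. pr X v * ln (pr X v))"

definition fibres :: "(circle \<Rightarrow> 'b) \<Rightarrow> circle set set" where
  "fibres X = (\<lambda>v. X -` {v}) ` range X"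

lemma simple_finite: "simple_function \<nu> X \<Longrightarrow> finite (range X)"
  by (simp add: simple_function_def)

lemma simple_sets: "simple_function \<nu> X \<Longrightarrow> X -` S \<in> sets borel"
  using measurable_sets[OF measurable_simple_function, of \<nu> X S] by simp

lemma simple_comp: "simple_function \<nu> X \<Longrightarrow> simple_function \<nu> (\<lambda>x. \<phi> (X x))"
  using simple_function_compose[of \<nu> X \<phi>] by (simp add: comp_def)

lemma simple_Pair: "simple_function \<nu> X \<Longrightarrow> simple_function \<nu> Y \<Longrightarrow> simple_function \<nu> (\<lambda>x. (X x, Y x))"
  by (rule simple_function_Pair)

lemma ent_fibres: "ent X = - (\<Sum>A\<in>fibres X. prob A * ln (prob A))"
proof -
  have "inj_on (\<lambda>v. X -` {v}) (range X)" by (rule inj_onI) blast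
  then show ?thesis unfolding ent_def fibres_def pr_def by (subst sum.reindex) auto
qed

text \<open>Entropy depends only on the partition into fibres.\<close>

lemma ent_eqI:
  assumes "\<And>x y. X x = X y \<longleftrightarrow> Y x = Y y"
  shows "ent X = ent Y"
proof -
  have "X -` {X x} = Y -` {Y x}" for x using assms by auto
  then have "fibres X = fibres Y" unfolding fibres_def image_image by simp
  then show ?thesis by (simp add: ent_fibres)
qed

lemma expectation_simple:
  fixes F :: "'b \<Rightarrow> real"
  assumes X: "simple_function \<nu> X"
  shows "expectation (\<lambda>x. F (X x)) = (\<Sum>v\<in>range X. F v * pr X v)"
proof -
  have eq: "F (X x) = (\<Sum>v\<in>range X. F v * indicator (X -` {v}) x)" for x
  proof -
    have "(\<Sum>v\<in>range X. F v * indicator (X -` {v}) x) = (\<Sum>v\<in>range X. if v = X x then F v else 0)"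
      by (intro sum.cong) (auto simp: indicator_def)
    then show ?thesis using simple_finite[OF X] by (simp add: sum.delta')
  qed
  have i: "integrable \<nu> (indicator (X -` {v}) :: circle \<Rightarrow> real)" for v
    using simple_sets[OF X] by (intro integrable_real_indicator) (auto simp: less_top[symmetric])
  have "expectation (\<lambda>x. F (X x)) = (\<Sum>v\<in>range X. expectation (\<lambda>x. F v * indicator (X -` {v}) x))"
    unfolding eq by (rule Bochner_Integration.integral_sum) (intro integrable_mult_right i)
  also have "\<dots> = (\<Sum>v\<in>range X. F v * pr X v)"
    using simple_sets[OF X] by (intro sum.cong) (simp_all add: pr_def)
  finally show ?thesis .
qed

lemma sum_pr: "simple_function \<nu> X \<Longrightarrow> (\<Sum>v\<in>range X. pr X v) = 1"
  using expectation_simple[of X "\<lambda>_. 1"] by simp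

lemma pr_nonneg: "0 \<le> pr X v"
  by (simp add: pr_def)

lemma ent_expectation:
  assumes "simple_function \<nu> X"
  shows "ent X = - expectation (\<lambda>x. ln (pr X (X x)))"
  unfolding ent_def expectation_simple[OF assms, of "\<lambda>v. ln (pr X v)"] by (simp add: mult.commute)

lemma pr_marginal:
  assumes "simple_function \<nu> X" "simple_function \<nu> Z"
  shows "(\<Sum>x\<in>range X. pr (\<lambda>w. (X w, Z w)) (x, z)) = pr Z z"
proof -
  have "pr Z z = prob (\<Union>x\<in>range X. (\<lambda>w. (X w, Z w)) -` {(x, z)})"
    unfolding pr_def by (rule arg_cong[where f=prob]) auto
  also have "\<dots> = (\<Sum>x\<in>range X. prob ((\<lambda>w. (X w, Z w)) -` {(x, z)}))"
    using simple_finite[OF assms(1)] simple_sets[OF simple_Pair[OF assms]]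
    by (intro finite_measure_finite_Union) (auto simp: disjoint_family_on_def)
  finally show ?thesis by (simp add: pr_def)
qed

lemma pr_pair_le:
  assumes "simple_function \<nu> Z"
  shows "pr (\<lambda>w. (X w, Z w)) (x, z) \<le> pr Z z"
  unfolding pr_def using simple_sets[OF assms] by (intro finite_measure_mono) auto

text \<open>Apply \<open>ln t \<le> t - 1\<close> to \<open>t = p(x,z) p(y,z) / (p(x,y,z) p(z))\<close>. The numerators divided by \<open>p(z)\<close> sum
  to at most 1, like the probabilities \<open>p(x,y,z)\<close>.\<close>

theorem ent_strong_subadditive:
  assumes X: "simple_function \<nu> X" and Y: "simple_function \<nu> Y" and Z: "simple_function \<nu> Z"
  shows "ent (\<lambda>w. (X w, Y w, Z w)) + ent Z \<le> ent (\<lambda>w. (X w, Z w)) + ent (\<lambda>w. (Y w, Z w))"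
proof -
  let ?W = "\<lambda>w. (X w, Y w, Z w)" and ?XZ = "\<lambda>w. (X w, Z w)" and ?YZ = "\<lambda>w. (Y w, Z w)"
  have YZ: "simple_function \<nu> ?YZ" and XZ: "simple_function \<nu> ?XZ" by (intro simple_Pair X Y Z)+
  have W: "simple_function \<nu> ?W" by (intro simple_Pair X YZ)
  define q where "q v = pr ?XZ (fst v, snd (snd v)) * pr ?YZ (snd v) / pr Z (snd (snd v))" for v
  have q0: "0 \<le> q v" for v by (simp add: q_def pr_nonneg)
  have eW: "ent ?W = - (\<Sum>v\<in>range ?W. ln (pr ?W v) * pr ?W v)"
    by (simp add: ent_def mult.commute)
  have eZ: "ent Z = - (\<Sum>v\<in>range ?W. ln (pr Z (snd (snd v))) * pr ?W v)"
    unfolding ent_expectation[OF Z] using expectation_simple[OF W, of "\<lambda>v. ln (pr Z (snd (snd v)))"] by simp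
  have eXZ: "ent ?XZ = - (\<Sum>v\<in>range ?W. ln (pr ?XZ (fst v, snd (snd v))) * pr ?W v)"
    unfolding ent_expectation[OF XZ] using expectation_simple[OF W, of "\<lambda>v. ln (pr ?XZ (fst v, snd (snd v)))"] by simp
  have eYZ: "ent ?YZ = - (\<Sum>v\<in>range ?W. ln (pr ?YZ (snd v)) * pr ?W v)"
    unfolding ent_expectation[OF YZ] using expectation_simple[OF W, of "\<lambda>v. ln (pr ?YZ (snd v))"] by simp
  have summand: "pr ?W v - q v \<le> (ln (pr ?W v) + ln (pr Z (snd (snd v)))
      - ln (pr ?XZ (fst v, snd (snd v))) - ln (pr ?YZ (snd v))) * pr ?W v" for v
  proof (cases "pr ?W v = 0")
    case True
    then show ?thesis using q0[of v] by simp
  next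
    case False
    obtain x y z where v: "v = (x, y, z)" by (metis prod_cases3)
    have p: "0 < pr ?W v" using False pr_nonneg[of ?W v] by simp
    have "pr ?W v \<le> pr ?YZ (y, z)" unfolding v by (rule pr_pair_le[OF YZ])
    moreover have "pr ?W v \<le> pr ?XZ (x, z)"
      unfolding v pr_def using simple_sets[OF XZ] by (intro finite_measure_mono) auto
    moreover have "pr ?YZ (y, z) \<le> pr Z z" by (rule pr_pair_le[OF Z])
    ultimately have pos: "0 < pr ?XZ (x, z)" "0 < pr ?YZ (y, z)" "0 < pr Z z" using p by linarith+
    have qv: "q v = pr ?XZ (x, z) * pr ?YZ (y, z) / pr Z z" by (simp add: q_def v)
    have qpos: "0 < q v" using pos by (simp add: qv)
    have "ln (q v / pr ?W v) \<le> q v / pr ?W v - 1" using qpos p by (intro ln_le_minus_one) simp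
    moreover have "ln (q v / pr ?W v) = ln (pr ?XZ (x, z)) + ln (pr ?YZ (y, z)) - ln (pr Z z) - ln (pr ?W v)"
      using pos p qpos by (simp add: qv ln_div ln_mult)
    ultimately have "1 - q v / pr ?W v \<le> ln (pr ?W v) + ln (pr Z z) - ln (pr ?XZ (x, z)) - ln (pr ?YZ (y, z))"
      by linarith
    from mult_right_mono[OF this less_imp_le[OF p]] show ?thesis
      using p by (simp add: v left_diff_distrib)
  qed
  have "(\<Sum>v\<in>range ?W. q v) \<le> (\<Sum>v\<in>range X \<times> range Y \<times> range Z. q v)"
    using q0 by (intro sum_mono2 finite_cartesian_product simple_finite X Y Z) auto
  also have "\<dots> = (\<Sum>x\<in>range X. \<Sum>y\<in>range Y. \<Sum>z\<in>range Z. q (x, y, z))"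
    by (simp add: sum.cartesian_product)
  also have "\<dots> = (\<Sum>x\<in>range X. \<Sum>z\<in>range Z. \<Sum>y\<in>range Y. q (x, y, z))"
    by (intro sum.cong refl sum.swap)
  also have "\<dots> = (\<Sum>z\<in>range Z. \<Sum>x\<in>range X. \<Sum>y\<in>range Y. q (x, y, z))"
    by (rule sum.swap)
  also have "\<dots> = (\<Sum>z\<in>range Z. (\<Sum>x\<in>range X. pr ?XZ (x, z)) * (\<Sum>y\<in>range Y. pr ?YZ (y, z)) / pr Z z)"
    unfolding sum_product sum_divide_distrib q_def by simp
  also have "\<dots> = (\<Sum>z\<in>range Z. pr Z z)"
    unfolding pr_marginal[OF X Z] pr_marginal[OF Y Z] by (intro sum.cong) auto
  finally have "(\<Sum>v\<in>range ?W. q v) \<le> 1" using sum_pr[OF Z] by simp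
  then have "0 \<le> (\<Sum>v\<in>range ?W. pr ?W v - q v)" using sum_pr[OF W] by (simp add: sum_subtractf)
  also have "\<dots> \<le> (\<Sum>v\<in>range ?W. (ln (pr ?W v) + ln (pr Z (snd (snd v)))
      - ln (pr ?XZ (fst v, snd (snd v))) - ln (pr ?YZ (snd v))) * pr ?W v)"
    by (intro sum_mono summand)
  also have "\<dots> = - ent ?W - ent Z + ent ?XZ + ent ?YZ"
    unfolding eW eZ eXZ eYZ by (simp add: sum.distrib sum_subtractf ring_distribs)
  finally show ?thesis by linarith
qed

text \<open>Conditional entropy, through the chain rule.\<close>

definition cond_ent :: "(circle \<Rightarrow> 'b) \<Rightarrow> (circle \<Rightarrow> 'c) \<Rightarrow> real" where
  "cond_ent X Y = ent (\<lambda>w. (X w, Y w)) - ent Y"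

lemma cond_ent_coarser:
  assumes "simple_function \<nu> X" "simple_function \<nu> Y"
  shows "cond_ent X Y \<le> cond_ent X (\<lambda>w. \<phi> (Y w))"
proof -
  have "ent (\<lambda>w. (X w, Y w, \<phi> (Y w))) = ent (\<lambda>w. (X w, Y w))" "ent (\<lambda>w. (Y w, \<phi> (Y w))) = ent Y"
    by (rule ent_eqI; auto)+
  then show ?thesis
    using ent_strong_subadditive[OF assms(1,2) simple_comp[OF assms(2), of \<phi>]] by (simp add: cond_ent_def)
qed

lemma cond_ent_nonneg:
  assumes "simple_function \<nu> X" "simple_function \<nu> Y"
  shows "0 \<le> cond_ent X Y"
proof -
  have "ent (\<lambda>w. (X w, X w, Y w)) = ent (\<lambda>w. (X w, Y w))" by (rule ent_eqI) auto
  then show ?thesis using ent_strong_subadditive[OF assms(1,1,2)] by (simp add: cond_ent_def)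
qed

lemma ent_coarser:
  assumes "simple_function \<nu> Y"
  shows "ent (\<lambda>w. \<phi> (Y w)) \<le> ent Y"
proof -
  have "ent (\<lambda>w. (Y w, \<phi> (Y w))) = ent Y" by (rule ent_eqI) auto
  then show ?thesis using cond_ent_nonneg[OF assms simple_comp[OF assms, of \<phi>]] by (simp add: cond_ent_def)
qed

lemma ent_const: "ent (\<lambda>_. c) = 0"
  by (simp add: ent_def pr_def vimage_def)

lemma cond_ent_le_ent:
  assumes "simple_function \<nu> X" "simple_function \<nu> Y"
  shows "cond_ent X Y \<le> ent X"
proof -
  have "ent (\<lambda>w. (X w, ())) = ent X" by (rule ent_eqI) auto
  then show ?thesis using cond_ent_coarser[OF assms, of "\<lambda>_. ()"] ent_const[of "()"] by (simp add: cond_ent_def)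
qed

lemma cond_ent_Pair_le:
  assumes "simple_function \<nu> X" "simple_function \<nu> Y" "simple_function \<nu> Z"
  shows "cond_ent (\<lambda>w. (X w, Y w)) Z \<le> cond_ent X Z + cond_ent Y Z"
proof -
  have "ent (\<lambda>w. (X w, Y w, Z w)) = ent (\<lambda>w. ((X w, Y w), Z w))" by (rule ent_eqI) auto
  then show ?thesis using ent_strong_subadditive[OF assms] by (simp add: cond_ent_def)
qed

lemma cond_ent_first_coarser:
  assumes "simple_function \<nu> X" "simple_function \<nu> Y"
  shows "cond_ent (\<lambda>w. \<phi> (X w)) Y \<le> cond_ent X Y"
  using ent_coarser[OF simple_Pair[OF assms], of "\<lambda>(x, y). (\<phi> x, y)"] by (simp add: cond_ent_def)

lemma ent_set_small:
  assumes "e > 0"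
  shows "\<exists>d>0. \<forall>A\<in>sets borel. prob A < d \<longrightarrow> ent (\<lambda>w. w \<in> A) < e"
proof -
  have "((\<lambda>p::real. - (p * ln p) - (1 - p) * ln (1 - p)) \<longlongrightarrow> 0) (at_right 0)" by real_asymp
  from tendstoD[OF this assms]
  have "\<forall>\<^sub>F p in at_right 0. dist (- (p * ln p) - (1 - p) * ln (1 - p)) (0::real) < e" .
  then obtain d :: real where d: "d > 0" "\<And>p. 0 < p \<Longrightarrow> p < d \<Longrightarrow> - (p * ln p) - (1 - p) * ln (1 - p) < e"
    unfolding eventually_at_right_field by (auto simp: dist_real_def abs_less_iff)
  have "ent (\<lambda>w. w \<in> A) < e" if A: "A \<in> sets borel" "prob A < d" for A
  proof -
    have c: "prob (- A) = 1 - prob A" using prob_compl[of A] A by (simp add: Compl_eq_Diff_UNIV)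
    have pr: "pr (\<lambda>w. w \<in> A) True = prob A" "pr (\<lambda>w. w \<in> A) False = 1 - prob A"
      unfolding c[symmetric] by (auto simp: pr_def vimage_def intro!: arg_cong[where f=prob])
    have z: "pr (\<lambda>w. w \<in> A) v * ln (pr (\<lambda>w. w \<in> A) v) = 0" if "v \<notin> range (\<lambda>w. w \<in> A)" for v
    proof -
      have "(\<lambda>w. w \<in> A) -` {v} = {}" using that by auto
      then show ?thesis unfolding pr_def by simp
    qed
    have "ent (\<lambda>w. w \<in> A) = - (\<Sum>v\<in>{True, False}. pr (\<lambda>w. w \<in> A) v * ln (pr (\<lambda>w. w \<in> A) v))"
      unfolding ent_def using z by (intro arg_cong[where f=uminus] sum.mono_neutral_left) auto
    then have eq: "ent (\<lambda>w. w \<in> A) = - (prob A * ln (prob A)) - (1 - prob A) * ln (1 - prob A)"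
      by (simp add: pr)
    show ?thesis
    proof (cases "prob A = 0")
      case False
      then have "0 < prob A" by (simp add: zero_less_measure_iff)
      then show ?thesis using d(2) A unfolding eq by blast
    qed (use assms eq in simp)
  qed
  then show ?thesis using d(1) by blast
qed

lemma simple_set: "A \<in> sets borel \<Longrightarrow> simple_function \<nu> (\<lambda>w. w \<in> A)"
  unfolding simple_function_def
proof (intro conjI ballI)
  show "finite ((\<lambda>w. w \<in> A) ` space \<nu>)" by (rule finite_subset[of _ UNIV]) auto
  fix v assume "A \<in> sets borel"
  then have "- A \<in> sets borel" by (simp add: Compl_eq_Diff_UNIV)
  moreover have "(\<lambda>w. w \<in> A) -` {v} = (if v then A else - A)" by auto
  ultimately show "(\<lambda>w. w \<in> A) -` {v} \<inter> space \<nu> \<in> sets \<nu>" using \<open>A \<in> sets borel\<close> by simp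
qed

end

section \<open>Entropy of an invariant measure\<close>

lemma Cesaro_limit:
  fixes a :: "nat \<Rightarrow> real"
  assumes "a \<longlonglongrightarrow> l"
  shows "(\<lambda>n. (\<Sum>k<n. a k) / real n) \<longlonglongrightarrow> l"
proof (rule LIMSEQ_I)
  fix e :: real assume e: "e > 0"
  obtain n0 where n0: "\<And>n. n \<ge> n0 \<Longrightarrow> \<bar>a n - l\<bar> < e / 2"
    using LIMSEQ_D[OF assms, of "e / 2"] e by auto
  define C where "C = (\<Sum>k<n0. \<bar>a k - l\<bar>)"
  obtain n1 :: nat where n1: "2 * C / e < real n1" using reals_Archimedean2 by blast
  have "norm ((\<Sum>k<n. a k) / real n - l) < e" if n: "n \<ge> max (Suc n1) n0" for n
  proof -
    have np: "0 < real n" using n by simp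
    have "(\<Sum>k<n. a k) / real n - l = (\<Sum>k<n. a k - l) / real n"
      using np by (simp add: sum_subtractf field_simps)
    also have "\<bar>\<dots>\<bar> \<le> (\<Sum>k<n. \<bar>a k - l\<bar>) / real n"
      using np by (simp add: abs_divide divide_right_mono sum_abs)
    also have "(\<Sum>k<n. \<bar>a k - l\<bar>) = C + (\<Sum>k=n0..<n. \<bar>a k - l\<bar>)"
    proof -
      have "(\<Sum>k<n. \<bar>a k - l\<bar>) = (\<Sum>k=0..<n0. \<bar>a k - l\<bar>) + (\<Sum>k=n0..<n. \<bar>a k - l\<bar>)"
        using n by (subst sum.atLeastLessThan_concat) (auto simp: lessThan_atLeast0)
      then show ?thesis by (simp add: C_def lessThan_atLeast0)
    qed
    also have "(\<Sum>k=n0..<n. \<bar>a k - l\<bar>) \<le> (\<Sum>k=n0..<n. e / 2)"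
      using n0 by (intro sum_mono) (auto intro: less_imp_le)
    also have "\<dots> \<le> real n * (e / 2)" using e by (simp add: mult_right_mono)
    finally have "\<bar>(\<Sum>k<n. a k) / real n - l\<bar> \<le> (C + real n * (e / 2)) / real n"
      using np by (simp add: divide_right_mono)
    also have "\<dots> = C / real n + e / 2" using np by (simp add: field_simps)
    also have "C / real n < e / 2"
    proof -
      have "2 * C / e < real n" using n1 n by linarith
      then show ?thesis using e np by (simp add: field_simps)
    qed
    finally show ?thesis by simp
  qed
  then show "\<exists>n0. \<forall>n\<ge>n0. norm ((\<Sum>k<n. a k) / real n - l) < e" by blast
qed

locale circle_system = circle_prob \<nu> for \<nu> :: "circle measure" +
  fixes T :: "circle \<Rightarrow> circle"
  assumes T_meas: "T \<in> borel_measurable borel" and T_inv: "distr \<nu> \<nu> T = \<nu>"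
begin

lemma prob_vimage_T: "A \<in> sets borel \<Longrightarrow> prob (T -` A) = prob A"
  using measure_distr[of T \<nu> \<nu> A] T_meas by (simp add: T_inv)

lemma simple_T: "simple_function \<nu> X \<Longrightarrow> simple_function \<nu> (\<lambda>w. X (T w))"
  unfolding simple_function_def
proof (elim conjE, intro conjI ballI)
  assume fin: "finite (X ` space \<nu>)" and X: "\<forall>v\<in>X ` space \<nu>. X -` {v} \<inter> space \<nu> \<in> sets \<nu>"
  show "finite ((\<lambda>w. X (T w)) ` space \<nu>)" by (rule finite_subset[OF _ fin]) auto
  fix v assume "v \<in> (\<lambda>w. X (T w)) ` space \<nu>"
  then have "X -` {v} \<in> sets borel" using X by auto
  from measurable_sets[OF T_meas this] show "(\<lambda>w. X (T w)) -` {v} \<inter> space \<nu> \<in> sets \<nu>"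
    by (simp add: vimage_def)
qed

lemma simple_T_iter: "simple_function \<nu> X \<Longrightarrow> simple_function \<nu> (\<lambda>w. X ((T ^^ j) w))"
proof (induction j)
  case (Suc j)
  then show ?case using simple_T[OF Suc.IH] by (simp add: funpow_swap1)
qed simp

lemma ent_T:
  assumes X: "simple_function \<nu> X"
  shows "ent (\<lambda>w. X (T w)) = ent X"
proof -
  have p: "pr (\<lambda>w. X (T w)) v = pr X v" for v
    using prob_vimage_T[OF simple_sets[OF X, of "{v}"]] by (simp add: pr_def vimage_def)
  have "pr X v = 0" if "v \<notin> range (\<lambda>w. X (T w))" for v
  proof -
    have "(\<lambda>w. X (T w)) -` {v} = {}" using that by auto
    then show ?thesis unfolding p[symmetric] by (simp add: pr_def)
  qed
  then show ?thesis
    unfolding ent_def p using simple_finite[OF X]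
    by (intro arg_cong[where f=uminus] sum.mono_neutral_left) auto
qed

lemma ent_T_iter: "simple_function \<nu> X \<Longrightarrow> ent (\<lambda>w. X ((T ^^ j) w)) = ent X"
proof (induction j)
  case (Suc j)
  then show ?case using ent_T[OF simple_T_iter[OF Suc.prems, of j]] by (simp add: funpow_swap1)
qed simp

text \<open>The itinerary of a point; its fibres are the cylinders.\<close>

definition code :: "nat \<Rightarrow> (circle \<Rightarrow> 'b) \<Rightarrow> circle \<Rightarrow> 'b list" where
  "code n X w = map (\<lambda>j. X ((T ^^ j) w)) [0..<n]"

lemma code_0 [simp]: "code 0 X w = []"
  by (simp add: code_def)

lemma code_0': "code 0 X = (\<lambda>_. [])"
  by (simp add: fun_eq_iff)

lemma code_Suc: "code (Suc n) X w = X w # code n X (T w)"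
  unfolding code_def upt_conv_Cons[OF zero_less_Suc] map_Suc_upt[symmetric]
  by (simp add: funpow_swap1 comp_def)

lemma code_Suc': "code (Suc n) X w = code n X w @ [X ((T ^^ n) w)]"
  by (simp add: code_def)

lemma length_code [simp]: "length (code n X w) = n"
  by (simp add: code_def)

lemma code_shift: "code l X ((T ^^ j) w) = take l (drop j (code (j + l) X w))"
  by (rule nth_equalityI) (auto simp: code_def funpow_add add.commute)

lemma code_take: "l \<le> n \<Longrightarrow> code l X w = take l (code n X w)"
  by (rule nth_equalityI) (auto simp: code_def)

lemma simple_code: "simple_function \<nu> X \<Longrightarrow> simple_function \<nu> (code n X)"
proof (induction n)
  case (Suc n)
  have "simple_function \<nu> (\<lambda>w. (X w, code n X (T w)))" by (intro simple_Pair simple_T Suc)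
  from simple_comp[OF this, of "\<lambda>(a, b). a # b"] show ?case by (simp add: code_Suc[abs_def])
qed (simp add: code_0')

definition incr :: "(circle \<Rightarrow> 'b) \<Rightarrow> nat \<Rightarrow> real" where
  "incr X n = ent (code (Suc n) X) - ent (code n X)"

lemma incr_cond_ent:
  assumes X: "simple_function \<nu> X"
  shows "incr X n = cond_ent X (\<lambda>w. code n X (T w))"
proof -
  have "ent (code (Suc n) X) = ent (\<lambda>w. (X w, code n X (T w)))"
    by (rule ent_eqI) (simp add: code_Suc)
  then show ?thesis unfolding incr_def cond_ent_def using ent_T[OF simple_code[OF X]] by simp
qed

lemma incr_nonneg: "simple_function \<nu> X \<Longrightarrow> 0 \<le> incr X n"
  unfolding incr_cond_ent by (intro cond_ent_nonneg simple_T simple_code)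

lemma incr_Suc_le:
  assumes X: "simple_function \<nu> X"
  shows "incr X (Suc n) \<le> incr X n"
proof -
  have "cond_ent X (\<lambda>w. code (Suc n) X (T w)) \<le> cond_ent X (\<lambda>w. take n (code (Suc n) X (T w)))"
    by (intro cond_ent_coarser X simple_T simple_code)
  then show ?thesis unfolding incr_cond_ent[OF X] by (simp add: code_take[of n "Suc n", symmetric])
qed

definition rate_ent :: "(circle \<Rightarrow> 'b) \<Rightarrow> real" where "rate_ent X = lim (incr X)"

lemma incr_tendsto:
  assumes X: "simple_function \<nu> X"
  shows "incr X \<longlonglongrightarrow> rate_ent X" "rate_ent X \<le> incr X n"
proof -
  have dec: "decseq (incr X)" using incr_Suc_le[OF X] by (rule decseq_SucI)
  have "convergent (incr X)"
    using decseq_bounded[OF dec, of 0] incr_nonneg[OF X] decseq_convergent[OF dec, of 0]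
    by (metis convergent_def)
  then show l: "incr X \<longlonglongrightarrow> rate_ent X" by (simp add: rate_ent_def convergent_LIMSEQ_iff)
  show "rate_ent X \<le> incr X n" using decseq_ge[OF dec l] .
qed

lemma ent_code_sum: "ent (code n X) = (\<Sum>k<n. incr X k)"
proof (induction n)
  case 0
  show ?case by (simp add: ent_const code_def)
qed (simp add: incr_def)

lemma ent_code_rate:
  assumes "simple_function \<nu> X"
  shows "(\<lambda>n. ent (code n X) / real n) \<longlonglongrightarrow> rate_ent X"
  unfolding ent_code_sum by (rule Cesaro_limit[OF incr_tendsto(1)[OF assms]])

text \<open>The code of length \<open>n + l\<close> of \<open>Q\<close> determines the code of length \<open>l\<close> at each of the times
  \<open>i < n\<close>; given the former, each symbol of \<open>X\<close> therefore costs at most \<open>cond_ent X (code l Q)\<close>.\<close>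

lemma rate_ent_le:
  assumes X: "simple_function \<nu> X" and Q: "simple_function \<nu> Q"
  shows "rate_ent X \<le> rate_ent Q + cond_ent X (code l Q)"
proof -
  have bound: "ent (code n X) \<le> ent (code (n + l) Q) + real n * cond_ent X (code l Q)" for n
  proof -
    let ?C = "code (n + l) Q"
    have C: "simple_function \<nu> ?C" by (rule simple_code[OF Q])
    have "cond_ent (code i X) ?C \<le> real i * cond_ent X (code l Q)" if "i \<le> n" for i
      using that
    proof (induction i)
      case 0
      have "ent (\<lambda>w. (code 0 X w, ?C w)) = ent ?C" by (rule ent_eqI) simp
      then show ?case by (simp add: cond_ent_def)
    next
      case (Suc i)
      have Xi: "simple_function \<nu> (\<lambda>w. X ((T ^^ i) w))" by (rule simple_T_iter[OF X])
      have "ent (\<lambda>w. (code (Suc i) X w, ?C w)) = ent (\<lambda>w. ((code i X w, X ((T ^^ i) w)), ?C w))"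
        by (rule ent_eqI) (simp add: code_Suc')
      then have "cond_ent (code (Suc i) X) ?C = cond_ent (\<lambda>w. (code i X w, X ((T ^^ i) w))) ?C"
        by (simp add: cond_ent_def)
      also have "\<dots> \<le> cond_ent (code i X) ?C + cond_ent (\<lambda>w. X ((T ^^ i) w)) ?C"
        by (intro cond_ent_Pair_le simple_code X Xi C)
      also have "cond_ent (\<lambda>w. X ((T ^^ i) w)) ?C \<le> cond_ent (\<lambda>w. X ((T ^^ i) w)) (\<lambda>w. take l (drop i (?C w)))"
        by (intro cond_ent_coarser Xi C)
      also have "(\<lambda>w. take l (drop i (?C w))) = (\<lambda>w. code l Q ((T ^^ i) w))"
      proof
        fix w
        have "code (i + l) Q w = take (i + l) (?C w)" using Suc.prems by (intro code_take) simp
        then show "take l (drop i (?C w)) = code l Q ((T ^^ i) w)"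
          unfolding code_shift by (simp add: take_drop add.commute)
      qed
      also have "cond_ent (\<lambda>w. X ((T ^^ i) w)) (\<lambda>w. code l Q ((T ^^ i) w)) = cond_ent X (code l Q)"
        unfolding cond_ent_def
        using ent_T_iter[OF simple_Pair[OF X simple_code[OF Q]], of i l] ent_T_iter[OF simple_code[OF Q], of l i] by simp
      finally show ?case using Suc by (simp add: algebra_simps)
    qed
    from this[of n] have "ent (\<lambda>w. (code n X w, ?C w)) \<le> ent ?C + real n * cond_ent X (code l Q)"
      by (simp add: cond_ent_def)
    moreover have "ent (code n X) \<le> ent (\<lambda>w. (code n X w, ?C w))"
      using ent_coarser[OF simple_Pair[OF simple_code[OF X] C], of fst n] by simp
    ultimately show ?thesis by linarith
  qed
  have l1: "(\<lambda>n. (ent (code (n + l) Q) / real (n + l)) * (real (n + l) / real n) + cond_ent X (code l Q))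
      \<longlonglongrightarrow> rate_ent Q * 1 + cond_ent X (code l Q)"
  proof (intro tendsto_add tendsto_mult tendsto_const)
    show "(\<lambda>n. ent (code (n + l) Q) / real (n + l)) \<longlonglongrightarrow> rate_ent Q"
      by (rule LIMSEQ_ignore_initial_segment[OF ent_code_rate[OF Q]])
    show "(\<lambda>n. real (n + l) / real n) \<longlonglongrightarrow> 1" by real_asymp
  qed
  have "rate_ent X \<le> rate_ent Q * 1 + cond_ent X (code l Q)"
  proof (rule LIMSEQ_le[OF ent_code_rate[OF X] l1])
    have "ent (code n X) / real n \<le> (ent (code (n + l) Q) / real (n + l)) * (real (n + l) / real n) + cond_ent X (code l Q)"
      if "n \<ge> 1" for n
    proof -
      have "(ent (code (n + l) Q) / real (n + l)) * (real (n + l) / real n) = ent (code (n + l) Q) / real n"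
        using that by simp
      then show ?thesis
        using divide_right_mono[OF bound[of n], of "real n"] that by (simp add: add_divide_distrib)
    qed
    then show "\<exists>N. \<forall>n\<ge>N. ent (code n X) / real n
        \<le> (ent (code (n + l) Q) / real (n + l)) * (real (n + l) / real n) + cond_ent X (code l Q)" by blast
  qed
  then show ?thesis by simp
qed

text \<open>The refined partition consists of the cylinders, and perhaps of the empty set.\<close>

lemma refined_partition_fibres: "refined_partition \<nu> T (fibres X) n - {{}} = fibres (code n X)"
proof (induction n)
  case 0
  have f: "fibres (code 0 X) = {UNIV}" unfolding code_0' by (auto simp: fibres_def vimage_def)
  show ?case unfolding f by simp
next
  case (Suc n)
  have split: "code (Suc n) X -` {code (Suc n) X w} = X -` {X w} \<inter> (T -` (code n X -` {code n X (T w)}))" for w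
    by (auto simp: code_Suc)
  show ?case
  proof (intro equalityI subsetI)
    fix Z assume "Z \<in> refined_partition \<nu> T (fibres X) (Suc n) - {{}}"
    then obtain A B w where AB: "A \<in> fibres X" "B \<in> refined_partition \<nu> T (fibres X) n"
      "Z = A \<inter> T -` B" "w \<in> Z" by auto
    have "B \<in> fibres (code n X)" using AB Suc by auto
    then have "B = code n X -` {code n X (T w)}" using AB by (auto simp: fibres_def)
    moreover have "A = X -` {X w}" using AB by (auto simp: fibres_def)
    ultimately have "Z = code (Suc n) X -` {code (Suc n) X w}" unfolding split AB(3) by simp
    then show "Z \<in> fibres (code (Suc n) X)" by (auto simp: fibres_def)
  next
    fix Z assume "Z \<in> fibres (code (Suc n) X)"
    then obtain w where w: "Z = code (Suc n) X -` {code (Suc n) X w}" by (auto simp: fibres_def)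
    have "code n X -` {code n X (T w)} \<in> refined_partition \<nu> T (fibres X) n"
      using Suc by (auto simp: fibres_def)
    moreover have "X -` {X w} \<in> fibres X" by (auto simp: fibres_def)
    ultimately have "Z \<in> refined_partition \<nu> T (fibres X) (Suc n)" unfolding w split by auto
    moreover have "w \<in> Z" using w by simp
    ultimately show "Z \<in> refined_partition \<nu> T (fibres X) (Suc n) - {{}}" by blast
  qed
qed

lemma entropy_wrt_fibres:
  assumes X: "simple_function \<nu> X"
  shows "entropy_wrt_partition \<nu> T (fibres X) = rate_ent X"
proof -
  have fin: "finite (refined_partition \<nu> T (fibres X) n)" for n
  proof -
    have "finite (fibres (code n X))" unfolding fibres_def using simple_finite[OF simple_code[OF X]] by simp
    then show ?thesis unfolding refined_partition_fibres[symmetric] by simp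
  qed
  have "partition_entropy \<nu> (refined_partition \<nu> T (fibres X) n) = ent (code n X)" for n
  proof -
    have "(\<Sum>A\<in>refined_partition \<nu> T (fibres X) n. prob A * ln (prob A))
        = (\<Sum>A\<in>refined_partition \<nu> T (fibres X) n - {{}}. prob A * ln (prob A))"
      using fin by (intro sum.mono_neutral_right) auto
    then show ?thesis unfolding partition_entropy_def refined_partition_fibres ent_fibres by simp
  qed
  then show ?thesis
    unfolding entropy_wrt_partition_def using ent_code_rate[OF X] by (simp add: limI)
qed

lemma finite_partition_fibres:
  assumes "finite_partition \<nu> P"
  shows "\<exists>X :: circle \<Rightarrow> circle set. simple_function \<nu> X \<and> P = fibres X"
proof -
  have P: "finite P" "P \<subseteq> sets borel" "partition_on UNIV P" using assms by (auto simp: finite_partition_def)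
  define X where "X w = (THE A. A \<in> P \<and> w \<in> A)" for w
  have ex1: "\<exists>!A. A \<in> P \<and> w \<in> A" for w
  proof -
    obtain A where A: "A \<in> P" "w \<in> A" using P(3) unfolding partition_on_def by blast
    moreover have "B = A" if "B \<in> P \<and> w \<in> B" for B
      using P(3) A that unfolding partition_on_def disjoint_def by blast
    ultimately show ?thesis by blast
  qed
  have X: "X w \<in> P" "w \<in> X w" for w using theI'[OF ex1, of w] by (auto simp: X_def)
  have XI: "X w = A" if "A \<in> P" "w \<in> A" for A w using ex1[of w] X[of w] that by auto
  have fib: "X -` {A} = A" if "A \<in> P" for A using XI[OF that] X by auto
  have ne: "A \<noteq> {}" if "A \<in> P" for A using P(3) that by (auto simp: partition_on_def)
  have ran: "range X = P"
  proof (intro equalityI subsetI)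
    fix A assume "A \<in> P"
    then show "A \<in> range X" using ne[of A] XI[of A] by blast
  qed (use X in auto)
  have "simple_function \<nu> X"
    unfolding simple_function_def using P fib ran by auto
  moreover have "P = fibres X" unfolding fibres_def ran using fib by auto
  ultimately show ?thesis by blast
qed

lemma fibres_finite_partition:
  assumes "simple_function \<nu> X"
  shows "finite_partition \<nu> (fibres X)"
  unfolding finite_partition_def partition_on_def disjoint_def
  using simple_finite[OF assms] simple_sets[OF assms] by (auto simp: fibres_def)

section \<open>Generating partitions\<close>

definition generating :: "(circle \<Rightarrow> 'b) \<Rightarrow> bool" where
  "generating Q \<longleftrightarrow> simple_function \<nu> Q \<and> (\<forall>e>0. \<exists>l. \<forall>x y. code l Q x = code l Q y \<longrightarrow> dist x y < e)"

text \<open>The sets that are unions of cylinders up to arbitrarily small measure.\<close>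

definition approximable :: "(circle \<Rightarrow> 'b) \<Rightarrow> circle set \<Rightarrow> bool" where
  "approximable Q A \<longleftrightarrow> (\<forall>e>0. \<exists>l S. prob (sym_diff A (code l Q -` S)) < e)"

lemma code_vimage_larger: "l \<le> n \<Longrightarrow> code l Q -` S = code n Q -` {c. take l c \<in> S}"
  by (auto simp: code_take[symmetric])

lemma approximableI:
  assumes Q: "simple_function \<nu> Q" and A: "A \<in> sets borel"
    and B: "\<And>e. e > 0 \<Longrightarrow> \<exists>B\<in>sets borel. approximable Q B \<and> prob (sym_diff A B) < e"
  shows "approximable Q A"
  unfolding approximable_def
proof (intro allI impI)
  fix e :: real assume e: "e > 0"
  obtain B where B: "B \<in> sets borel" "approximable Q B" "prob (sym_diff A B) < e / 2"
    using B[of "e / 2"] e by auto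
  obtain l S where lS: "prob (sym_diff B (code l Q -` S)) < e / 2"
    using B(2) e unfolding approximable_def by (meson half_gt_zero)
  have U: "code l Q -` S \<in> sets borel" by (rule simple_sets[OF simple_code[OF Q]])
  have "prob (sym_diff A (code l Q -` S)) \<le> prob (sym_diff A B \<union> sym_diff B (code l Q -` S))"
    using A B U by (intro finite_measure_mono) auto
  also have "\<dots> \<le> prob (sym_diff A B) + prob (sym_diff B (code l Q -` S))"
    using A B U by (intro measure_Un_le) auto
  finally have "prob (sym_diff A (code l Q -` S)) < e" using B(3) lS by linarith
  then show "\<exists>l S. prob (sym_diff A (code l Q -` S)) < e" by blast
qed

lemma approximable_Un:
  assumes Q: "simple_function \<nu> Q" and AB: "A \<in> sets borel" "B \<in> sets borel"
    and a: "approximable Q A" "approximable Q B"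
  shows "approximable Q (A \<union> B)"
  unfolding approximable_def
proof (intro allI impI)
  fix e :: real assume e: "e > 0"
  obtain l S where l: "prob (sym_diff A (code l Q -` S)) < e / 2"
    using a(1) e unfolding approximable_def by (meson half_gt_zero)
  obtain k R where k: "prob (sym_diff B (code k Q -` R)) < e / 2"
    using a(2) e unfolding approximable_def by (meson half_gt_zero)
  define n where "n = max l k"
  define S' R' where "S' = {c. take l c \<in> S}" and "R' = {c. take k c \<in> R}"
  have eq: "code l Q -` S = code n Q -` S'" "code k Q -` R = code n Q -` R'"
    unfolding S'_def R'_def by (rule code_vimage_larger; simp add: n_def)+
  have U: "code n Q -` Z \<in> sets borel" for Z by (rule simple_sets[OF simple_code[OF Q]])
  have "prob (sym_diff (A \<union> B) (code n Q -` (S' \<union> R')))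
      \<le> prob (sym_diff A (code n Q -` S') \<union> sym_diff B (code n Q -` R'))"
    using AB U by (intro finite_measure_mono) auto
  also have "\<dots> \<le> prob (sym_diff A (code n Q -` S')) + prob (sym_diff B (code n Q -` R'))"
    using AB U by (intro measure_Un_le) auto
  finally have "prob (sym_diff (A \<union> B) (code n Q -` (S' \<union> R'))) < e" using l k unfolding eq by linarith
  then show "\<exists>l S. prob (sym_diff (A \<union> B) (code l Q -` S)) < e" by blast
qed

text \<open>The union of the cylinders that meet a closed set lies in a small neighbourhood of the set.\<close>

lemma approximable_closed:
  assumes Q: "generating Q" and C: "closed C"
  shows "approximable Q C"
  unfolding approximable_def
proof (intro allI impI)
  fix e :: real assume e: "e > 0"
  show "\<exists>l S. prob (sym_diff C (code l Q -` S)) < e"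
  proof (cases "C = {}")
    case True
    then show ?thesis using e by (intro exI[of _ 0] exI[of _ "{}"]) simp
  next
    case False
    define E where "E k = {x. infdist x C < 1 / real (Suc k)} - C" for k
    have op: "open {x. infdist x C < 1 / real (Suc k)}" for k
      by (intro open_Collect_less continuous_intros)
    have E: "E k \<in> sets borel" for k unfolding E_def using op C by (intro sets.Diff) auto
    have "decseq E"
    proof (rule decseq_SucI)
      fix k
      have "1 / real (Suc (Suc k)) \<le> 1 / real (Suc k)" by (simp add: frac_le)
      then show "E (Suc k) \<subseteq> E k" unfolding E_def by auto
    qed
    moreover have "(\<Inter>k. E k) = {}"
    proof (rule ccontr)
      assume "(\<Inter>k. E k) \<noteq> {}"
      then obtain x where x: "\<And>k. x \<in> E k" by auto
      then have "x \<notin> C" "\<And>k. infdist x C < 1 / real (Suc k)" by (auto simp: E_def)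
      moreover have "infdist x C > 0"
        using in_closed_iff_infdist_zero[OF C False] infdist_nonneg[of x C] \<open>x \<notin> C\<close> by (metis less_eq_real_def)
      ultimately show False using nat_approx_posE[of "infdist x C"] by (metis less_asym)
    qed
    ultimately have "(\<lambda>k. prob (E k)) \<longlonglongrightarrow> 0"
      using finite_Lim_measure_decseq[of E] E by auto
    then have "\<forall>\<^sub>F k in sequentially. prob (E k) < e" using e by (rule order_tendstoD)
    then obtain k where k: "prob (E k) < e" by (meson eventually_sequentially order_refl)
    obtain l where l: "\<And>x y. code l Q x = code l Q y \<Longrightarrow> dist x y < 1 / real (Suc k)"
      using Q unfolding generating_def by (metis of_nat_0_less_iff zero_less_Suc zero_less_divide_1_iff)
    define U where "U = code l Q -` (code l Q ` C)"
    have "x \<in> E k" if x: "x \<in> U" "x \<notin> C" for x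
    proof -
      obtain y where "y \<in> C" "code l Q x = code l Q y" using x by (auto simp: U_def)
      then have "infdist x C < 1 / real (Suc k)" using infdist_le[of y C x] l[of x y] by linarith
      then show ?thesis using x by (simp add: E_def)
    qed
    moreover have "C \<subseteq> U" by (auto simp: U_def)
    ultimately have "sym_diff C U \<subseteq> E k" by blast
    then have "prob (sym_diff C U) \<le> prob (E k)" using E by (intro finite_measure_mono) auto
    then show ?thesis using k unfolding U_def by (intro exI[of _ l] exI[of _ "code l Q ` C"]) linarith
  qed
qed

lemma approximable_borel:
  assumes Q: "generating Q" and A: "A \<in> sets borel"
  shows "approximable Q A"
proof -
  have sQ: "simple_function \<nu> Q" using Q by (simp add: generating_def)
  have st: "Int_stable (Collect closed :: circle set set)" "Collect closed \<subseteq> Pow (UNIV :: circle set)"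
    by (auto simp: Int_stable_def)
  have "A \<in> sigma_sets UNIV (Collect closed)"
    using A unfolding borel_eq_closed by simp
  with st show ?thesis
  proof (induction rule: sigma_sets_induct_disjoint)
    case (basic C)
    then show ?case using approximable_closed[OF Q] by simp
  next
    case empty
    show ?case by (rule approximable_closed[OF Q]) simp
  next
    case (compl A)
    have "sym_diff (UNIV - A) (code l Q -` (- S)) = sym_diff A (code l Q -` S)" for l S by auto
    then show ?case using compl(2) unfolding approximable_def by metis
  next
    case (union A)
    then have A: "A i \<in> sets borel" for i unfolding borel_eq_closed by auto
    have UA: "(\<Union>i<n. A i) \<in> sets borel" for n using A by auto
    have fin: "approximable Q (\<Union>i<n. A i)" for n :: nat
    proof (induction n)
      case 0
      show ?case using approximable_closed[OF Q, of "{}"] by simp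
    next
      case (Suc n)
      have "(\<Union>i<Suc n. A i) = (\<Union>i<n. A i) \<union> A n" by (auto simp: lessThan_Suc)
      then show ?case using approximable_Un[OF sQ UA A Suc union(3)] by simp
    qed
    show ?case
    proof (rule approximableI[OF sQ])
      show "(\<Union>i. A i) \<in> sets borel" using A by auto
      fix e :: real assume e: "e > 0"
      have "(\<lambda>n. prob (\<Union>i<n. A i)) \<longlonglongrightarrow> prob (\<Union>n. \<Union>i<n. A i)"
        using UA by (intro finite_Lim_measure_incseq) (auto simp: incseq_def intro: less_le_trans)
      moreover have "(\<Union>n. \<Union>i<n. A i) = (\<Union>i. A i)" by auto
      ultimately have "(\<lambda>n. prob (\<Union>i<n. A i)) \<longlonglongrightarrow> prob (\<Union>i. A i)" by simp
      then have "\<forall>\<^sub>F n in sequentially. prob (\<Union>i. A i) - e < prob (\<Union>i<n. A i)"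
        by (rule order_tendstoD) (use e in simp)
      then obtain n where n: "prob (\<Union>i. A i) - e < prob (\<Union>i<n. A i)"
        by (meson eventually_sequentially order_refl)
      have "sym_diff (\<Union>i. A i) (\<Union>i<n. A i) = (\<Union>i. A i) - (\<Union>i<n. A i)" by auto
      moreover have "prob ((\<Union>i. A i) - (\<Union>i<n. A i)) = prob (\<Union>i. A i) - prob (\<Union>i<n. A i)"
        using A UA by (intro finite_measure_Diff) auto
      ultimately have "prob (sym_diff (\<Union>i. A i) (\<Union>i<n. A i)) < e" using n by simp
      then show "\<exists>B\<in>sets borel. approximable Q B \<and> prob (sym_diff (\<Union>i. A i) B) < e"
        using UA fin by blast
    qed
  qed
qed

lemma cond_ent_code_mono:
  assumes "simple_function \<nu> X" "simple_function \<nu> Q" "l \<le> n"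
  shows "cond_ent X (code n Q) \<le> cond_ent X (code l Q)"
  using cond_ent_coarser[OF assms(1) simple_code[OF assms(2)], of n "take l"]
  by (simp add: code_take[OF assms(3), symmetric])

text \<open>If the union \<open>U\<close> of cylinders approximates \<open>A\<close>, then, given the code, membership in \<open>A\<close> amounts to
  membership in the small set \<open>sym_diff A U\<close>.\<close>

lemma cond_ent_set_small:
  assumes Q: "generating Q" and A: "A \<in> sets borel" and e: "e > 0"
  shows "\<exists>l. cond_ent (\<lambda>w. w \<in> A) (code l Q) < e"
proof -
  have sQ: "simple_function \<nu> Q" using Q by (simp add: generating_def)
  obtain d where d: "d > 0" "\<And>B. B \<in> sets borel \<Longrightarrow> prob B < d \<Longrightarrow> ent (\<lambda>w. w \<in> B) < e"
    using ent_set_small[OF e] by auto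
  obtain l S where lS: "prob (sym_diff A (code l Q -` S)) < d"
    using approximable_borel[OF Q A] d(1) unfolding approximable_def by blast
  define U where "U = code l Q -` S"
  have U: "U \<in> sets borel" unfolding U_def by (rule simple_sets[OF simple_code[OF sQ]])
  have D: "sym_diff A U \<in> sets borel" using A U by auto
  have "cond_ent (\<lambda>w. w \<in> A) (code l Q) \<le> cond_ent (\<lambda>w. w \<in> A) (\<lambda>w. code l Q w \<in> S)"
    by (intro cond_ent_coarser simple_set A simple_code sQ)
  also have "(\<lambda>w. code l Q w \<in> S) = (\<lambda>w. w \<in> U)" by (simp add: U_def)
  also have "cond_ent (\<lambda>w. w \<in> A) (\<lambda>w. w \<in> U) = cond_ent (\<lambda>w. w \<in> sym_diff A U) (\<lambda>w. w \<in> U)"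
    unfolding cond_ent_def by (intro arg_cong2[where f=minus] refl ent_eqI) auto
  also have "\<dots> \<le> ent (\<lambda>w. w \<in> sym_diff A U)" by (intro cond_ent_le_ent simple_set D U)
  also have "\<dots> < e" using lS by (intro d(2) D) (simp add: U_def)
  finally show ?thesis by blast
qed

lemma cond_ent_small:
  assumes Q: "generating Q" and X: "simple_function \<nu> X" and e: "e > 0"
  shows "\<exists>l. cond_ent X (code l Q) < e"
proof -
  have sQ: "simple_function \<nu> Q" using Q by (simp add: generating_def)
  define R where "R F w = (if X w \<in> F then Some (X w) else None)" for F w
  have R: "simple_function \<nu> (R F)" for F
    using simple_comp[OF X, of "\<lambda>v. if v \<in> F then Some v else None"] by (simp add: R_def[abs_def])
  have "\<exists>l. cond_ent (R F) (code l Q) < e" if "finite F" "e > 0" for F e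
    using that
  proof (induction F arbitrary: e rule: finite_induct)
    case empty
    have z: "cond_ent (R {}) (code 0 Q) = 0"
      unfolding cond_ent_def by (simp add: R_def ent_const code_0')
    show ?case by (rule exI[of _ 0]) (unfold z, rule empty)
  next
    case (insert v F)
    obtain l where l: "cond_ent (R F) (code l Q) < e / 2" using insert.IH[of "e / 2"] insert.prems by auto
    have A: "X -` {v} \<in> sets borel" by (rule simple_sets[OF X])
    obtain k where k: "cond_ent (\<lambda>w. w \<in> X -` {v}) (code k Q) < e / 2"
      using cond_ent_set_small[OF Q A, of "e / 2"] insert.prems by auto
    define n where "n = max l k"
    have "R (insert v F) = (\<lambda>w. (\<lambda>(a, b). if b then Some v else a) (R F w, w \<in> X -` {v}))"
      by (auto simp: R_def fun_eq_iff)
    then have "cond_ent (R (insert v F)) (code n Q) \<le> cond_ent (\<lambda>w. (R F w, w \<in> X -` {v})) (code n Q)"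
      using cond_ent_first_coarser[OF simple_Pair[OF R[of F] simple_set[OF A]] simple_code[OF sQ],
        of "\<lambda>(a, b). if b then Some v else a" n] by simp
    also have "\<dots> \<le> cond_ent (R F) (code n Q) + cond_ent (\<lambda>w. w \<in> X -` {v}) (code n Q)"
      by (intro cond_ent_Pair_le R simple_set A simple_code sQ)
    also have "\<dots> \<le> cond_ent (R F) (code l Q) + cond_ent (\<lambda>w. w \<in> X -` {v}) (code k Q)"
      by (intro add_mono cond_ent_code_mono R simple_set A sQ) (auto simp: n_def)
    finally show ?case using l k by (intro exI[of _ n]) linarith
  qed
  from this[OF simple_finite[OF X] e] obtain l where l: "cond_ent (R (range X)) (code l Q) < e" by blast
  have eq: "cond_ent X (code l Q) = cond_ent (R (range X)) (code l Q)"
    unfolding cond_ent_def by (intro arg_cong2[where f=minus] refl ent_eqI) (auto simp: R_def)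
  show ?thesis by (rule exI[of _ l]) (unfold eq, rule l)
qed

text \<open>The theorem of Kolmogorov and Sinai: by \<open>rate_ent_le\<close> and \<open>cond_ent_small\<close> no partition has a larger
  entropy rate than a generating one.\<close>

theorem metric_entropy_generating:
  assumes Q: "generating Q"
  shows "metric_entropy \<nu> T = ereal (rate_ent Q)"
proof -
  have sQ: "simple_function \<nu> Q" using Q by (simp add: generating_def)
  have le: "rate_ent X \<le> rate_ent Q" if X: "simple_function \<nu> X" for X :: "circle \<Rightarrow> circle set"
  proof (rule field_le_epsilon)
    fix e :: real assume "e > 0"
    then obtain l where "cond_ent X (code l Q) < e" using cond_ent_small[OF Q X] by blast
    then show "rate_ent X \<le> rate_ent Q + e" using rate_ent_le[OF X sQ, of l] by linarith
  qed
  show ?thesis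
    unfolding metric_entropy_def
  proof (rule antisym)
    show "(SUP P\<in>{P. finite_partition \<nu> P}. ereal (entropy_wrt_partition \<nu> T P)) \<le> ereal (rate_ent Q)"
    proof (rule SUP_least)
      fix P assume "P \<in> {P. finite_partition \<nu> P}"
      then obtain X :: "circle \<Rightarrow> circle set" where X: "simple_function \<nu> X" "P = fibres X"
        using finite_partition_fibres by blast
      then show "ereal (entropy_wrt_partition \<nu> T P) \<le> ereal (rate_ent Q)"
        using le[OF X(1)] by (simp add: X(2) entropy_wrt_fibres[OF X(1)])
    qed
    have "ereal (rate_ent Q) = ereal (entropy_wrt_partition \<nu> T (fibres Q))"
      using entropy_wrt_fibres[OF sQ] by simp
    also have "\<dots> \<le> (SUP P\<in>{P. finite_partition \<nu> P}. ereal (entropy_wrt_partition \<nu> T P))"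
      using fibres_finite_partition[OF sQ] by (intro SUP_upper) simp
    finally show "ereal (rate_ent Q) \<le> (SUP P\<in>{P. finite_partition \<nu> P}. ereal (entropy_wrt_partition \<nu> T P))" .
  qed
qed

end

section \<open>The partition into branches\<close>

context circle_factor
begin

definition branch :: "circle \<Rightarrow> nat" where "branch x = nat \<lfloor>G (crep x)\<rfloor>"

definition pre :: "nat \<Rightarrow> circle \<Rightarrow> circle" where "pre i z = br (crep z + real i)"

lemma G_crep_bounds: "0 \<le> G (crep x)" "G (crep x) < real (N + 1)"
  using G_mono[of 0 "crep x"] G_strict_mono[of "crep x" 1] crep_bounds[of x] G_ge_1[of 0]
  by (auto simp: G_eq_g)

lemma branch_le: "branch x \<le> N"
  using G_crep_bounds[of x] unfolding branch_def by linarith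

lemma crep_T: "crep (T x) = G (crep x) - real (branch x)"
proof -
  have "T x = to_circle (G (crep x))" using T_to_circle[of "crep x"] by simp
  then have "crep (T x) = frac (G (crep x))" by (simp add: crep_to_circle)
  then show ?thesis using G_crep_bounds[of x] by (simp add: frac_def branch_def)
qed

lemma crep_eq_H: "crep x = H (crep (T x) + real (branch x))"
  by (simp add: crep_T)

lemma pre_branch: "pre (branch x) (T x) = x"
  unfolding pre_def br_def crep_eq_H[symmetric] by simp

lemma T_pre [simp]: "T (pre i z) = z"
proof -
  have "to_circle (crep z + real i) = to_circle (crep z)" using to_circle_add_int[of "crep z" "int i"] by simp
  then show ?thesis by (simp add: pre_def)
qed

lemma branch_pre:
  assumes "i \<le> N"
  shows "branch (pre i z) = i"
proof -
  have "0 \<le> H (crep z + real i) \<and> H (crep z + real i) < 1"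
    using crep_bounds[of z] assms by (intro H_unit) auto
  then have "crep (pre i z) = H (crep z + real i)"
    by (simp add: pre_def br_def crep_to_circle frac_eq_id)
  then have "G (crep (pre i z)) = crep z + real i" by simp
  then show ?thesis using crep_bounds[of z] unfolding branch_def by (simp add: floor_eq_iff nat_eq_iff)
qed

text \<open>Points with the same itinerary are taken by the same branches, so that their representatives
  separate like the endpoints of an arc on the line.\<close>

lemma orbit_separation:
  assumes "\<And>j. j < l \<Longrightarrow> branch ((T ^^ j) x) = branch ((T ^^ j) y)"
    and "0 < d" "d \<le> \<bar>crep x - crep y\<bar>"
  shows "d + real l * (d * rate d) \<le> \<bar>crep ((T ^^ l) x) - crep ((T ^^ l) y)\<bar>"
  using assms(1)
proof (induction l)
  case (Suc l)
  define u v where "u = (T ^^ l) x" and "v = (T ^^ l) y"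
  define e where "e = \<bar>crep u - crep v\<bar>"
  have r: "0 \<le> d * rate d" using assms rate_nonneg by simp
  have IH: "d + real l * (d * rate d) \<le> e" using Suc unfolding e_def u_def v_def by simp
  then have de: "d \<le> e" using r by (smt (verit) mult_nonneg_nonneg of_nat_0_le_iff)
  have b: "branch u = branch v" using Suc.prems[of l] by (simp add: u_def v_def)
  define a c where "a = crep (T u) + real (branch u)" and "c = crep (T v) + real (branch v)"
  have ac: "\<bar>a - c\<bar> = \<bar>crep (T u) - crep (T v)\<bar>" "crep u = H a" "crep v = H c"
    unfolding a_def c_def crep_eq_H[symmetric] using b by simp_all
  have "\<bar>a - c\<bar> \<le> 1" unfolding ac(1) using crep_bounds[of "T u"] crep_bounds[of "T v"] by linarith
  from H_contract(2)[OF this] have "e * (1 + rate e) \<le> \<bar>crep (T u) - crep (T v)\<bar>"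
    unfolding ac(1) e_def ac(2,3) .
  moreover have "d * rate d \<le> e * rate e"
    using de assms rate_mono[of d e] rate_nonneg[of d] by (intro mult_mono) auto
  ultimately show ?case using IH by (simp add: u_def v_def algebra_simps)
qed (use assms in simp)

text \<open>Representatives of points stay at distance less than 1.\<close>

lemma cylinders_small:
  assumes "e > 0"
  shows "\<exists>l. \<forall>x y. (\<forall>j<l. branch ((T ^^ j) x) = branch ((T ^^ j) y)) \<longrightarrow> dist x y < e"
proof -
  obtain l where "1 / (e * rate e) < real l" using reals_Archimedean2 by blast
  then have l: "1 < real l * (e * rate e)" using assms rate_pos[of e] by (simp add: field_simps)
  have "dist x y < e" if "\<forall>j<l. branch ((T ^^ j) x) = branch ((T ^^ j) y)" for x y
  proof (rule ccontr)
    assume "\<not> dist x y < e"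
    then have "e \<le> \<bar>crep x - crep y\<bar>" using dist_to_circle_le[of "crep x" "crep y"] by simp
    then have "e + real l * (e * rate e) \<le> \<bar>crep ((T ^^ l) x) - crep ((T ^^ l) y)\<bar>"
      using orbit_separation[of l x y e] that assms by simp
    moreover have "\<bar>crep ((T ^^ l) x) - crep ((T ^^ l) y)\<bar> < 1"
      using crep_bounds[of "(T ^^ l) x"] crep_bounds[of "(T ^^ l) y"] by linarith
    ultimately show False using l assms by linarith
  qed
  then show ?thesis by blast
qed

lemma G_borel: "G \<in> borel_measurable borel"
  by (rule borel_measurable_mono) (auto simp: mono_def G_mono)

lemma branch_fibre_borel: "branch -` {i} \<in> sets borel"
proof -
  have "branch -` {i} = (\<lambda>x. G (crep x)) -` {real i..<real i + 1}"
  proof (intro set_eqI)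
    fix x
    show "x \<in> branch -` {i} \<longleftrightarrow> x \<in> (\<lambda>x. G (crep x)) -` {real i..<real i + 1}"
      using G_crep_bounds[of x] unfolding branch_def by (auto simp: nat_eq_iff floor_eq_iff)
  qed
  moreover have "(\<lambda>x. G (crep x)) \<in> borel_measurable borel"
    by (rule measurable_compose[OF crep_borel_measurable G_borel])
  ultimately show ?thesis using measurable_sets[of "\<lambda>x. G (crep x)" borel borel "{real i..<real i + 1}"] by simp
qed

lemma (in circle_prob) simple_branch: "circle_factor V \<Longrightarrow> simple_function \<nu> (circle_factor.branch V)"
  unfolding simple_function_def
  using circle_factor.branch_fibre_borel circle_factor.branch_le[of V]
  by (auto intro: finite_subset[of _ "{..circle_factor.N V}"])

end

section \<open>Relative entropy\<close>

text \<open>Relative entropy dominates the Hellinger distance, as \<open>ln t \<le> t - 1\<close> for \<open>t = sqrt (b / a)\<close>.\<close>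

lemma relative_entropy_hellinger:
  fixes a b :: "'i \<Rightarrow> real"
  assumes "finite J" "\<And>v. v \<in> J \<Longrightarrow> 0 \<le> a v" "\<And>v. v \<in> J \<Longrightarrow> 0 \<le> b v"
    and "\<And>v. v \<in> J \<Longrightarrow> 0 < a v \<Longrightarrow> 0 < b v" and "sum a J = sum b J"
  shows "(\<Sum>v\<in>J. a v * (ln (b v) - ln (a v))) \<le> - (\<Sum>v\<in>J. (sqrt (a v) - sqrt (b v))\<^sup>2)"
proof -
  have "a v * (ln (b v) - ln (a v)) \<le> b v - a v - (sqrt (a v) - sqrt (b v))\<^sup>2" if v: "v \<in> J" for v
  proof (cases "a v = 0")
    case True
    then show ?thesis using assms(3)[OF v] by simp
  next
    case False
    then have p: "0 < a v" "0 < b v" using assms(2,4)[OF v] by auto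
    define r where "r = sqrt (b v) / sqrt (a v)"
    have r: "r > 0" using p by (simp add: r_def)
    have "ln (b v) - ln (a v) = 2 * ln r" using p by (simp add: r_def ln_div ln_sqrt)
    also have "\<dots> \<le> 2 * (r - 1)" using ln_le_minus_one[OF r] by simp
    finally have "a v * (ln (b v) - ln (a v)) \<le> a v * (2 * (r - 1))" using p by (intro mult_left_mono) auto
    also have "a v * r = sqrt (a v) * sqrt (b v)"
      using p real_sqrt_mult_self[of "a v"] by (simp add: r_def field_simps)
    then have "a v * (2 * (r - 1)) = 2 * (sqrt (a v) * sqrt (b v)) - 2 * a v" by (simp add: algebra_simps)
    also have "\<dots> = b v - a v - (sqrt (a v) - sqrt (b v))\<^sup>2"
      using p by (simp add: power2_diff)
    finally show ?thesis .
  qed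
  then have "(\<Sum>v\<in>J. a v * (ln (b v) - ln (a v))) \<le> (\<Sum>v\<in>J. b v - a v - (sqrt (a v) - sqrt (b v))\<^sup>2)"
    by (rule sum_mono)
  also have "\<dots> = - (\<Sum>v\<in>J. (sqrt (a v) - sqrt (b v))\<^sup>2)"
    using assms(5) by (simp add: sum_subtractf)
  finally show ?thesis .
qed

text \<open>Cauchy-Schwarz in the form with a free parameter \<open>t\<close>, which avoids square roots of sums.\<close>

lemma total_variation_hellinger:
  fixes a b :: "'i \<Rightarrow> real"
  assumes "\<And>v. v \<in> J \<Longrightarrow> 0 \<le> a v" "\<And>v. v \<in> J \<Longrightarrow> 0 \<le> b v" "sum a J = 1" "sum b J = 1" "t > 0"
  shows "(\<Sum>v\<in>J. \<bar>a v - b v\<bar>) \<le> (\<Sum>v\<in>J. (sqrt (a v) - sqrt (b v))\<^sup>2) / t + t"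
proof -
  have "\<bar>a v - b v\<bar> \<le> (sqrt (a v) - sqrt (b v))\<^sup>2 / t + t * ((a v + b v) / 2)" if v: "v \<in> J" for v
  proof -
    define p q where "p = sqrt (a v)" and "q = sqrt (b v)"
    have pq: "a v = p\<^sup>2" "b v = q\<^sup>2" using assms(1,2)[OF v] by (simp_all add: p_def q_def)
    have "p\<^sup>2 - q\<^sup>2 = (p - q) * (p + q)" by (simp add: power2_eq_square algebra_simps)
    then have "\<bar>a v - b v\<bar> = \<bar>p - q\<bar> * \<bar>p + q\<bar>" by (simp only: pq abs_mult)
    also have "\<dots> \<le> (p - q)\<^sup>2 / t + t * ((p + q)\<^sup>2 / 4)"
    proof -
      have "0 \<le> (\<bar>p - q\<bar> / sqrt t - sqrt t * \<bar>p + q\<bar> / 2)\<^sup>2" by simp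
      also have "\<dots> = (p - q)\<^sup>2 / t + t * ((p + q)\<^sup>2 / 4) - \<bar>p - q\<bar> * \<bar>p + q\<bar>"
        using assms(5) by (simp add: power2_diff power_divide power_mult_distrib)
      finally show ?thesis by simp
    qed
    also have "t * ((p + q)\<^sup>2 / 4) \<le> t * ((p\<^sup>2 + q\<^sup>2) / 2)"
    proof (rule mult_left_mono)
      have "0 \<le> (p - q)\<^sup>2" by simp
      then show "(p + q)\<^sup>2 / 4 \<le> (p\<^sup>2 + q\<^sup>2) / 2" by (simp add: power2_eq_square algebra_simps)
    qed (use assms(5) in simp)
    finally have "\<bar>a v - b v\<bar> \<le> (p - q)\<^sup>2 / t + t * ((a v + b v) / 2)" unfolding pq by simp
    then show ?thesis unfolding p_def q_def .
  qed
  then have "(\<Sum>v\<in>J. \<bar>a v - b v\<bar>) \<le> (\<Sum>v\<in>J. (sqrt (a v) - sqrt (b v))\<^sup>2 / t + t * ((a v + b v) / 2))"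
    by (rule sum_mono)
  also have "\<dots> = (\<Sum>v\<in>J. (sqrt (a v) - sqrt (b v))\<^sup>2) / t + t * ((sum a J + sum b J) / 2)"
    by (simp add: sum.distrib sum_divide_distrib sum_distrib_left[symmetric] add_divide_distrib distrib_left
        flip: sum_divide_distrib)
  finally show ?thesis using assms(3,4) by simp
qed

section \<open>The variational principle\<close>

context transfer_cone
begin

text \<open>The logarithm of the normalised weights: their exponentials sum to 1 over each fibre.\<close>

definition lg :: "circle \<Rightarrow> real" where "lg x = f x + ln (h x) - ln (h (T x)) - ln \<rho>"

definition Lnorm :: "(circle \<Rightarrow> real) \<Rightarrow> circle \<Rightarrow> real" where
  "Lnorm \<phi> z = (\<Sum>i\<le>N. exp (lg (pre i z)) * \<phi> (pre i z))"

lemma Lnorm_eq: "Lnorm \<phi> z = L (\<lambda>x. h x * \<phi> x) z / (\<rho> * h z)"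
proof -
  have "exp (lg (pre i z)) * \<phi> (pre i z) = exp (f (pre i z)) * (h (pre i z) * \<phi> (pre i z)) / (\<rho> * h z)" for i
    using h_pos \<rho>_pos by (simp add: lg_def exp_add exp_diff field_simps)
  then show ?thesis unfolding Lnorm_def L_eq_crep pre_def by (simp add: sum_divide_distrib)
qed

lemma Lnorm_one: "(\<Sum>i\<le>N. exp (lg (pre i z))) = 1"
  using Lnorm_eq[of "\<lambda>_. 1" z] h_pos[of z] \<rho>_pos by (simp add: Lnorm_def L_h)

lemma Lnorm_iter_eq: "(Lnorm ^^ n) \<phi> z = (L ^^ n) (\<lambda>x. h x * \<phi> x) z / (\<rho> ^ n * h z)"
proof (induction n arbitrary: z)
  case 0
  then show ?case using h_pos[of z] by simp
next
  case (Suc n)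
  have "(\<lambda>x. h x * (Lnorm ^^ n) \<phi> x) = (\<lambda>x. (1 / \<rho> ^ n) * (L ^^ n) (\<lambda>x. h x * \<phi> x) x)"
    using h_pos less_imp_neq[OF h_pos] unfolding Suc by (simp add: fun_eq_iff)
  then have "L (\<lambda>x. h x * (Lnorm ^^ n) \<phi> x) z = (1 / \<rho> ^ n) * (L ^^ Suc n) (\<lambda>x. h x * \<phi> x) z"
    using L_iter_scale[of 1 "1 / \<rho> ^ n" "(L ^^ n) (\<lambda>x. h x * \<phi> x)"] by simp
  moreover have "(Lnorm ^^ Suc n) \<phi> z = L (\<lambda>x. h x * (Lnorm ^^ n) \<phi> x) z / (\<rho> * h z)"
    by (simp only: funpow.simps comp_apply Lnorm_eq[of "(Lnorm ^^ n) \<phi>"])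
  ultimately show ?case by simp
qed

lemma Lnorm_continuous: "continuous_on UNIV \<phi> \<Longrightarrow> continuous_on UNIV (Lnorm \<phi>)"
  unfolding Lnorm_eq[abs_def] using h_pos \<rho>_pos
  by (intro continuous_intros L_continuous h_cont) (auto simp: less_imp_neq[symmetric])

lemma Lnorm_iter_continuous: "continuous_on UNIV \<phi> \<Longrightarrow> continuous_on UNIV ((Lnorm ^^ n) \<phi>)"
  by (induction n) (simp_all add: Lnorm_continuous)

lemma Lnorm_bound:
  assumes "\<And>x. \<bar>\<phi> x\<bar> \<le> B"
  shows "\<bar>Lnorm \<phi> z\<bar> \<le> B"
proof -
  have "\<bar>Lnorm \<phi> z\<bar> \<le> (\<Sum>i\<le>N. exp (lg (pre i z)) * B)"
    unfolding Lnorm_def using assms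
    by (intro order_trans[OF sum_abs] sum_mono) (simp add: abs_mult mult_left_mono)
  also have "\<dots> = B" by (simp add: sum_distrib_right[symmetric] Lnorm_one)
  finally show ?thesis .
qed

lemma Lnorm_iter_bound: "(\<And>x. \<bar>\<phi> x\<bar> \<le> B) \<Longrightarrow> \<bar>(Lnorm ^^ n) \<phi> z\<bar> \<le> B"
  by (induction n arbitrary: z) (simp_all add: Lnorm_bound)

lemma Lnorm_tendsto:
  assumes "continuous_on UNIV \<phi>"
  shows "(\<lambda>n. (Lnorm ^^ n) \<phi> z) \<longlonglongrightarrow> integral\<^sup>L mu \<phi>"
proof -
  have "(\<lambda>n. (L ^^ n) (\<lambda>x. h x * \<phi> x) z / \<rho> ^ n / h z) \<longlonglongrightarrow> h z * integral\<^sup>L conf (\<lambda>x. h x * \<phi> x) / h z"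
    using h_pos[of z] by (intro tendsto_divide convergence_pointwise continuous_intros h_cont assms tendsto_const) auto
  then show ?thesis
    using h_pos[of z] borel_measurable_continuous_onI[OF assms] by (simp add: Lnorm_iter_eq integral_mu)
qed

lemma lg_cont: "continuous_on UNIV lg"
  unfolding lg_def using h_pos
  by (intro continuous_intros f_cont h_cont T_cont continuous_on_compose2[OF h_cont T_cont])
    (auto simp: less_imp_neq[symmetric])

text \<open>The iterates of the normalised operator converge to the integral with respect to \<open>mu\<close>.\<close>

lemma Lnorm_invariant_unique:
  assumes "circle_prob m"
    and inv: "\<And>\<phi>. continuous_on UNIV \<phi> \<Longrightarrow> integral\<^sup>L m (Lnorm \<phi>) = integral\<^sup>L m \<phi>"
  shows "m = mu"
proof -
  interpret m: circle_prob m by fact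
  show ?thesis
  proof (rule circle_prob_eqI[OF assms(1) circle_prob_mu])
    fix \<phi> :: "circle \<Rightarrow> real" assume \<phi>: "continuous_on UNIV \<phi>"
    obtain B where "0 < B" and B: "\<And>x. norm (\<phi> x) \<le> B"
      by (rule circle_bounded[OF \<phi>], rule that)
    have I: "integral\<^sup>L m ((Lnorm ^^ n) \<phi>) = integral\<^sup>L m \<phi>" for n
      by (induction n) (simp_all add: inv Lnorm_iter_continuous \<phi>)
    have "(\<lambda>n. integral\<^sup>L m ((Lnorm ^^ n) \<phi>)) \<longlonglongrightarrow> integral\<^sup>L m (\<lambda>_. integral\<^sup>L mu \<phi>)"
    proof (rule integral_dominated_convergence[where w="\<lambda>_. B"])
      show "(Lnorm ^^ n) \<phi> \<in> borel_measurable m" for n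
        using borel_measurable_continuous_onI[OF Lnorm_iter_continuous[OF \<phi>]] by simp
      show "AE x in m. norm ((Lnorm ^^ n) \<phi> x) \<le> B" for n
        using Lnorm_iter_bound[of \<phi> B n] B by simp
      show "AE x in m. (\<lambda>n. (Lnorm ^^ n) \<phi> x) \<longlonglongrightarrow> integral\<^sup>L mu \<phi>" using Lnorm_tendsto[OF \<phi>] by simp
    qed auto
    then show "integral\<^sup>L m \<phi> = integral\<^sup>L mu \<phi>" unfolding I by (simp add: LIMSEQ_const_iff)
  qed
qed

lemma uniform_continuity:
  fixes \<phi> :: "circle \<Rightarrow> real"
  assumes "continuous_on UNIV \<phi>" "e > 0"
  shows "\<exists>d>0. \<forall>x y. dist x y < d \<longrightarrow> \<bar>\<phi> x - \<phi> y\<bar> < e"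
proof -
  have "uniformly_continuous_on UNIV \<phi>" by (intro compact_uniformly_continuous assms(1) compact_circle)
  then obtain d where "d > 0" "\<forall>x\<in>UNIV. \<forall>x'\<in>UNIV. dist x' x < d \<longrightarrow> dist (\<phi> x') (\<phi> x) < e"
    using assms(2) unfolding uniformly_continuous_on_def by blast
  then show ?thesis by (intro exI[of _ d]) (auto simp: dist_real_def)
qed

end

locale invariant_measure = transfer_cone V f \<Psi> + S: circle_system m "circle_map V"
  for V f \<Psi> and m :: "circle measure"
begin

lemma branch_simple: "simple_function m branch"
  by (rule S.simple_branch) (rule circle_factor_axioms)

lemma code_eq_iff: "S.code l branch x = S.code l branch y \<longleftrightarrow> (\<forall>j<l. branch ((T ^^ j) x) = branch ((T ^^ j) y))"
  by (auto simp: S.code_def)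

lemma branch_generating: "S.generating branch"
  unfolding S.generating_def code_eq_iff using branch_simple cylinders_small by blast

lemma integral_T:
  fixes \<phi> :: "circle \<Rightarrow> real"
  assumes "continuous_on UNIV \<phi>"
  shows "integral\<^sup>L m (\<lambda>x. \<phi> (T x)) = integral\<^sup>L m \<phi>"
proof -
  have "integral\<^sup>L (distr m m T) \<phi> = integral\<^sup>L m (\<lambda>x. \<phi> (T x))"
    using T_measurable borel_measurable_continuous_onI[OF assms] by (intro integral_distr) auto
  then show ?thesis by (simp add: S.T_inv)
qed

lemma integral_lg: "integral\<^sup>L m lg = integral\<^sup>L m f - ln \<rho>"
proof -
  have lh: "continuous_on UNIV (\<lambda>x. ln (h x))"
    using h_pos by (intro continuous_intros h_cont) (auto simp: less_imp_neq[symmetric])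
  have lhT: "continuous_on UNIV (\<lambda>x. ln (h (T x)))"
    by (rule continuous_on_compose2[OF lh T_cont]) auto
  show ?thesis
    unfolding lg_def using S.integrable_continuous[OF lh] S.integrable_continuous[OF lhT] S.integrable_continuous[OF f_cont]
      integral_T[OF lh] by simp
qed

definition centre :: "nat \<Rightarrow> nat list \<Rightarrow> circle" where
  "centre n c = (SOME z. S.code n branch z = c)"

lemma code_centre: "S.code n branch (centre n (S.code n branch z)) = S.code n branch z"
  unfolding centre_def by (rule someI[of _ z]) simp

text \<open>The conditional probabilities of the branches given the future are compared, cylinder by
  cylinder, with the normalised weights at a point of the cylinder.\<close>

definition joint :: "nat \<Rightarrow> circle \<Rightarrow> nat \<times> nat list" where
  "joint n x = (branch x, S.code n branch (T x))"

definition index :: "nat \<Rightarrow> (nat \<times> nat list) set" where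
  "index n = {..N} \<times> range (S.code n branch)"

definition actual :: "nat \<Rightarrow> nat \<times> nat list \<Rightarrow> real" where
  "actual n v = S.pr (joint n) v"

definition point :: "nat \<Rightarrow> nat \<times> nat list \<Rightarrow> circle" where
  "point n v = pre (fst v) (centre n (snd v))"

definition ideal :: "nat \<Rightarrow> nat \<times> nat list \<Rightarrow> real" where
  "ideal n v = S.pr (S.code n branch) (snd v) * exp (lg (point n v))"

lemma simple_code_branch: "simple_function m (S.code n branch)"
  by (rule S.simple_code[OF branch_simple])

lemma simple_joint: "simple_function m (joint n)"
  unfolding joint_def by (intro S.simple_Pair branch_simple S.simple_T simple_code_branch)

lemma finite_index: "finite (index n)"
  unfolding index_def using S.simple_finite[OF simple_code_branch] by simp

lemma range_joint: "range (joint n) \<subseteq> index n"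
  unfolding joint_def index_def using branch_le by auto

lemma expectation_joint:
  "integral\<^sup>L m (\<lambda>x. F (joint n x)) = (\<Sum>v\<in>index n. F v * actual n v)" for F :: "_ \<Rightarrow> real"
proof -
  have "S.pr (joint n) v = 0" if "v \<notin> range (joint n)" for v
  proof -
    have "joint n -` {v} = {}" using that by blast
    then show ?thesis by (simp add: S.pr_def)
  qed
  then show ?thesis
    unfolding S.expectation_simple[OF simple_joint] actual_def
    using finite_index range_joint by (intro sum.mono_neutral_left) auto
qed

lemma sum_index: "(\<Sum>v\<in>index n. F v) = (\<Sum>c\<in>range (S.code n branch). \<Sum>i\<le>N. F (i, c))" for F :: "_ \<Rightarrow> real"
  unfolding index_def by (subst sum.swap) (simp add: sum.cartesian_product)

lemma sum_ideal:
  "(\<Sum>v\<in>index n. ideal n v * \<phi> (point n v)) = integral\<^sup>L m (\<lambda>z. Lnorm \<phi> (centre n (S.code n branch z)))"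
proof -
  have "(\<Sum>v\<in>index n. ideal n v * \<phi> (point n v))
      = (\<Sum>c\<in>range (S.code n branch). Lnorm \<phi> (centre n c) * S.pr (S.code n branch) c)"
    unfolding sum_index by (intro sum.cong refl) (simp add: ideal_def point_def Lnorm_def sum_distrib_left mult_ac)
  then show ?thesis using S.expectation_simple[OF simple_code_branch, of "\<lambda>c. Lnorm \<phi> (centre n c)" n] by simp
qed

lemma sum_actual_1: "sum (actual n) (index n) = 1"
  using expectation_joint[of "\<lambda>_. 1" n] S.prob_UNIV by simp

lemma sum_ideal_1: "sum (ideal n) (index n) = 1"
  using sum_ideal[of n "\<lambda>_. 1"] S.prob_UNIV by (simp add: Lnorm_def Lnorm_one)

lemma actual_nonneg: "0 \<le> actual n v" by (simp add: actual_def S.pr_nonneg)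

lemma ideal_nonneg: "0 \<le> ideal n v" by (simp add: ideal_def S.pr_nonneg)

lemma pr_code_T: "S.pr (\<lambda>x. S.code n branch (T x)) c = S.pr (S.code n branch) c"
  using S.prob_vimage_T[OF S.simple_sets[OF simple_code_branch, of n "{c}"]]
  by (simp add: S.pr_def vimage_def)

lemma actual_le: "actual n (i, c) \<le> S.pr (S.code n branch) c"
  unfolding actual_def joint_def pr_code_T[symmetric]
  by (intro S.pr_pair_le S.simple_T simple_code_branch)

text \<open>With the weights sampled at the points of the cylinders the identity is exact; the sampling error
  is estimated in \<open>integral_near\<close>.\<close>

lemma incr_relative_entropy:
  "S.incr branch n + integral\<^sup>L m (\<lambda>x. lg (point n (joint n x)))
    = (\<Sum>v\<in>index n. actual n v * (ln (ideal n v) - ln (actual n v)))"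
proof -
  have 1: "S.incr branch n = S.ent (joint n) - S.ent (\<lambda>x. S.code n branch (T x))"
    unfolding S.incr_cond_ent[OF branch_simple] S.cond_ent_def joint_def ..
  have 2: "S.ent (joint n) = - (\<Sum>v\<in>index n. ln (actual n v) * actual n v)"
    unfolding S.ent_expectation[OF simple_joint] actual_def[symmetric]
    using expectation_joint[of "\<lambda>v. ln (actual n v)" n] by simp
  have 3: "S.ent (\<lambda>x. S.code n branch (T x)) = - (\<Sum>v\<in>index n. ln (S.pr (S.code n branch) (snd v)) * actual n v)"
    unfolding S.ent_expectation[OF S.simple_T[OF simple_code_branch]] pr_code_T
    using expectation_joint[of "\<lambda>v. ln (S.pr (S.code n branch) (snd v))" n] by (simp add: joint_def)
  have 4: "integral\<^sup>L m (\<lambda>x. lg (point n (joint n x))) = (\<Sum>v\<in>index n. lg (point n v) * actual n v)"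
    by (rule expectation_joint)
  have "S.incr branch n + integral\<^sup>L m (\<lambda>x. lg (point n (joint n x)))
    = (\<Sum>v\<in>index n. (ln (S.pr (S.code n branch) (snd v)) + lg (point n v) - ln (actual n v)) * actual n v)"
    unfolding 1 2 3 4 by (simp add: sum.distrib sum_subtractf ring_distribs)
  also have "\<dots> = (\<Sum>v\<in>index n. actual n v * (ln (ideal n v) - ln (actual n v)))"
  proof (intro sum.cong refl)
    fix v :: "nat \<times> nat list"
    obtain i c where v: "v = (i, c)" by (cases v)
    show "(ln (S.pr (S.code n branch) (snd v)) + lg (point n v) - ln (actual n v)) * actual n v
        = actual n v * (ln (ideal n v) - ln (actual n v))"
    proof (cases "actual n v = 0")
      case False
      then have "0 < S.pr (S.code n branch) (snd v)"
        using actual_le[of n i c] actual_nonneg[of n v] unfolding v by auto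
      then have "ln (ideal n v) = ln (S.pr (S.code n branch) (snd v)) + lg (point n v)"
        by (simp add: ideal_def ln_mult)
      then show ?thesis by (simp add: mult.commute)
    qed simp
  qed
  finally show ?thesis .
qed

lemma incr_hellinger:
  "S.incr branch n + integral\<^sup>L m (\<lambda>x. lg (point n (joint n x)))
    \<le> - (\<Sum>v\<in>index n. (sqrt (actual n v) - sqrt (ideal n v))\<^sup>2)"
  unfolding incr_relative_entropy
proof (rule relative_entropy_hellinger[OF finite_index actual_nonneg ideal_nonneg])
  fix v assume "0 < actual n v"
  obtain i c where v: "v = (i, c)" by (cases v)
  show "0 < ideal n v" using \<open>0 < actual n v\<close> actual_le[of n i c] by (simp add: ideal_def v)
qed (simp add: sum_actual_1 sum_ideal_1)

lemma integral_near:
  fixes \<phi> :: "circle \<Rightarrow> real" and s :: "circle \<Rightarrow> circle"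
  assumes \<phi>: "continuous_on UNIV \<phi>" and near: "\<And>x. \<bar>\<phi> (s x) - \<phi> x\<bar> \<le> e"
    and s: "s = (\<lambda>x. \<theta> (X x))" and X: "simple_function m X"
  shows "\<bar>integral\<^sup>L m (\<lambda>x. \<phi> (s x)) - integral\<^sup>L m \<phi>\<bar> \<le> e"
proof -
  have i1: "integrable m \<phi>" by (rule S.integrable_continuous[OF \<phi>])
  have sf: "simple_function m (\<lambda>x. \<phi> (s x))" unfolding s using S.simple_comp[OF X, of "\<lambda>v. \<phi> (\<theta> v)"] .
  obtain B where "0 < B" and B: "\<And>x. norm (\<phi> x) \<le> B"
    by (rule circle_bounded[OF \<phi>], rule that)
  have i2: "integrable m (\<lambda>x. \<phi> (s x))"
    by (rule S.integrable_const_bound[of _ B]) (use B borel_measurable_simple_function[OF sf] in auto)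
  have b: "\<phi> (s x) - \<phi> x \<le> e" "- e \<le> \<phi> (s x) - \<phi> x" for x using near[of x] by linarith+
  have "integral\<^sup>L m (\<lambda>x. \<phi> (s x) - \<phi> x) \<le> e" "- e \<le> integral\<^sup>L m (\<lambda>x. \<phi> (s x) - \<phi> x)"
    using b by (intro S.integral_le_const S.integral_ge_const Bochner_Integration.integrable_diff i1 i2; simp)+
  then show ?thesis using i1 i2 by (simp add: abs_le_iff)
qed

lemma point_joint_code: "S.code (Suc n) branch (point n (joint n x)) = S.code (Suc n) branch x"
  unfolding S.code_Suc point_def joint_def by (simp add: branch_pre branch_le code_centre)

lemma points_near:
  assumes "d > 0"
  shows "\<exists>n. \<forall>x. dist (point n (joint n x)) x < d \<and> dist (centre n (S.code n branch x)) x < d"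
proof -
  obtain l where l: "\<forall>x y. (\<forall>j<l. branch ((T ^^ j) x) = branch ((T ^^ j) y)) \<longrightarrow> dist x y < d"
    using cylinders_small[OF assms] by blast
  have "dist (point l (joint l x)) x < d" for x
    using l point_joint_code[of l x] unfolding code_eq_iff by auto
  moreover have "dist (centre l (S.code l branch x)) x < d" for x
    using l code_centre[of l x] unfolding code_eq_iff by auto
  ultimately show ?thesis by blast
qed

text \<open>The increments decrease to the entropy rate, so that one increment for a long cylinder suffices.\<close>

theorem entropy_le: "S.rate_ent branch + integral\<^sup>L m lg \<le> 0"
proof (rule field_le_epsilon)
  fix e :: real assume e: "e > 0"
  obtain d where d: "d > 0" "\<And>x y. dist x y < d \<Longrightarrow> \<bar>lg x - lg y\<bar> < e" using uniform_continuity[OF lg_cont e] by auto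
  obtain n where n: "\<And>x. dist (point n (joint n x)) x < d" using points_near[OF d(1)] by auto
  have "\<bar>integral\<^sup>L m (\<lambda>x. lg (point n (joint n x))) - integral\<^sup>L m lg\<bar> \<le> e"
    by (rule integral_near[OF lg_cont less_imp_le[OF d(2)[OF n]] refl simple_joint])
  moreover have "S.incr branch n + integral\<^sup>L m (\<lambda>x. lg (point n (joint n x))) \<le> 0"
    using incr_hellinger[of n] sum_nonneg[of "index n" "\<lambda>v. (sqrt (actual n v) - sqrt (ideal n v))\<^sup>2"] by simp
  ultimately show "S.rate_ent branch + integral\<^sup>L m lg \<le> 0 + e"
    using S.incr_tendsto(2)[OF branch_simple, of n] by linarith
qed

text \<open>In the case of equality the relative entropy for long cylinders is small. Then \<open>actual\<close> and \<open>ideal\<close>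
  are close in total variation; the first integrates \<open>\<phi>\<close> approximately like \<open>m\<close>, the second like
  \<open>m\<close> applied to \<open>Lnorm \<phi>\<close>.\<close>

theorem entropy_eq_imp_mu:
  assumes eq: "S.rate_ent branch + integral\<^sup>L m lg = 0"
  shows "m = mu"
proof (rule Lnorm_invariant_unique)
  show "circle_prob m" by (rule S.circle_prob_axioms)
  fix \<phi> :: "circle \<Rightarrow> real" assume \<phi>: "continuous_on UNIV \<phi>"
  have W: "continuous_on UNIV (Lnorm \<phi>)" by (rule Lnorm_continuous[OF \<phi>])
  obtain B where "B > 0" and "\<And>x. norm (\<phi> x) \<le> B"
    by (rule circle_bounded[OF \<phi>], rule that)
  then have B: "B > 0" "\<And>x. \<bar>\<phi> x\<bar> \<le> B" by simp_all
  have small: "\<bar>integral\<^sup>L m (Lnorm \<phi>) - integral\<^sup>L m \<phi>\<bar> \<le> \<delta>" if \<delta>: "\<delta> > 0" for \<delta>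
  proof -
    \<comment> \<open>The oscillation of \<open>lg\<close> has to be of second order, as the total variation is only
      controlled by the square root of the relative entropy.\<close>
    define t where "t = \<delta> / (4 * B)"
    define e where "e = t * t"
    have t: "t > 0" "e > 0" using \<delta> B by (auto simp: t_def e_def)
    obtain d1 where d1: "d1 > 0" "\<And>x y. dist x y < d1 \<Longrightarrow> \<bar>lg x - lg y\<bar> < e"
      using uniform_continuity[OF lg_cont t(2)] by auto
    obtain d2 where d2: "d2 > 0" "\<And>x y. dist x y < d2 \<Longrightarrow> \<bar>\<phi> x - \<phi> y\<bar> < \<delta> / 4"
      using uniform_continuity[OF \<phi>, of "\<delta> / 4"] \<delta> by auto
    obtain d3 where d3: "d3 > 0" "\<And>x y. dist x y < d3 \<Longrightarrow> \<bar>Lnorm \<phi> x - Lnorm \<phi> y\<bar> < \<delta> / 4"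
      using uniform_continuity[OF W, of "\<delta> / 4"] \<delta> by auto
    obtain n where n: "\<And>x. dist (point n (joint n x)) x < min d1 (min d2 d3)"
      "\<And>x. dist (centre n (S.code n branch x)) x < min d1 (min d2 d3)"
      using points_near[of "min d1 (min d2 d3)"] d1(1) d2(1) d3(1) by auto
    define Hd where "Hd = (\<Sum>v\<in>index n. (sqrt (actual n v) - sqrt (ideal n v))\<^sup>2)"
    have "\<bar>lg (point n (joint n x)) - lg x\<bar> \<le> e" for x using d1(2)[of "point n (joint n x)" x] n(1)[of x] by simp
    then have "\<bar>integral\<^sup>L m (\<lambda>x. lg (point n (joint n x))) - integral\<^sup>L m lg\<bar> \<le> e"
      by (rule integral_near[OF lg_cont _ refl simple_joint])
    then have Hd: "Hd \<le> e"
      using incr_hellinger[of n] S.incr_tendsto(2)[OF branch_simple, of n] eq unfolding Hd_def by linarith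
    have "(\<Sum>v\<in>index n. \<bar>actual n v - ideal n v\<bar>) \<le> Hd / t + t"
      unfolding Hd_def by (intro total_variation_hellinger actual_nonneg ideal_nonneg sum_actual_1 sum_ideal_1 t)
    also have "\<dots> \<le> 2 * t" using divide_right_mono[OF Hd less_imp_le[OF t(1)]] t by (simp add: e_def)
    finally have tv: "(\<Sum>v\<in>index n. \<bar>actual n v - ideal n v\<bar>) \<le> 2 * t" .
    have "\<bar>(\<Sum>v\<in>index n. \<phi> (point n v) * actual n v) - (\<Sum>v\<in>index n. ideal n v * \<phi> (point n v))\<bar>
        = \<bar>\<Sum>v\<in>index n. (actual n v - ideal n v) * \<phi> (point n v)\<bar>"
      by (simp add: sum_subtractf algebra_simps)
    also have "\<dots> \<le> (\<Sum>v\<in>index n. \<bar>actual n v - ideal n v\<bar> * B)"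
      using B by (intro order_trans[OF sum_abs] sum_mono) (simp add: abs_mult mult_left_mono)
    also have "\<dots> \<le> 2 * t * B" using tv B by (simp add: sum_distrib_right[symmetric])
    also have "\<dots> = \<delta> / 2" using B by (simp add: t_def)
    finally have 1: "\<bar>integral\<^sup>L m (\<lambda>x. \<phi> (point n (joint n x)))
        - integral\<^sup>L m (\<lambda>z. Lnorm \<phi> (centre n (S.code n branch z)))\<bar> \<le> \<delta> / 2"
      unfolding sum_ideal expectation_joint[of "\<lambda>v. \<phi> (point n v)" n] .
    have "\<bar>\<phi> (point n (joint n x)) - \<phi> x\<bar> \<le> \<delta> / 4" for x
      using d2(2)[of "point n (joint n x)" x] n(1)[of x] by simp
    then have 2: "\<bar>integral\<^sup>L m (\<lambda>x. \<phi> (point n (joint n x))) - integral\<^sup>L m \<phi>\<bar> \<le> \<delta> / 4"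
      by (rule integral_near[OF \<phi> _ refl simple_joint])
    have "\<bar>Lnorm \<phi> (centre n (S.code n branch x)) - Lnorm \<phi> x\<bar> \<le> \<delta> / 4" for x
      using d3(2)[of "centre n (S.code n branch x)" x] n(2)[of x] by simp
    then have 3: "\<bar>integral\<^sup>L m (\<lambda>z. Lnorm \<phi> (centre n (S.code n branch z))) - integral\<^sup>L m (Lnorm \<phi>)\<bar> \<le> \<delta> / 4"
      by (rule integral_near[OF W _ refl simple_code_branch])
    show ?thesis using 1 2 3 by linarith
  qed
  have "\<bar>integral\<^sup>L m (Lnorm \<phi>) - integral\<^sup>L m \<phi>\<bar> \<le> 0"
  proof (rule field_le_epsilon)
    fix e :: real assume "0 < e"
    then show "\<bar>integral\<^sup>L m (Lnorm \<phi>) - integral\<^sup>L m \<phi>\<bar> \<le> 0 + e" using small[of e] by simp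
  qed
  then show "integral\<^sup>L m (Lnorm \<phi>) = integral\<^sup>L m \<phi>" by simp
qed

lemma metric_entropy_branch: "metric_entropy m T = ereal (S.rate_ent branch)"
  by (rule S.metric_entropy_generating[OF branch_generating])

end

section \<open>The invariant measure is an equilibrium state\<close>

context transfer_cone
begin

lemma distortion_cylinder:
  assumes "\<forall>j<n. branch ((T ^^ j) x) = branch ((T ^^ j) y)"
  shows "birkhoff_sum T f n x \<le> birkhoff_sum T f n y + \<Psi> 1"
proof -
  define e where "e j = \<bar>crep ((T ^^ j) x) - crep ((T ^^ j) y)\<bar>" for j
  have e: "0 \<le> e j" "e j \<le> 1" for j
    using crep_bounds[of "(T ^^ j) x"] crep_bounds[of "(T ^^ j) y"] by (auto simp: e_def)
  have "birkhoff_sum T f k x - birkhoff_sum T f k y \<le> \<Psi> (e k)" if "k \<le> n" for k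
    using that
  proof (induction k)
    case 0
    show ?case using \<Psi>_nonneg[OF e] by (simp add: birkhoff_sum_def)
  next
    case (Suc k)
    define u v where "u = (T ^^ k) x" and "v = (T ^^ k) y"
    have b: "branch u = branch v" using assms Suc.prems by (simp add: u_def v_def)
    define a c where "a = crep (T u) + real (branch u)" and "c = crep (T v) + real (branch v)"
    have 1: "\<bar>a - c\<bar> = e (Suc k)" using b by (simp add: a_def c_def e_def u_def v_def)
    have 2: "H a = crep u" "H c = crep v" unfolding a_def c_def crep_eq_H[symmetric] by simp_all
    have 3: "br a = u" "br c = v" unfolding br_def 2 by simp_all
    have "\<bar>f u - f v\<bar> \<le> \<Psi> (e (Suc k)) - \<Psi> (e k)"
      using key[of a c] e(2)[of "Suc k"] unfolding 1 2 3 by (simp add: e_def u_def v_def)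
    then show ?case using Suc by (simp add: birkhoff_sum_def u_def v_def)
  qed
  from this[of n] show ?thesis using \<Psi>_mono[of "e n" 1] e[of n] by linarith
qed

lemma cylinder_inj:
  assumes "\<forall>j<n. branch ((T ^^ j) x) = branch ((T ^^ j) y)" "(T ^^ n) x = (T ^^ n) y"
  shows "x = y"
  using assms
proof (induction n arbitrary: x y)
  case (Suc n)
  have "T x = T y"
  proof (rule Suc.IH)
    show "\<forall>j<n. branch ((T ^^ j) (T x)) = branch ((T ^^ j) (T y))"
    proof (intro allI impI)
      fix j assume "j < n"
      then have "branch ((T ^^ Suc j) x) = branch ((T ^^ Suc j) y)" using Suc.prems(1) by blast
      then show "branch ((T ^^ j) (T x)) = branch ((T ^^ j) (T y))" by (simp add: funpow_swap1)
    qed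
    show "(T ^^ n) (T x) = (T ^^ n) (T y)" using Suc.prems(2) by (simp add: funpow_swap1)
  qed
  moreover have "branch x = branch y" using Suc.prems(1) by auto
  ultimately show ?case by (metis pre_branch)
qed simp

text \<open>As \<open>T\<^sup>n\<close> is injective on a cylinder, the \<open>n\<close>-th iterate of its indicator function is a sum with at
  most one term, which bounded distortion compares with the weight at \<open>x\<close>.\<close>

lemma mu_cylinder_le:
  assumes E: "E = {y. \<forall>j<n. branch ((T ^^ j) y) = branch ((T ^^ j) x)}" and B: "E \<in> sets borel"
  shows "measure mu E \<le> K * K * exp (birkhoff_sum T f n x - real n * ln \<rho>)"
proof -
  define s where "s = exp (birkhoff_sum T f n x + \<Psi> 1)"
  have up: "(L ^^ n) (indicator E) z \<le> s" for z
  proof -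
    have eq: "(L ^^ n) (indicator E) z = (\<Sum>y\<in>(T ^^ n) -` {z} \<inter> E. exp (birkhoff_sum T f n y))"
      unfolding L_iter_eq using finite_fibre_iter
      by (simp add: indicator_def if_distrib[of "\<lambda>a. _ * a"] sum.inter_restrict cong: if_cong)
    show ?thesis
    proof (cases "(T ^^ n) -` {z} \<inter> E = {}")
      case True
      show ?thesis unfolding eq True by (simp add: s_def)
    next
      case False
      then obtain y where y: "(T ^^ n) y = z" "y \<in> E" by auto
      have "y' = y" if "(T ^^ n) y' = z" "y' \<in> E" for y'
      proof (rule cylinder_inj[of n])
        show "\<forall>j<n. branch ((T ^^ j) y') = branch ((T ^^ j) y)" using that(2) y(2) by (simp add: E)
        show "(T ^^ n) y' = (T ^^ n) y" unfolding that(1) y(1) ..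
      qed
      then have "(T ^^ n) -` {z} \<inter> E = {y}" using y by blast
      moreover have "birkhoff_sum T f n y \<le> birkhoff_sum T f n x + \<Psi> 1"
        using y(2) by (intro distortion_cylinder) (simp add: E)
      ultimately show ?thesis unfolding eq by (simp add: s_def)
    qed
  qed
  have pos: "0 \<le> (L ^^ n) (indicator E) z" for z
    unfolding L_iter_eq by (intro sum_nonneg) (simp add: indicator_def)
  have m: "(L ^^ n) (indicator E) \<in> borel_measurable borel"
    by (intro L_iter_measurable borel_measurable_indicator B)
  have i: "integrable conf ((L ^^ n) (indicator E))"
    using up pos m by (intro nu.integrable_const_bound[of _ s]) auto
  have "\<rho> ^ n * measure conf E \<le> s"
    unfolding conf_iter_indicator[OF B, symmetric] using i up by (rule nu.integral_le_const)
  then have "measure conf E \<le> s / \<rho> ^ n" using \<rho>_pos by (simp add: field_simps)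
  then have "K * measure conf E \<le> K * (s / \<rho> ^ n)" using K_pos by (intro mult_left_mono) auto
  also have "\<dots> = K * K * exp (birkhoff_sum T f n x - real n * ln \<rho>)"
    using \<rho>_pos by (simp add: s_def K_def exp_add exp_diff exp_of_nat_mult)
  finally show ?thesis using mu_conf_bounds(1)[OF B] by linarith
qed

lemma circle_system_mu: "circle_system mu T"
  using mu_invariant T_measurable mu.circle_prob_axioms
  by (simp add: circle_system_def circle_system_axioms_def invariant_probs_def)

lemma invariant_measure_mu: "invariant_measure V f \<Psi> mu"
  by (intro invariant_measure.intro transfer_cone_axioms circle_system_mu)

end

context invariant_measure
begin

text \<open>The bound on the measure of cylinders is a lower bound on the information of each cylinder; its
  constants disappear after division by the length.\<close>

lemma entropy_mu_ge:
  assumes "m = mu"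
  shows "S.rate_ent branch + integral\<^sup>L m lg \<ge> 0"
proof -
  have fT: "integral\<^sup>L m (\<lambda>x. f ((T ^^ j) x)) = integral\<^sup>L m f \<and> continuous_on UNIV (\<lambda>x. f ((T ^^ j) x))" for j
  proof (induction j)
    case (Suc j)
    have "continuous_on UNIV (\<lambda>x. f ((T ^^ j) (T x)))"
      by (rule continuous_on_compose2[OF conjunct2[OF Suc] T_cont]) simp
    then show ?case using Suc integral_T[OF conjunct2[OF Suc]] by (simp add: funpow_swap1)
  qed (simp add: f_cont)
  have iS: "integrable m (birkhoff_sum T f n)" for n
    unfolding birkhoff_sum_def using fT by (intro Bochner_Integration.integrable_sum S.integrable_continuous) simp
  have IS: "integral\<^sup>L m (birkhoff_sum T f n) = real n * integral\<^sup>L m f" for n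
    unfolding birkhoff_sum_def using fT
    by (subst Bochner_Integration.integral_sum) (auto intro: S.integrable_continuous)
  have ent: "S.ent (S.code n branch) \<ge> real n * (ln \<rho> - integral\<^sup>L m f) - 3 * \<Psi> 1" for n
  proof -
    let ?Q = "S.code n branch"
    define g where "g c = birkhoff_sum T f n (centre n c)" for c
    have pt: "S.pr ?Q c * (real n * ln \<rho> - g c - 2 * \<Psi> 1) \<le> - (S.pr ?Q c * ln (S.pr ?Q c))"
      if c: "c \<in> range ?Q" for c
    proof (cases "S.pr ?Q c = 0")
      case False
      then have pos: "0 < S.pr ?Q c" using S.pr_nonneg[of ?Q c] by simp
      obtain z where z: "c = ?Q z" using c by auto
      have fib: "?Q -` {c} = {y. \<forall>j<n. branch ((T ^^ j) y) = branch ((T ^^ j) (centre n c))}"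
      proof -
        have "y \<in> ?Q -` {c} \<longleftrightarrow> ?Q y = ?Q (centre n c)" for y
          unfolding z code_centre by simp
        then show ?thesis unfolding code_eq_iff by auto
      qed
      have "measure m (?Q -` {c}) \<le> K * K * exp (birkhoff_sum T f n (centre n c) - real n * ln \<rho>)"
        using mu_cylinder_le[OF fib S.simple_sets[OF simple_code_branch]] by (simp only: assms)
      then have "S.pr ?Q c \<le> K * K * exp (g c - real n * ln \<rho>)"
        unfolding S.pr_def g_def .
      also have "\<dots> = exp (2 * \<Psi> 1 + g c - real n * ln \<rho>)"
        by (simp add: K_def exp_add[symmetric] algebra_simps)
      finally have "ln (S.pr ?Q c) \<le> 2 * \<Psi> 1 + g c - real n * ln \<rho>"
        using pos by (metis exp_gt_zero ln_exp ln_le_cancel_iff)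
      then have "S.pr ?Q c * (real n * ln \<rho> - g c - 2 * \<Psi> 1) \<le> S.pr ?Q c * (- ln (S.pr ?Q c))"
        using pos by (intro mult_left_mono) auto
      then show ?thesis by simp
    qed simp
    have g_le: "g (?Q x) \<le> birkhoff_sum T f n x + \<Psi> 1" for x
      unfolding g_def
    proof (rule distortion_cylinder)
      show "\<forall>j<n. branch ((T ^^ j) (centre n (?Q x))) = branch ((T ^^ j) x)"
        using code_centre[of n x] unfolding code_eq_iff .
    qed
    have sg: "simple_function m (\<lambda>x. g (?Q x))" by (rule S.simple_comp[OF simple_code_branch])
    have "integral\<^sup>L m (\<lambda>x. g (?Q x)) \<le> integral\<^sup>L m (\<lambda>x. birkhoff_sum T f n x + \<Psi> 1)"
    proof (rule integral_mono)
      have fin: "finite (range (\<lambda>x. g (?Q x)))" by (rule S.simple_finite[OF sg])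
      have "norm (g (?Q x)) \<le> Max (range (\<lambda>x. norm (g (?Q x))))" for x
      proof (rule Max_ge)
        have "range (\<lambda>x. norm (g (?Q x))) = norm ` range (\<lambda>x. g (?Q x))" by auto
        then show "finite (range (\<lambda>x. norm (g (?Q x))))" using fin by simp
      qed simp
      then show "integrable m (\<lambda>x. g (?Q x))"
        using borel_measurable_simple_function[OF sg] by (intro S.integrable_const_bound) auto
      show "integrable m (\<lambda>x. birkhoff_sum T f n x + \<Psi> 1)" using iS by simp
    qed (rule g_le)
    then have Ig: "integral\<^sup>L m (\<lambda>x. g (?Q x)) \<le> real n * integral\<^sup>L m f + \<Psi> 1"
      using iS S.prob_UNIV by (simp add: IS)
    have "real n * ln \<rho> - integral\<^sup>L m (\<lambda>x. g (?Q x)) - 2 * \<Psi> 1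
        = (\<Sum>c\<in>range ?Q. S.pr ?Q c * (real n * ln \<rho> - g c - 2 * \<Psi> 1))"
    proof -
      have "(\<Sum>c\<in>range ?Q. S.pr ?Q c * (real n * ln \<rho> - g c - 2 * \<Psi> 1))
          = (\<Sum>c\<in>range ?Q. S.pr ?Q c) * (real n * ln \<rho> - 2 * \<Psi> 1) - (\<Sum>c\<in>range ?Q. g c * S.pr ?Q c)"
      proof -
        have "S.pr ?Q c * (real n * ln \<rho> - g c - 2 * \<Psi> 1)
            = S.pr ?Q c * (real n * ln \<rho> - 2 * \<Psi> 1) - g c * S.pr ?Q c" for c
          by (simp add: algebra_simps)
        then show ?thesis by (simp only: sum_subtractf sum_distrib_right)
      qed
      then show ?thesis
        unfolding S.sum_pr[OF simple_code_branch] S.expectation_simple[OF simple_code_branch, of g n] by simp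
    qed
    also have "\<dots> \<le> S.ent ?Q"
      unfolding S.ent_def sum_negf[symmetric] by (rule sum_mono) (rule pt)
    finally show ?thesis using Ig by (simp add: algebra_simps)
  qed
  have "ln \<rho> - integral\<^sup>L m f \<le> S.rate_ent branch"
  proof (rule LIMSEQ_le[OF _ S.ent_code_rate[OF branch_simple]])
    show "(\<lambda>n. (ln \<rho> - integral\<^sup>L m f) - 3 * \<Psi> 1 / real n) \<longlonglongrightarrow> ln \<rho> - integral\<^sup>L m f"
      using tendsto_diff[OF tendsto_const lim_const_over_n[of "3 * \<Psi> 1"], of "ln \<rho> - integral\<^sup>L m f"]
      by simp
    have "(ln \<rho> - integral\<^sup>L m f) - 3 * \<Psi> 1 / real n \<le> S.ent (S.code n branch) / real n" if "n \<ge> 1" for n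
      using divide_right_mono[OF ent[of n], of "real n"] that by (simp add: diff_divide_distrib)
    then show "\<exists>N. \<forall>n\<ge>N. (ln \<rho> - integral\<^sup>L m f) - 3 * \<Psi> 1 / real n \<le> S.ent (S.code n branch) / real n"
      by blast
  qed
  then show ?thesis unfolding integral_lg by simp
qed

end

context transfer_cone
begin

theorem variational_principle:
  shows "metric_entropy mu T + ereal (integral\<^sup>L mu f) = ereal (ln \<rho>)"
    and "ereal (ln \<rho>) = pressure T f"
    and "m \<in> invariant_probs T \<Longrightarrow> m \<noteq> mu \<Longrightarrow> metric_entropy m T + ereal (integral\<^sup>L m f) < ereal (ln \<rho>)"
proof -
  have inv: "invariant_measure V f \<Psi> m" if "m \<in> invariant_probs T" for m
    using that T_measurable transfer_cone_axioms
    by (auto simp: invariant_measure_def invariant_probs_def circle_system_def circle_system_axioms_def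
      circle_prob_def circle_prob_axioms_def)
  have le: "metric_entropy m T + ereal (integral\<^sup>L m f) \<le> ereal (ln \<rho>)" if "m \<in> invariant_probs T" for m
  proof -
    interpret E: invariant_measure V f \<Psi> m by (rule inv[OF that])
    show ?thesis unfolding E.metric_entropy_branch using E.entropy_le unfolding E.integral_lg by simp
  qed
  show less: "metric_entropy m T + ereal (integral\<^sup>L m f) < ereal (ln \<rho>)" if "m \<in> invariant_probs T" "m \<noteq> mu" for m
  proof -
    interpret E: invariant_measure V f \<Psi> m by (rule inv[OF that(1)])
    show ?thesis
      unfolding E.metric_entropy_branch
      using E.entropy_le E.entropy_eq_imp_mu that(2) unfolding E.integral_lg by fastforce
  qed
  show eq: "metric_entropy mu T + ereal (integral\<^sup>L mu f) = ereal (ln \<rho>)"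
  proof -
    interpret E: invariant_measure V f \<Psi> mu by (rule invariant_measure_mu)
    show ?thesis
      unfolding E.metric_entropy_branch using E.entropy_le E.entropy_mu_ge[OF refl] unfolding E.integral_lg by simp
  qed
  show "ereal (ln \<rho>) = pressure T f"
    unfolding pressure_def
  proof (rule antisym)
    show "ereal (ln \<rho>) \<le> (SUP m\<in>invariant_probs T. metric_entropy m T + ereal (integral\<^sup>L m f))"
      unfolding eq[symmetric] using mu_invariant by (intro SUP_upper)
    show "(SUP m\<in>invariant_probs T. metric_entropy m T + ereal (integral\<^sup>L m f)) \<le> ereal (ln \<rho>)"
      using le by (intro SUP_least)
  qed
qed

end

section \<open>The gauge adapted to the iterated logarithms\<close>

text \<open>With this scale \<open>ln (ln (gauge_scale / d)) \<ge> 1\<close> for \<open>0 < d \<le> 1\<close>, so that the gauge is usable on all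
  distances and not only near 0.\<close>

definition gauge_scale :: real where "gauge_scale = exp (exp 1)"

text \<open>The value at 0 is 0, by the conventions for division by zero and for the logarithm of 0.\<close>

definition log_gauge :: "real \<Rightarrow> real" where "log_gauge d = 1 / ln (ln (gauge_scale / d))"

lemma gauge_0: "log_gauge 0 = 0"
  by (simp add: log_gauge_def)

lemma ln_scale: "0 < d \<Longrightarrow> ln (gauge_scale / d) = exp 1 - ln d"
  by (simp add: gauge_scale_def ln_div)

lemma ln_scale_ge: "0 < d \<Longrightarrow> d \<le> 1 \<Longrightarrow> exp 1 \<le> ln (gauge_scale / d)"
  by (simp add: ln_scale)

lemma ln_ln_scale_ge:
  assumes "0 < d" "d \<le> 1"
  shows "1 \<le> ln (ln (gauge_scale / d))"
proof -
  have "ln (exp 1) \<le> ln (ln (gauge_scale / d))"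
    using ln_scale_ge[OF assms] by (intro ln_mono) (auto intro: less_le_trans[OF exp_gt_zero])
  then show ?thesis by simp
qed

lemma gauge_mono:
  assumes "0 \<le> x" "x \<le> y" "y \<le> 1"
  shows "log_gauge x \<le> log_gauge y"
proof (cases "x = 0")
  case True
  show ?thesis
  proof (cases "y = 0")
    case False
    then show ?thesis using ln_ln_scale_ge[of y] assms by (simp add: True log_gauge_def)
  qed (simp add: True)
next
  case False
  then have x: "0 < x" "x \<le> 1" "0 < y" using assms by auto
  have p: "0 < ln (gauge_scale / y)" "0 < ln (gauge_scale / x)"
    using ln_scale_ge[of y] ln_scale_ge[of x] x assms less_le_trans[OF exp_gt_zero] by blast+
  have "ln (gauge_scale / y) \<le> ln (gauge_scale / x)" using x assms by (simp add: ln_scale ln_mono)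
  then have "ln (ln (gauge_scale / y)) \<le> ln (ln (gauge_scale / x))" using p by (subst ln_le_cancel_iff)
  then show ?thesis unfolding log_gauge_def using ln_ln_scale_ge[of y] x assms by (intro divide_left_mono) (auto intro!: mult_pos_pos)
qed

lemma gauge_tendsto: "(log_gauge \<longlongrightarrow> 0) (at_right 0)"
  unfolding log_gauge_def gauge_scale_def by real_asymp

lemma gauge_linear:
  assumes "0 \<le> x" "x \<le> 1"
  shows "x \<le> gauge_scale * log_gauge x"
proof (cases "x = 0")
  case False
  then have x: "0 < x" using assms by simp
  have s: "0 < gauge_scale" by (simp add: gauge_scale_def)
  have p: "0 < ln (gauge_scale / x)" using ln_scale_ge[of x] x assms less_le_trans[OF exp_gt_zero] by blast
  have "ln (ln (gauge_scale / x)) \<le> ln (gauge_scale / x)" using ln_le_minus_one[OF p] by linarith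
  also have "\<dots> \<le> gauge_scale / x" using ln_le_minus_one[of "gauge_scale / x"] x s by simp
  finally have "x * ln (ln (gauge_scale / x)) \<le> gauge_scale" using x by (simp add: field_simps)
  then show ?thesis using ln_ln_scale_ge[of x] x assms by (simp add: log_gauge_def field_simps)
qed (simp add: gauge_0)

text \<open>In the variable \<open>- ln d\<close> the gauge is convex, so its increment over one step of the map is
  at least the step in this variable times the derivative.\<close>

lemma gauge_increment:
  fixes D d w M :: real
  assumes D: "0 < D" and w: "0 \<le> w" "1 + w \<le> M" and d: "D * (1 + w) \<le> d" "d \<le> 1"
  defines "u \<equiv> ln (gauge_scale / D)"
  shows "w / (M * (u * (ln u)\<^sup>2)) \<le> log_gauge d - log_gauge D"
proof -
  define u0 where "u0 = ln (gauge_scale / d)"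
  have "D * 1 \<le> D * (1 + w)" using D w by (intro mult_left_mono) auto
  then have D1: "D \<le> d" "D \<le> 1" "0 < d" using D d by linarith+
  have e: "exp 1 \<le> u0" "exp 1 \<le> u" using ln_scale_ge D D1 d by (auto simp: u0_def u_def)
  then have up: "0 < u0" "0 < u" using less_le_trans[OF exp_gt_zero] by blast+
  have v: "1 \<le> ln u0" "1 \<le> ln u" using ln_ln_scale_ge D D1 d by (auto simp: u0_def u_def)
  have "ln D + ln (1 + w) = ln (D * (1 + w))" using D w by (subst ln_mult) auto
  also have "\<dots> \<le> ln d" using D w d by (intro ln_mono) auto
  finally have s: "ln (1 + w) \<le> u - u0" using D D1 by (simp add: u_def u0_def ln_scale)
  have lw: "w / M \<le> ln (1 + w)"
  proof -
    have "ln (1 / (1 + w)) \<le> 1 / (1 + w) - 1" using w by (intro ln_le_minus_one) simp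
    then have "1 - 1 / (1 + w) \<le> ln (1 + w)" using w by (simp add: ln_div)
    moreover have "1 - 1 / (1 + w) = w / (1 + w)" using w by (simp add: field_simps)
    moreover have "w / M \<le> w / (1 + w)" using w by (intro divide_left_mono) auto
    ultimately show ?thesis by linarith
  qed
  have u0u: "u0 \<le> u" using s lw w by (smt (verit) divide_nonneg_nonneg)
  have "ln (u0 / u) \<le> u0 / u - 1" using up by (intro ln_le_minus_one) simp
  then have "(u - u0) / u \<le> ln u - ln u0" using up by (simp add: ln_div diff_divide_distrib)
  moreover have "(w / M) / u \<le> (u - u0) / u" using s lw up by (intro divide_right_mono) auto
  ultimately have dv: "w / M / u \<le> ln u - ln u0" by linarith
  have "w / (M * (u * (ln u)\<^sup>2)) = (w / M / u) / (ln u)\<^sup>2" by simp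
  also have "\<dots> \<le> (ln u - ln u0) / (ln u)\<^sup>2" using dv by (intro divide_right_mono) auto
  also have "\<dots> \<le> (ln u - ln u0) / (ln u0 * ln u)"
  proof (rule divide_left_mono)
    have "ln u0 \<le> ln u" using u0u up by (intro ln_mono)
    then show "ln u0 * ln u \<le> (ln u)\<^sup>2" using v by (simp add: power2_eq_square mult_right_mono)
    show "0 \<le> ln u - ln u0" using \<open>ln u0 \<le> ln u\<close> by simp
    show "0 < (ln u)\<^sup>2 * (ln u0 * ln u)" using v by (intro mult_pos_pos zero_less_power) auto
  qed
  also have "\<dots> = 1 / ln u0 - 1 / ln u" using v by (simp add: field_simps)
  also have "\<dots> = log_gauge d - log_gauge D" by (simp add: log_gauge_def u_def u0_def)
  finally show ?thesis .
qed

section \<open>Comparison of the moduli\<close>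

lemma iter_log_Suc: "iter_log (Suc k) x = ln (iter_log k x)"
  by (simp add: iter_log_def)

lemma iter_log_2: "iter_log 2 x = ln (ln x)"
  by (simp add: iter_log_def numeral_2_eq_2)

lemma iter_log_at_top: "filterlim (iter_log k) at_top at_top"
proof (induction k)
  case 0
  show ?case by (simp add: iter_log_def id_def filterlim_ident)
next
  case (Suc k)
  have "filterlim (\<lambda>x. ln (iter_log k x)) at_top at_top"
    by (rule filterlim_compose[OF ln_at_top Suc])
  then show ?case by (simp add: iter_log_Suc[abs_def])
qed

lemma iter_log_double: "\<forall>\<^sub>F x in at_top. iter_log k (2 * x) \<le> 2 * iter_log k x"
proof (induction k)
  case 0
  show ?case by (simp add: iter_log_def)
next
  case (Suc k)
  have dbl: "filterlim (\<lambda>x::real. 2 * x) at_top at_top" by real_asymp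
  have 1: "\<forall>\<^sub>F x in at_top. 0 < iter_log k (2 * x)"
    using filterlim_compose[OF iter_log_at_top dbl] by (simp add: filterlim_at_top_dense)
  have 2: "\<forall>\<^sub>F x in at_top. 0 < iter_log k x"
    using iter_log_at_top[of k] by (simp add: filterlim_at_top_dense)
  have 3: "\<forall>\<^sub>F x in at_top. ln 2 \<le> iter_log (Suc k) x"
    using iter_log_at_top[of "Suc k"] by (simp add: filterlim_at_top)
  show ?case
    using Suc 1 2 3
  proof eventually_elim
    case (elim x)
    have "ln (iter_log k (2 * x)) \<le> ln (2 * iter_log k x)" using elim by (intro ln_mono) auto
    also have "\<dots> = ln 2 + ln (iter_log k x)" using elim by (subst ln_mult) auto
    finally show ?case using elim(4) by (simp add: iter_log_Suc)
  qed
qed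

lemma eventually_inverse_right:
  assumes "\<forall>\<^sub>F x in at_top. P (x :: real)"
  shows "\<forall>\<^sub>F x in at_right 0. P (1 / x)"
proof -
  have "filterlim (\<lambda>x::real. 1 / x) at_top (at_right 0)" by real_asymp
  then show ?thesis using assms unfolding filterlim_iff by blast
qed

lemma eventually_at_right_interval:
  assumes "\<forall>\<^sub>F x in at_right 0. P (x :: real)"
  obtains e where "0 < e" "e \<le> 1" "\<And>x. 0 < x \<Longrightarrow> x \<le> e \<Longrightarrow> P x"
proof -
  obtain d where d: "d > 0" "\<And>x. 0 < x \<Longrightarrow> x < d \<Longrightarrow> P x"
    using assms unfolding eventually_at_right_field by auto
  have "P x" if "0 < x" "x \<le> min (d / 2) 1" for x using d that by auto
  then show ?thesis using d(1) that[of "min (d / 2) 1"] by auto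
qed

lemma moduliD:
  assumes "\<omega> \<in> concave_moduli"
  shows "0 \<le> x \<Longrightarrow> 0 \<le> \<omega> x" "0 \<le> x \<Longrightarrow> x \<le> y \<Longrightarrow> \<omega> x \<le> \<omega> y" "\<omega> 0 = 0" "continuous_on {0..} \<omega>"
  using assms unfolding concave_moduli_def mono_on_def by auto

text \<open>Near 0 the iterated logarithms of \<open>1 / D\<close>, \<open>2 / D\<close> and \<open>gauge_scale / D\<close> agree up to factors 2; these
  account for the constant \<open>32 / A\<close>. Away from 0 both sides lie between positive constants.\<close>

lemma (in circle_factor) potential_modulus_bound:
  assumes \<omega>: "\<omega> \<in> concave_moduli" and A: "A > 0"
    and V_eq: "\<forall>\<^sub>F x in at_right 0. V x = A * inverse (iter_log k (1 / x))"
    and \<omega>_eq: "\<forall>\<^sub>F x in at_right 0. \<omega> x =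
           inverse (iter_log k (1 / x)) * inverse (ln (1 / x)) * inverse ((iter_log 2 (1 / x))\<^sup>2)"
  shows "\<exists>C>0. \<forall>D. 0 < D \<longrightarrow> D \<le> 1 \<longrightarrow>
    \<omega> D \<le> C * (rate D / (ln (gauge_scale / D) * (ln (ln (gauge_scale / D)))\<^sup>2))"
proof -
  have half: "filterlim (\<lambda>x::real. x / 2) (at_right 0) (at_right 0)" by real_asymp
  have dbl: "filterlim (\<lambda>x::real. 2 * x) at_top at_top" by real_asymp
  have V_half: "\<forall>\<^sub>F x in at_right 0. V (x / 2) = A * inverse (iter_log k (1 / (x / 2)))"
    using half V_eq unfolding filterlim_iff by blast
  have l1: "\<forall>\<^sub>F x in at_right 0. iter_log k (2 * (1 / x)) \<le> 2 * iter_log k (1 / x)"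
    by (rule eventually_inverse_right[OF iter_log_double])
  have "\<forall>\<^sub>F x in at_top. 0 < iter_log k (2 * x)"
    using filterlim_compose[OF iter_log_at_top dbl] by (simp add: filterlim_at_top_dense)
  then have l2: "\<forall>\<^sub>F x in at_right 0. 0 < iter_log k (2 * (1 / x))" by (rule eventually_inverse_right)
  have l4: "\<forall>\<^sub>F x in at_right 0. ln (gauge_scale / x) \<le> 2 * ln (1 / x)"
    unfolding gauge_scale_def by real_asymp
  have l5: "\<forall>\<^sub>F x in at_right 0. ln (ln (gauge_scale / x)) \<le> 2 * ln (ln (1 / x))"
    unfolding gauge_scale_def by real_asymp
  have near: "\<forall>\<^sub>F x in at_right 0. \<omega> x \<le> 32 / A * (rate x / (ln (gauge_scale / x) * (ln (ln (gauge_scale / x)))\<^sup>2))"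
    using V_half \<omega>_eq l1 l2 l4 l5 eventually_at_right_real[OF zero_less_one]
  proof eventually_elim
    case (elim x)
    then have x: "0 < x" "x < 1" by auto
    define X X2 p q u v where "X = iter_log k (1 / x)" and "X2 = iter_log k (2 * (1 / x))" and "p = ln (1 / x)"
      and "q = ln (ln (1 / x))" and "u = ln (gauge_scale / x)" and "v = ln (ln (gauge_scale / x))"
    have uv: "1 \<le> u" "1 \<le> v"
      using ln_scale_ge[of x] ln_ln_scale_ge[of x] x exp_ge_add_one_self[of 1] by (auto simp: u_def v_def)
    have b: "X2 \<le> 2 * X" "0 < X2" "u \<le> 2 * p" "v \<le> 2 * q"
      using elim by (auto simp: X_def X2_def u_def v_def p_def q_def)
    then have pos: "0 < X" "0 < p" "0 < q" using uv by linarith+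
    have "v\<^sup>2 \<le> (2 * q)\<^sup>2" using b uv by (intro power_mono) auto
    then have "X2 * (u * v\<^sup>2) \<le> (2 * X) * ((2 * p) * (2 * q)\<^sup>2)"
      using b uv pos by (intro mult_mono) auto
    also have "\<dots> = 16 * (X * (p * q\<^sup>2))" by (simp add: power2_eq_square)
    finally have le: "X2 * (u * v\<^sup>2) \<le> 16 * (X * (p * q\<^sup>2))" .
    have P: "0 < X2 * (u * v\<^sup>2)" "0 < X * (p * q\<^sup>2)" using b uv pos by (auto intro!: mult_pos_pos)
    have "\<omega> x = 1 / (X * (p * q\<^sup>2))"
      using elim(2) by (simp add: X_def p_def q_def iter_log_2 field_simps)
    also have "\<dots> \<le> 16 / (X2 * (u * v\<^sup>2))" using le P by (simp add: field_simps)
    also have "\<dots> = 32 / A * ((A / X2) / 2 / (u * v\<^sup>2))" using A b uv by (simp add: field_simps)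
    also have "(A / X2) / 2 = rate x"
      using elim(1) by (simp add: rate_def X2_def field_simps)
    finally show ?case by (simp add: u_def v_def)
  qed
  obtain e where e: "0 < e" "e \<le> 1" "\<And>x. 0 < x \<Longrightarrow> x \<le> e \<Longrightarrow>
      \<omega> x \<le> 32 / A * (rate x / (ln (gauge_scale / x) * (ln (ln (gauge_scale / x)))\<^sup>2))"
    by (rule eventually_at_right_interval[OF near], rule that)
  define B where "B = ln (gauge_scale / e) * (ln (ln (gauge_scale / e)))\<^sup>2"
  define C where "C = max (32 / A) (\<omega> 1 * B / rate e)"
  have far: "\<omega> x \<le> \<omega> 1 * B / rate e * (rate x / (ln (gauge_scale / x) * (ln (ln (gauge_scale / x)))\<^sup>2))"
    if x: "e \<le> x" "x \<le> 1" for x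
  proof -
    define u where "u = ln (gauge_scale / x)"
    have x0: "0 < x" using e x by linarith
    have "exp 1 \<le> u" unfolding u_def by (rule ln_scale_ge[OF x0 x(2)])
    then have "0 < u" by (rule less_le_trans[OF exp_gt_zero])
    moreover have "1 \<le> ln u" unfolding u_def by (rule ln_ln_scale_ge[OF x0 x(2)])
    moreover have "u \<le> ln (gauge_scale / e)" using x x0 e by (simp add: u_def ln_scale)
    ultimately have u: "0 < u" "1 \<le> ln u" "u \<le> ln (gauge_scale / e)" by blast+
    have "ln u \<le> ln (ln (gauge_scale / e))" using u by (intro ln_mono) auto
    then have uB: "u * (ln u)\<^sup>2 \<le> B" unfolding B_def using u by (intro mult_mono power_mono; (linarith | simp))
    have pos: "0 < u * (ln u)\<^sup>2" using u by (intro mult_pos_pos zero_less_power; linarith)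
    have re: "0 < rate e" "rate e \<le> rate x" using rate_pos rate_mono e x by auto
    have "1 * 1 \<le> (rate x / rate e) * (B / (u * (ln u)\<^sup>2))"
      using re uB pos by (intro mult_mono) auto
    then have "\<omega> 1 * 1 \<le> \<omega> 1 * ((rate x / rate e) * (B / (u * (ln u)\<^sup>2)))"
      using moduliD(1)[OF \<omega>, of 1] by (intro mult_left_mono) auto
    moreover have "\<omega> x \<le> \<omega> 1" using moduliD(2)[OF \<omega>] x x0 by simp
    ultimately show ?thesis by (simp add: u_def mult_ac)
  qed
  have main: "\<omega> D \<le> C * (rate D / (ln (gauge_scale / D) * (ln (ln (gauge_scale / D)))\<^sup>2))" if D: "0 < D" "D \<le> 1" for D
  proof -
    define r where "r = rate D / (ln (gauge_scale / D) * (ln (ln (gauge_scale / D)))\<^sup>2)"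
    have r: "0 \<le> r" unfolding r_def
      using rate_nonneg[of D] ln_scale_ge[OF D] D less_imp_le[OF less_le_trans[OF exp_gt_zero]]
      by (intro divide_nonneg_nonneg mult_nonneg_nonneg) auto
    have "32 / A * r \<le> C * r" "\<omega> 1 * B / rate e * r \<le> C * r"
      using r by (intro mult_right_mono; simp add: C_def)+
    then show ?thesis using e(3)[of D] far[of D] D unfolding r_def[symmetric] by (cases "D \<le> e") auto
  qed
  moreover have "C > 0" using A by (simp add: C_def less_max_iff_disj)
  ultimately show ?thesis by blast
qed

lemma eigenfunction_modulus_bound:
  assumes \<Omega>: "\<Omega> \<in> concave_moduli"
    and \<Omega>_eq: "\<forall>\<^sub>F x in at_right 0. \<Omega> x = inverse (iter_log 2 (1 / x))"
  shows "\<exists>C>0. \<forall>d. 0 \<le> d \<longrightarrow> d \<le> 1 \<longrightarrow> log_gauge d \<le> C * \<Omega> d"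
proof -
  have l: "\<forall>\<^sub>F x in at_right 0. 0 < ln (ln (1 / x)) \<and> ln (ln (1 / x)) \<le> ln (ln (gauge_scale / x))"
    unfolding gauge_scale_def by (intro eventually_conj; real_asymp)
  have near: "\<forall>\<^sub>F x in at_right 0. log_gauge x \<le> \<Omega> x \<and> 0 < \<Omega> x"
    using \<Omega>_eq l
  proof eventually_elim
    case (elim x)
    then show ?case by (simp add: log_gauge_def iter_log_2 inverse_eq_divide frac_le)
  qed
  obtain e where e: "0 < e" "e \<le> 1" "\<And>x. 0 < x \<Longrightarrow> x \<le> e \<Longrightarrow> log_gauge x \<le> \<Omega> x \<and> 0 < \<Omega> x"
    by (rule eventually_at_right_interval[OF near], rule that)
  define C where "C = max 1 (log_gauge 1 / \<Omega> e)"
  have \<Omega>e: "0 < \<Omega> e" using e by auto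
  have "log_gauge d \<le> C * \<Omega> d" if d: "0 \<le> d" "d \<le> 1" for d
  proof -
    consider "d = 0" | "0 < d" "d \<le> e" | "e < d" using d by linarith
    then show ?thesis
    proof cases
      case 1
      then show ?thesis by (simp add: gauge_0 moduliD(3)[OF \<Omega>])
    next
      case 2
      have "1 * \<Omega> d \<le> C * \<Omega> d" using e(3)[of d] 2 by (intro mult_right_mono) (auto simp: C_def)
      then show ?thesis using e(3)[OF 2] by linarith
    next
      case 3
      have "log_gauge d \<le> log_gauge 1" using d by (intro gauge_mono) auto
      also have "\<dots> = log_gauge 1 / \<Omega> e * \<Omega> e" using \<Omega>e by simp
      also have "\<dots> \<le> C * \<Omega> d"
        using moduliD(2)[OF \<Omega>, of e d] 3 e(1) less_imp_le[OF \<Omega>e] by (intro mult_mono) (simp_all add: C_def)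
      finally show ?thesis .
    qed
  qed
  moreover have "C > 0" by (simp add: C_def)
  ultimately show ?thesis by blast
qed

lemma modulus_space_continuous:
  assumes \<Omega>: "\<Omega> \<in> concave_moduli" and \<phi>: "\<phi> \<in> modulus_space \<Omega>"
  shows "continuous_on UNIV \<phi>"
  unfolding continuous_on_iff
proof (intro ballI allI impI)
  fix x and e :: real assume e: "e > 0"
  obtain C where C: "C > 0" "\<And>x y. \<bar>\<phi> x - \<phi> y\<bar> \<le> C * \<Omega> (dist x y)"
    using \<phi> unfolding modulus_space_def by auto
  obtain d where d: "d > 0" "\<And>t. t \<in> {0..} \<Longrightarrow> dist t 0 < d \<Longrightarrow> dist (\<Omega> t) (\<Omega> 0) < e / C"
    using moduliD(4)[OF \<Omega>] e C(1) unfolding continuous_on_iff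
    by (metis atLeast_iff divide_pos_pos order_refl)
  have "dist (\<phi> y) (\<phi> x) < e" if y: "dist y x < d" for y
  proof -
    have "\<Omega> (dist y x) < e / C"
      using d(2)[of "dist y x"] y moduliD(3)[OF \<Omega>] by (simp add: dist_real_def)
    then have "C * \<Omega> (dist y x) < e" using C(1) by (simp add: field_simps)
    then show ?thesis using C(2)[of y x] by (simp add: dist_real_def)
  qed
  then show "\<exists>d>0. \<forall>x'\<in>UNIV. dist x' x < d \<longrightarrow> dist (\<phi> x') (\<phi> x) < e" using d(1) by blast
qed

text \<open>The lower bound on the gain of the gauge in one step meets the upper bound for \<open>\<omega>\<close>.\<close>

lemma transfer_coneI:
  fixes V :: "real \<Rightarrow> real" and f :: "circle \<Rightarrow> real"
  assumes fam: "in_family (circle_map V) V" and A: "A > 0"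
    and V_eq: "\<forall>\<^sub>F x in at_right 0. V x = A * inverse (iter_log k (1 / x))"
    and \<omega>: "\<omega> \<in> concave_moduli"
    and \<omega>_eq: "\<forall>\<^sub>F x in at_right 0. \<omega> x =
           inverse (iter_log k (1 / x)) * inverse (ln (1 / x)) * inverse ((iter_log 2 (1 / x))\<^sup>2)"
    and f_cont: "continuous_on UNIV f" and f: "f \<in> modulus_space \<omega>"
  shows "\<exists>C>0. transfer_cone V f (\<lambda>d. C * log_gauge d)"
proof -
  interpret circle_factor V using fam by unfold_locales (simp add: in_family_def)
  obtain Cf where Cf: "Cf > 0" "\<And>x y. \<bar>f x - f y\<bar> \<le> Cf * \<omega> (dist x y)"
    using f unfolding modulus_space_def by auto
  obtain C1 where C1: "C1 > 0" "\<And>D. 0 < D \<Longrightarrow> D \<le> 1 \<Longrightarrow>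
    \<omega> D \<le> C1 * (rate D / (ln (gauge_scale / D) * (ln (ln (gauge_scale / D)))\<^sup>2))"
    using potential_modulus_bound[OF \<omega> A V_eq \<omega>_eq] by auto
  define M where "M = 1 + rate 1"
  have M: "0 < M" using rate_nonneg[of 1] by (simp add: M_def)
  define C where "C = Cf * (C1 * M)"
  have C: "C > 0" using Cf C1 M by (simp add: C_def)
  have "transfer_cone V f (\<lambda>d. C * log_gauge d)"
  proof
    show "continuous_on UNIV T" using fam by (simp add: in_family_def)
    show "continuous_on UNIV f" by (rule f_cont)
    show "C * log_gauge x \<le> C * log_gauge y" if "0 \<le> x" "x \<le> y" "y \<le> 1" for x y
      using gauge_mono[OF that] C by simp
    show "C * log_gauge 0 = 0" by (simp add: gauge_0)
    show "\<exists>d>0. \<forall>x\<ge>0. x < d \<longrightarrow> C * log_gauge x < e" if "e > 0" for e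
    proof -
      have near: "\<forall>\<^sub>F x in at_right 0. log_gauge x < e / C"
        using gauge_tendsto by (rule order_tendstoD) (use that C in simp)
      obtain d where d: "0 < d" "\<And>x. 0 < x \<Longrightarrow> x \<le> d \<Longrightarrow> log_gauge x < e / C"
        by (rule eventually_at_right_interval[OF near], rule that)
      have "C * log_gauge x < e" if "0 \<le> x" "x < d" for x
        using d(2)[of x] that C \<open>e > 0\<close> by (cases "x = 0") (auto simp: gauge_0 field_simps)
      then show ?thesis using d(1) by blast
    qed
    show "\<exists>c>0. \<forall>x\<in>{0..1}. x \<le> c * (C * log_gauge x)"
    proof (intro exI[of _ "gauge_scale / C"] conjI ballI)
      show "0 < gauge_scale / C" using C by (simp add: gauge_scale_def)
      show "x \<le> gauge_scale / C * (C * log_gauge x)" if "x \<in> {0..1}" for x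
        using gauge_linear[of x] that C by simp
    qed
    show "\<bar>f (br a) - f (br b)\<bar> \<le> C * log_gauge \<bar>a - b\<bar> - C * log_gauge \<bar>H a - H b\<bar>" if ab: "\<bar>a - b\<bar> \<le> 1" for a b
    proof -
      define D where "D = \<bar>H a - H b\<bar>"
      have D: "0 \<le> D" "D \<le> 1" "D * (1 + rate D) \<le> \<bar>a - b\<bar>" "D \<le> \<bar>a - b\<bar>"
        using H_contract[OF ab] by (auto simp: D_def)
      show ?thesis
      proof (cases "D = 0")
        case True
        then have "br a = br b" by (simp add: D_def br_def)
        then show ?thesis using True gauge_mono[of D "\<bar>a - b\<bar>"] D ab C by (simp add: D_def)
      next
        case False
        then have D0: "0 < D" using D by simp
        have "\<bar>f (br a) - f (br b)\<bar> \<le> Cf * \<omega> (dist (br a) (br b))" by (rule Cf)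
        also have "\<dots> \<le> Cf * \<omega> D"
          using dist_to_circle_le[of "H a" "H b"] Cf(1) moduliD(2)[OF \<omega>]
          by (intro mult_left_mono) (auto simp: br_def D_def)
        also have "\<dots> \<le> Cf * (C1 * (rate D / (ln (gauge_scale / D) * (ln (ln (gauge_scale / D)))\<^sup>2)))"
          using C1(2)[OF D0 D(2)] Cf(1) by (intro mult_left_mono) auto
        also have "\<dots> = C * (rate D / (M * (ln (gauge_scale / D) * (ln (ln (gauge_scale / D)))\<^sup>2)))"
          using M by (simp add: C_def)
        also have "\<dots> \<le> C * (log_gauge \<bar>a - b\<bar> - log_gauge D)"
          using D D0 ab C rate_nonneg[of D] rate_mono[of D 1]
          by (intro mult_left_mono gauge_increment) (auto simp: M_def)
        finally show ?thesis by (simp add: D_def right_diff_distrib)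
      qed
    qed
  qed
  then show ?thesis using C by blast
qed

text \<open>A member of the cone with values at most \<open>K\<close> varies by at most \<open>K * (exp (\<Psi> d) - 1)\<close>.\<close>

lemma (in transfer_cone) h_modulus:
  assumes "C > 0" and bound: "\<And>d. 0 \<le> d \<Longrightarrow> d \<le> 1 \<Longrightarrow> \<Psi> d \<le> C * \<Omega> d"
  shows "h \<in> modulus_space \<Omega>"
proof -
  have diff: "h x - h y \<le> K * (K * C) * \<Omega> (dist x y)" for x y
  proof -
    define t where "t = \<Psi> (dist x y)"
    have d: "0 \<le> dist x y" "dist x y \<le> 1" using dist_circle_le_half[of x y] by auto
    have t: "0 \<le> t" unfolding t_def by (rule \<Psi>_nonneg[OF d])
    have "1 - t \<le> exp (- t)" using exp_ge_add_one_self[of "- t"] by simp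
    then have "exp t * (1 - t) \<le> exp t * exp (- t)" by (intro mult_left_mono) auto
    then have "exp t - 1 \<le> exp t * t" by (simp add: exp_minus algebra_simps)
    also have "\<dots> \<le> K * (C * \<Omega> (dist x y))"
      using exp_\<Psi>_dist(2)[of x y] bound[OF d] t K_pos by (intro mult_mono) (auto simp: t_def)
    finally have e: "exp t - 1 \<le> K * (C * \<Omega> (dist x y))" .
    have "h x - h y \<le> h y * (exp t - 1)" using cone_le[OF h_cone, of x y] by (simp add: t_def algebra_simps)
    also have "\<dots> \<le> K * (K * (C * \<Omega> (dist x y)))"
      using h_bounds(1)[of y] h_pos[of y] e t K_pos by (intro mult_mono) auto
    finally show ?thesis by (simp add: mult_ac)
  qed
  have "\<bar>h x - h y\<bar> \<le> K * (K * C) * \<Omega> (dist x y)" for x y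
    using diff[of x y] diff[of y x] by (simp add: dist_commute abs_le_iff)
  then show ?thesis using assms(1) K_pos unfolding modulus_space_def by (auto intro!: exI[of _ "K * (K * C)"])
qed

lemma (in transfer_cone) simple_real:
  assumes \<Omega>: "\<Omega> \<in> concave_moduli" and h: "h \<in> modulus_space \<Omega>"
  shows "is_simple_eigenvalue (modulus_space \<Omega>) L \<rho>"
proof (rule simple_eigenvalue_of_convergence[where h = h and J = "integral\<^sup>L conf" and ?x0.0 = base
      and F' = "{\<phi>. continuous_on UNIV \<phi>}"])
  show "L (\<lambda>x. a * \<phi> x + b * \<psi> x) = (\<lambda>x. a * L \<phi> x + b * L \<psi> x)" for a b \<phi> \<psi> by (rule L_lincomb)
  show "modulus_space \<Omega> \<subseteq> {\<phi>. continuous_on UNIV \<phi>}" using modulus_space_continuous[OF \<Omega>] by blast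
  show "(\<lambda>x. L \<phi> x - \<rho> * \<phi> x) \<in> {\<phi>. continuous_on UNIV \<phi>}" if "\<phi> \<in> {\<phi>. continuous_on UNIV \<phi>}" for \<phi>
    using that L_continuous by (auto intro!: continuous_intros)
  show "(\<lambda>x. a * h x) \<in> modulus_space \<Omega>" for a
  proof -
    obtain C where C: "C > 0" "\<And>x y. \<bar>h x - h y\<bar> \<le> C * \<Omega> (dist x y)" using h unfolding modulus_space_def by auto
    have "\<bar>a * h x - a * h y\<bar> \<le> (\<bar>a\<bar> + 1) * C * \<Omega> (dist x y)" for x y
    proof -
      have "\<bar>a * h x - a * h y\<bar> = \<bar>a\<bar> * \<bar>h x - h y\<bar>" by (simp add: abs_mult right_diff_distrib[symmetric])
      also have "\<dots> \<le> (\<bar>a\<bar> + 1) * (C * \<Omega> (dist x y))" using C(2)[of x y] by (intro mult_mono) auto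
      finally show ?thesis by simp
    qed
    then show ?thesis using C(1) unfolding modulus_space_def
      by (auto intro!: exI[of _ "(\<bar>a\<bar> + 1) * C"])
  qed
qed (use h_pos[of base] \<rho>_pos convergence_pointwise L_h in auto)

lemma (in transfer_cone) dual_conf: "dual_transfer T f conf (scale_measure (ennreal \<rho>) conf)"
proof -
  have eq: "scale_measure (ennreal \<rho>) conf = density conf (\<lambda>_. ennreal \<rho>)"
    by (rule measure_eqI) (auto simp: emeasure_density_const)
  have "emeasure (scale_measure (ennreal \<rho>) conf) UNIV \<noteq> \<infinity>"
    using nu.emeasure_space_1 by (simp add: ennreal_mult_eq_top_iff)
  then have fin: "finite_measure (scale_measure (ennreal \<rho>) conf)"
    by (intro finite_measureI) (simp add: space_scale_measure)
  have "integral\<^sup>L (scale_measure (ennreal \<rho>) conf) \<phi> = integral\<^sup>L conf (L \<phi>)"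
    if "continuous_on UNIV \<phi>" for \<phi> :: "circle \<Rightarrow> real"
    unfolding eq integral_L[OF that] using \<rho>_pos borel_measurable_continuous_onI[OF that]
    by (subst integral_density) auto
  then show ?thesis unfolding dual_transfer_def using fin nu.finite_measure_axioms by simp
qed

theorem corollary5:
  fixes k :: nat and A :: real
    and S :: "circle \<Rightarrow> circle" and W \<omega> \<Omega> :: "real \<Rightarrow> real" and f :: "circle \<Rightarrow> real"
  assumes "k \<ge> 1"
    and "in_family S W"
    and "A > 0"
    and "\<forall>\<^sub>F x in at_right 0. W x = A * inverse (iter_log k (1 / x))"
    and "\<omega> \<in> concave_moduli" and "\<Omega> \<in> concave_moduli"
    and "\<forall>\<^sub>F x in at_right 0. \<omega> x =
           inverse (iter_log k (1 / x)) * inverse (ln (1 / x)) * inverse ((iter_log 2 (1 / x))\<^sup>2)"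
    and "\<forall>\<^sub>F x in at_right 0. \<Omega> x = inverse (iter_log 2 (1 / x))"
    and "continuous_on UNIV f" and "f \<in> modulus_space \<omega>"
  shows "\<exists>(\<nu> :: circle measure) (\<rho> :: real) (h :: circle \<Rightarrow> real).
    sets \<nu> = sets borel \<and> prob_space \<nu> \<and> \<rho> > 0 \<and>
    dual_transfer S f \<nu> (scale_measure (ennreal \<rho>) \<nu>) \<and>

    is_simple_eigenvalue (modulus_space \<Omega>) (transfer_op S f) \<rho> \<and>
    is_simple_eigenvalue {\<phi> :: circle \<Rightarrow> complex. continuous_on UNIV \<phi>}
      (transfer_op S f) (of_real \<rho>) \<and>
    h \<in> modulus_space \<Omega> \<and> (\<forall>x. h x > 0) \<and> transfer_op S f h = (\<lambda>x. \<rho> * h x) \<and>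

    \<not> (\<exists>c :: complex. c \<noteq> of_real \<rho> \<and> cmod c \<ge> \<rho> \<and>
          is_eigenvalue {\<phi> :: circle \<Rightarrow> complex. continuous_on UNIV \<phi>} (transfer_op S f) c) \<and>

    integral\<^sup>L \<nu> h = 1 \<and>
    (\<forall>\<phi> :: circle \<Rightarrow> real. continuous_on UNIV \<phi> \<longrightarrow>
       uniform_limit UNIV (\<lambda>n x. inverse (\<rho> ^ n) * (transfer_op S f ^^ n) \<phi> x)
         (\<lambda>x. h x * integral\<^sup>L \<nu> \<phi>) sequentially) \<and>

    (let \<mu> = density \<nu> (\<lambda>x. ennreal (h x)) in
       \<mu> \<in> invariant_probs S \<and>
       metric_entropy \<mu> S + ereal (integral\<^sup>L \<mu> f) = ereal (ln \<rho>) \<and>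
       ereal (ln \<rho>) = pressure S f \<and>
       (\<forall>m\<in>invariant_probs S. m \<noteq> \<mu> \<longrightarrow>
          metric_entropy m S + ereal (integral\<^sup>L m f) < pressure S f) \<and>
       gibbs_bounds S f (real_of_ereal (pressure S f)) \<mu>)"
proof -
  have S: "S = circle_map W" using assms(2) by (simp add: in_family_def)
  obtain C where C: "C > 0" "transfer_cone W f (\<lambda>d. C * log_gauge d)"
    using transfer_coneI[OF assms(2)[unfolded S] assms(3,4,5,7,9,10)] by blast
  interpret transfer_cone W f "\<lambda>d. C * log_gauge d" by (rule C(2))
  obtain C' where C': "C' > 0" "\<And>d. 0 \<le> d \<Longrightarrow> d \<le> 1 \<Longrightarrow> log_gauge d \<le> C' * \<Omega> d"
    using eigenfunction_modulus_bound[OF assms(6,8)] by auto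
  have hm: "h \<in> modulus_space \<Omega>"
  proof (rule h_modulus[of "C * C'"])
    show "0 < C * C'" using C C' by simp
    show "C * log_gauge d \<le> C * C' * \<Omega> d" if "0 \<le> d" "d \<le> 1" for d
      using mult_left_mono[OF C'(2)[OF that], of C] C(1) by simp
  qed
  have p: "real_of_ereal (pressure S f) = ln \<rho>"
    unfolding S variational_principle(2)[symmetric] by simp
  show ?thesis
    unfolding S Let_def mu_def[symmetric] p[unfolded S]
  proof (intro exI conjI allI ballI impI)
    show "sets conf = sets borel" "prob_space conf" by (rule conf_props)+
    show "\<rho> > 0" by (rule \<rho>_pos)
    show "dual_transfer T f conf (scale_measure (ennreal \<rho>) conf)" by (rule dual_conf)
    show "is_simple_eigenvalue (modulus_space \<Omega>) L \<rho>" by (rule simple_real[OF assms(6) hm])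
    show "is_simple_eigenvalue {\<phi> :: circle \<Rightarrow> complex. continuous_on UNIV \<phi>} LC (of_real \<rho>)" by (rule simple_complex)
    show "h \<in> modulus_space \<Omega>" by (rule hm)
    show "0 < h x" for x by (rule h_pos)
    show "L h = (\<lambda>x. \<rho> * h x)" by (rule L_h)
    show "\<not> (\<exists>c. c \<noteq> of_real \<rho> \<and> cmod c \<ge> \<rho> \<and> is_eigenvalue {\<phi> :: circle \<Rightarrow> complex. continuous_on UNIV \<phi>} LC c)"
      using no_other_peripheral_eigenvalue by blast
    show "integral\<^sup>L conf h = 1" by (rule integral_h)
    show "uniform_limit UNIV (\<lambda>n x. inverse (\<rho> ^ n) * (L ^^ n) \<phi> x) (\<lambda>x. h x * integral\<^sup>L conf \<phi>) sequentially"
      if "continuous_on UNIV \<phi>" for \<phi> by (rule convergence_uniform_limit[OF that])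
    show "density conf (\<lambda>x. ennreal (h x)) \<in> invariant_probs T" unfolding mu_def[symmetric] by (rule mu_invariant)
    show "metric_entropy (density conf (\<lambda>x. ennreal (h x))) T + ereal (integral\<^sup>L (density conf (\<lambda>x. ennreal (h x))) f) = ereal (ln \<rho>)"
      unfolding mu_def[symmetric] by (rule variational_principle(1))
    show "ereal (ln \<rho>) = pressure T f" by (rule variational_principle(2))
    show "metric_entropy m T + ereal (integral\<^sup>L m f) < pressure T f"
      if "m \<in> invariant_probs T" "m \<noteq> density conf (\<lambda>x. ennreal (h x))" for m
      using variational_principle(3)[OF that(1)] that(2) unfolding variational_principle(2)[symmetric] mu_def[symmetric] by blast
    show "gibbs_bounds T f (ln \<rho>) (density conf (\<lambda>x. ennreal (h x)))" unfolding mu_def[symmetric] by (rule gibbs)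
  qed
qed

end
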